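(* Fix line search parameters $\alpha,\beta$ with $0<\alpha<\beta<1$ and $\alpha<\frac12$. There is a constant $K>0$ depending only on $\alpha$ and $\beta$ such that the following holds. Let $f:\mathbb{R}^d\to\mathbb{R}$ be twice differentiable and $\mu$-strongly convex with $\mu>0$, let $\nabla f$ be Lipschitz continuous with constant $L>0$, and let $\nabla^2 f$ be Lipschitz continuous with constant $M>0$ (i.e. $\|\nabla^2f(x)-\nabla^2f(y)\|\le M\|x-y\|$ for all $x,y$). Let $\kappa=L/\mu$ and let $x_*$ be the minimizer of $f$. Let $\{x_t\}_{t\ge0}$ be generated by BFGS from any $x_0\in\mathbb{R}^d$ with $B_0=LI$, where at every iteration the step size satisfies the Armijo-Wolfe conditions with parameters $\alpha,\beta$, and the unit step size is chosen whenever it satisfies these conditions. Then for every $\epsilon\in(0,1)$, one has $\frac{f(x_t)-f(x_* )}{f(x_0)-f(x_* )}\le\epsilon$ for every integer $$t\ge K\min\left\{\kappa\log\frac1\epsilon,\ (d+C_0)\kappa+\log\frac1\epsilon,\ \frac{\log\frac1\epsilon}{\log\left(\frac12+\sqrt{\frac14+\frac1{d\kappa+C_0\kappa}\log\frac1\epsilon}\right)}\right\}.$$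
   Context: BFGS method: given $x_0\in\mathbb{R}^d$ and a symmetric positive definite $B_0\in\mathbb{R}^{d\times d}$, for $t\ge0$ set $g_t=\nabla f(x_t)$, $d_t=-B_t^{-1}g_t$, $x_{t+1}=x_t+\eta_t d_t$ with step size $\eta_t>0$, $s_t=x_{t+1}-x_t$, $y_t=\nabla f(x_{t+1})-\nabla f(x_t)$, and $$B_{t+1}=B_t-\frac{B_ts_ts_t^\top B_t}{s_t^\top B_ts_t}+\frac{y_ty_t^\top}{s_t^\top y_t}.$$ The iterates are assumed non-optimal ($g_t\neq0$), so that all quantities are well defined. Armijo-Wolfe conditions on $\eta_t$, with parameters $\alpha,\beta$: $$f(x_t+\eta_td_t)\le f(x_t)+\alpha\eta_t\nabla f(x_t)^\top d_t,\qquad \nabla f(x_t+\eta_td_t)^\top d_t\ge\beta\nabla f(x_t)^\top d_t.$$ $C_t:=\frac{M}{\mu^{3/2}}\sqrt{2(f(x_t)-f(x_* ))}$ for $t\ge0$. *)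

theory Defs
  imports Complex_Main "Jordan_Normal_Form.Gauss_Jordan_Elimination"
begin

(* Vectors of R^d are elements of carrier_vec d, so that the dimension d is an ordinary
   natural number and can be quantified after a constant that must not depend on it.
   Functions on R^d are only ever constrained on carrier_vec d. *)

definition vnorm :: "real vec \<Rightarrow> real" where
  "vnorm v = sqrt (v \<bullet> v)"

(* Spectral norm. The quotient is 0 at v = 0, since x / 0 = 0. *)
definition op_norm :: "real mat \<Rightarrow> real" where
  "op_norm A = (SUP v \<in> carrier_vec (dim_col A). vnorm (A *\<^sub>v v) / vnorm v)"

definition outer :: "real vec \<Rightarrow> real vec \<Rightarrow> real mat" where
  "outer u v = mat (dim_vec u) (dim_vec v) (\<lambda>(i, j). u $ i * v $ j)"

(* Frechet differentiability at x, the derivative being represented by a vector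
   (for scalar functions) or by the Jacobian matrix (for vector fields). *)

definition has_gradient_at :: "nat \<Rightarrow> (real vec \<Rightarrow> real) \<Rightarrow> real vec \<Rightarrow> real vec \<Rightarrow> bool" where
  "has_gradient_at d f g x \<longleftrightarrow> g \<in> carrier_vec d \<and>
     (\<forall>e>0. \<exists>\<delta>>0. \<forall>h\<in>carrier_vec d. vnorm h < \<delta> \<longrightarrow>
        \<bar>f (x + h) - f x - g \<bullet> h\<bar> \<le> e * vnorm h)"

definition has_jacobian_at ::
    "nat \<Rightarrow> (real vec \<Rightarrow> real vec) \<Rightarrow> real mat \<Rightarrow> real vec \<Rightarrow> bool" where
  "has_jacobian_at d F J x \<longleftrightarrow> J \<in> carrier_mat d d \<and>
     (\<forall>e>0. \<exists>\<delta>>0. \<forall>h\<in>carrier_vec d. vnorm h < \<delta> \<longrightarrow>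
        vnorm (F (x + h) - F x - J *\<^sub>v h) \<le> e * vnorm h)"

(* f is twice differentiable on R^d with gradient Df and Hessian Hf *)
definition twice_differentiable ::
    "nat \<Rightarrow> (real vec \<Rightarrow> real) \<Rightarrow> (real vec \<Rightarrow> real vec) \<Rightarrow> (real vec \<Rightarrow> real mat) \<Rightarrow> bool" where
  "twice_differentiable d f Df Hf \<longleftrightarrow>
     (\<forall>x\<in>carrier_vec d. has_gradient_at d f (Df x) x \<and> has_jacobian_at d Df (Hf x) x)"

definition strongly_convex :: "nat \<Rightarrow> real \<Rightarrow> (real vec \<Rightarrow> real) \<Rightarrow> bool" where
  "strongly_convex d \<mu> f \<longleftrightarrow>
     (\<forall>x\<in>carrier_vec d. \<forall>y\<in>carrier_vec d. \<forall>u\<in>{0..1}.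
        f ((1 - u) \<cdot>\<^sub>v x + u \<cdot>\<^sub>v y)
          \<le> (1 - u) * f x + u * f y - \<mu> / 2 * u * (1 - u) * (vnorm (x - y))\<^sup>2)"

definition lipschitz_gradient :: "nat \<Rightarrow> real \<Rightarrow> (real vec \<Rightarrow> real vec) \<Rightarrow> bool" where
  "lipschitz_gradient d L Df \<longleftrightarrow>
     (\<forall>x\<in>carrier_vec d. \<forall>y\<in>carrier_vec d. vnorm (Df x - Df y) \<le> L * vnorm (x - y))"

definition lipschitz_hessian :: "nat \<Rightarrow> real \<Rightarrow> (real vec \<Rightarrow> real mat) \<Rightarrow> bool" where
  "lipschitz_hessian d M Hf \<longleftrightarrow>
     (\<forall>x\<in>carrier_vec d. \<forall>y\<in>carrier_vec d. op_norm (Hf x - Hf y) \<le> M * vnorm (x - y))"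

definition is_minimizer :: "nat \<Rightarrow> (real vec \<Rightarrow> real) \<Rightarrow> real vec \<Rightarrow> bool" where
  "is_minimizer d f z \<longleftrightarrow> z \<in> carrier_vec d \<and> (\<forall>y\<in>carrier_vec d. f z \<le> f y)"

(* -B^{-1} g; mat_inverse returns None exactly for singular B, which does not occur
   along BFGS iterations started at a symmetric positive definite matrix *)
definition bfgs_direction :: "real mat \<Rightarrow> real vec \<Rightarrow> real vec" where
  "bfgs_direction B g = - (the (mat_inverse B) *\<^sub>v g)"

definition bfgs_update :: "real mat \<Rightarrow> real vec \<Rightarrow> real vec \<Rightarrow> real mat" where
  "bfgs_update B s y =
     B - (1 / (s \<bullet> (B *\<^sub>v s))) \<cdot>\<^sub>m (B * outer s s * B) + (1 / (s \<bullet> y)) \<cdot>\<^sub>m outer y y"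

definition bfgs_iterates ::
    "nat \<Rightarrow> (real vec \<Rightarrow> real vec) \<Rightarrow> real mat
      \<Rightarrow> (nat \<Rightarrow> real vec) \<Rightarrow> (nat \<Rightarrow> real mat) \<Rightarrow> (nat \<Rightarrow> real) \<Rightarrow> bool" where
  "bfgs_iterates d Df B0 x B \<eta> \<longleftrightarrow>
     x 0 \<in> carrier_vec d \<and> B 0 = B0 \<and>
     (\<forall>t. Df (x t) \<noteq> 0\<^sub>v d \<and> \<eta> t > 0 \<and>
          x (Suc t) = x t + \<eta> t \<cdot>\<^sub>v bfgs_direction (B t) (Df (x t)) \<and>
          B (Suc t) = bfgs_update (B t) (x (Suc t) - x t) (Df (x (Suc t)) - Df (x t)))"

(* The step size a satisfies the conditions at the point x in the direction p. *)
definition armijo_wolfe ::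
    "real \<Rightarrow> real \<Rightarrow> (real vec \<Rightarrow> real) \<Rightarrow> (real vec \<Rightarrow> real vec) \<Rightarrow> real vec \<Rightarrow> real vec \<Rightarrow> real \<Rightarrow> bool"
  where
  "armijo_wolfe \<alpha> \<beta> f Df x p a \<longleftrightarrow>
     f (x + a \<cdot>\<^sub>v p) \<le> f x + \<alpha> * a * (Df x \<bullet> p) \<and>
     Df (x + a \<cdot>\<^sub>v p) \<bullet> p \<ge> \<beta> * (Df x \<bullet> p)"

definition armijo_wolfe_unit_first ::
    "real \<Rightarrow> real \<Rightarrow> (real vec \<Rightarrow> real) \<Rightarrow> (real vec \<Rightarrow> real vec)
      \<Rightarrow> (nat \<Rightarrow> real vec) \<Rightarrow> (nat \<Rightarrow> real mat) \<Rightarrow> (nat \<Rightarrow> real) \<Rightarrow> bool" where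
  "armijo_wolfe_unit_first \<alpha> \<beta> f Df x B \<eta> \<longleftrightarrow>
     (\<forall>t. let p = bfgs_direction (B t) (Df (x t)) in
        armijo_wolfe \<alpha> \<beta> f Df (x t) p (\<eta> t) \<and>
        (armijo_wolfe \<alpha> \<beta> f Df (x t) p 1 \<longrightarrow> \<eta> t = 1))"

(* The paper's C_t, as a function of the iterate x *)
definition C_const :: "real \<Rightarrow> real \<Rightarrow> (real vec \<Rightarrow> real) \<Rightarrow> real vec \<Rightarrow> real vec \<Rightarrow> real" where
  "C_const M \<mu> f z x = M / \<mu> powr (3/2) * sqrt (2 * (f x - f z))"

end

theory Submission
  imports Defs "Jordan_Normal_Form.Schur_Decomposition"
begin

text \<open>
  The idea is to measure the matrices \<open>B\<^sub>t\<close> against a fixed weight \<open>P\<close> with inverse \<open>Q\<close> by the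
  potential \<open>tr (Q B) - d - ln (det (Q B))\<close>. It is nonnegative (\<open>potential_nonneg\<close>), vanishes for
  \<open>B = P\<close>, and changes explicitly under a BFGS update (\<open>potential_bfgs_update\<close>).
  With \<open>r\<^sub>t\<close> the ratio of two successive suboptimality gaps, \<open>1 - r\<^sub>t\<close> is the product of
  a line search factor, of the gradient dominance \<open>g\<^sup>T Q g / gap\<close>, and of
  \<open>(g\<^sup>T s)\<^sup>2 / ((g\<^sup>T Q g) (s\<^sup>T y))\<close>, the squared cosine between gradient and step
  divided by the curvature along the step, both in the metric \<open>P\<close>. A small last factor makes the potential
  drop, so the sum of its logarithms is bounded below by telescoping (\<open>ln_one_minus_r\<close>). By
  the inequality of arithmetic and geometric means, a lower bound \<open>- A\<close> on
  \<open>\<Sum> ln (1 - r\<^sub>i)\<close> over \<open>t\<close> steps turns into \<open>\<Prod> r\<^sub>i \<le> (1 - exp (- A / t)) ^ t\<close>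
  (\<open>prod_le_of_sum_ln\<close>).

  Two weights are used. For \<open>P = L I\<close> the potential starts at \<open>0\<close> and the Lipschitz gradient makes
  the error terms nonpositive; the outcome is the linear rate \<open>1 - 2 \<alpha> (1 - \<beta>) / \<kappa>\<close>
  (\<open>linear_rate\<close>). Since \<open>C\<^sub>t\<close> is proportional to the square root of the gap, it follows
  that \<open>\<Sum> C\<^sub>t\<close> is at most a multiple of \<open>C\<^sub>0 \<kappa>\<close>.

  For \<open>P\<close> the Hessian at the minimizer the potential starts below \<open>d \<kappa>\<close>
  (\<open>potential_init_le\<close>), and all errors are linear in \<open>C\<^sub>t\<close>, hence summable. The potential also pays for
  \<open>\<omega> (\<rho>\<^sub>t) = \<rho>\<^sub>t - 1 - ln \<rho>\<^sub>t\<close>, where \<open>\<rho>\<^sub>t\<close> compares \<open>B\<^sub>t\<close> with \<open>P\<close>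
  along the step (\<open>omega_rho_le\<close>). If \<open>C\<^sub>t\<close> is small and \<open>\<rho>\<^sub>t\<close> is close to \<open>1\<close>,
  then the unit step is accepted, and its line search factor is at least \<open>exp (- O (C\<^sub>t + \<omega> (\<rho>\<^sub>t))) / 2\<close>,
  where the \<open>1/2\<close> cancels the constant \<open>2\<close> in the gradient dominance. In every other step
  \<open>C\<^sub>t + \<omega> (\<rho>\<^sub>t)\<close> is at least a positive constant and pays for the constant factor lost there (\<open>step_progress\<close>). Therefore
  \<open>\<Sum> ln (1 - r\<^sub>i)\<close> is bounded below by a multiple of \<open>- (d + C\<^sub>0) \<kappa>\<close> that does not
  depend on the number of steps (\<open>sum_ln_ge\<close>), which yields the second and the third term of the minimum
  at once.
\<close>

section \<open>Symmetric positive definite matrices\<close>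

lemma outer_carrier [simp]: "u \<in> carrier_vec m \<Longrightarrow> v \<in> carrier_vec n \<Longrightarrow> outer u v \<in> carrier_mat m n"
  by (auto simp: outer_def)

lemma outer_mult_vec:
  assumes "u \<in> carrier_vec m" "v \<in> carrier_vec n" "x \<in> carrier_vec n"
  shows "outer u v *\<^sub>v x = (v \<bullet> x) \<cdot>\<^sub>v u"
  using assms by (intro eq_vecI) (auto simp: outer_def scalar_prod_def sum_distrib_left mult_ac)

lemma mult_mat_vec_smult_add:
  fixes A :: "real mat"
  assumes "A \<in> carrier_mat m n" "u \<in> carrier_vec n" "v \<in> carrier_vec n"
  shows "A *\<^sub>v (u + c \<cdot>\<^sub>v v) = A *\<^sub>v u + c \<cdot>\<^sub>v (A *\<^sub>v v)"
  using assms by (simp add: mult_add_distrib_mat_vec[of A m n] mult_mat_vec[of A m n])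

lemma smult_mat_vec:
  fixes A :: "real mat"
  assumes "A \<in> carrier_mat m n" "v \<in> carrier_vec n"
  shows "(c \<cdot>\<^sub>m A) *\<^sub>v v = c \<cdot>\<^sub>v (A *\<^sub>v v)"
  using assms by (intro eq_vecI) (auto simp: scalar_prod_def sum_distrib_left mult_ac)

lemma smult_smult_mat: "a \<cdot>\<^sub>m (b \<cdot>\<^sub>m A) = (a * b) \<cdot>\<^sub>m (A :: real mat)"
  by (intro eq_matI) auto

lemma one_smult_mat: "1 \<cdot>\<^sub>m A = (A :: real mat)"
  by (intro eq_matI) auto

lemma mat_eqI_form:
  fixes A B :: "real mat"
  assumes A: "A \<in> carrier_mat d d" and B: "B \<in> carrier_mat d d"
    and eq: "\<And>u v. u \<in> carrier_vec d \<Longrightarrow> v \<in> carrier_vec d \<Longrightarrow> u \<bullet> (A *\<^sub>v v) = u \<bullet> (B *\<^sub>v v)"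
  shows "A = B"
proof (rule eq_matI)
  fix i j assume "i < dim_row B" "j < dim_col B"
  then have "i < d" "j < d" using B by auto
  moreover have "row M i \<bullet> unit_vec d j = M $$ (i, j)" if "M \<in> carrier_mat d d" for M :: "real mat"
    using that \<open>i < d\<close> \<open>j < d\<close> by simp
  ultimately show "A $$ (i, j) = B $$ (i, j)"
    using eq[of "unit_vec d i" "unit_vec d j"] A B by auto
qed (use A B in auto)

lemma form_sym:
  fixes A :: "real mat"
  assumes "A \<in> carrier_mat d d" "A\<^sup>T = A" "u \<in> carrier_vec d" "v \<in> carrier_vec d"
  shows "u \<bullet> (A *\<^sub>v v) = v \<bullet> (A *\<^sub>v u)"
  using transpose_vec_mult_scalar[OF assms(1,4,3)] assms comm_scalar_prod[of "A *\<^sub>v u" d v]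
  by simp

definition spd :: "nat \<Rightarrow> real mat \<Rightarrow> bool" where
  "spd d A \<longleftrightarrow> A \<in> carrier_mat d d \<and> A\<^sup>T = A \<and>
     (\<forall>v\<in>carrier_vec d. v \<noteq> 0\<^sub>v d \<longrightarrow> v \<bullet> (A *\<^sub>v v) > 0)"

lemma spdD:
  assumes "spd d A"
  shows "A \<in> carrier_mat d d" "A\<^sup>T = A"
    "v \<in> carrier_vec d \<Longrightarrow> v \<noteq> 0\<^sub>v d \<Longrightarrow> v \<bullet> (A *\<^sub>v v) > 0"
  using assms by (auto simp: spd_def)

lemma spd_nonneg:
  assumes "spd d A" "v \<in> carrier_vec d" shows "v \<bullet> (A *\<^sub>v v) \<ge> 0"
proof (cases "v = 0\<^sub>v d")
  case True
  have "A *\<^sub>v v \<in> carrier_vec d" using spdD(1)[OF assms(1)] assms(2) by simp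
  then show ?thesis using True scalar_prod_left_zero by auto
qed (use spdD(3)[OF assms(1), of v] assms(2) in auto)

lemma spd_det_nonzero: assumes "spd d A" shows "det A \<noteq> 0"
proof
  assume "det A = 0"
  then obtain v where v: "v \<in> carrier_vec d" "v \<noteq> 0\<^sub>v d" "A *\<^sub>v v = 0\<^sub>v d"
    using det_0_iff_vec_prod_zero_field[OF spdD(1)[OF assms]] by blast
  then show False using spdD(3)[OF assms v(1,2)] by simp
qed

lemma spd_mat_inverse:
  assumes "spd d A"
  obtains Q where "mat_inverse A = Some Q" "A * Q = 1\<^sub>m d" "Q * A = 1\<^sub>m d" "Q \<in> carrier_mat d d"
proof (cases "mat_inverse A")
  case None
  then show ?thesis
    using mat_inverse(1)[OF spdD(1)[OF assms], where b="()"]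
      det_non_zero_imp_unit[OF spdD(1)[OF assms] spd_det_nonzero[OF assms], where b="()"] by auto
qed (use mat_inverse(2)[OF spdD(1)[OF assms]] that in auto)

text \<open>
  The weight of the argument. Only \<open>P\<close> and its inverse occur, never a square root: every
  quantity of the transformed iteration is a quadratic form in \<open>P\<close> or \<open>Q\<close>.
\<close>
definition spd_inverse :: "nat \<Rightarrow> real mat \<Rightarrow> real mat \<Rightarrow> bool" where
  "spd_inverse d P Q \<longleftrightarrow> spd d P \<and> Q \<in> carrier_mat d d \<and> P * Q = 1\<^sub>m d \<and> Q * P = 1\<^sub>m d"

lemma spd_inverseD:
  assumes "spd_inverse d P Q"
  shows "spd d P" "P \<in> carrier_mat d d" "P\<^sup>T = P" "Q \<in> carrier_mat d d" "P * Q = 1\<^sub>m d" "Q * P = 1\<^sub>m d" "Q\<^sup>T = Q"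
proof -
  show *: "spd d P" "P \<in> carrier_mat d d" "P\<^sup>T = P" "Q \<in> carrier_mat d d" "P * Q = 1\<^sub>m d" "Q * P = 1\<^sub>m d"
    using assms by (auto simp: spd_inverse_def spdD)
  have "Q\<^sup>T = Q\<^sup>T * (P * Q)" using * by simp
  also have "\<dots> = Q\<^sup>T * P * Q" using * by (intro assoc_mult_mat[symmetric]) auto
  also have "Q\<^sup>T * P = Q\<^sup>T * P\<^sup>T" unfolding *(3) ..
  also have "Q\<^sup>T * P\<^sup>T = (P * Q)\<^sup>T" using transpose_mult[OF *(2,4)] ..
  also have "\<dots> = 1\<^sub>m d" unfolding *(5) by simp
  finally show "Q\<^sup>T = Q" using * by simp
qed

lemma spd_inverse_cancel:
  assumes "spd_inverse d P Q" "v \<in> carrier_vec d"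
  shows "P *\<^sub>v (Q *\<^sub>v v) = v" "Q *\<^sub>v (P *\<^sub>v v) = v"
  using assms(2) spd_inverseD(4,5,6)[OF assms(1)] spd_inverseD(2)[OF assms(1)]
    assoc_mult_mat_vec[of P d d Q d v] assoc_mult_mat_vec[of Q d d P d v]
  by (metis one_mult_mat_vec)+

lemma spd_inverse_spd:
  assumes "spd_inverse d P Q" shows "spd d Q"
  unfolding spd_def
proof (intro conjI ballI impI)
  fix v :: "real vec" assume v: "v \<in> carrier_vec d" "v \<noteq> 0\<^sub>v d"
  define w where "w = Q *\<^sub>v v"
  have w: "w \<in> carrier_vec d" "P *\<^sub>v w = v"
    using v spd_inverse_cancel[OF assms] spd_inverseD[OF assms] by (auto simp: w_def)
  have "w \<noteq> 0\<^sub>v d" using w v spd_inverseD(2)[OF assms] by auto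
  then have "w \<bullet> (P *\<^sub>v w) > 0" using spdD(3)[OF spd_inverseD(1)[OF assms]] w by blast
  then show "v \<bullet> (Q *\<^sub>v v) > 0" using w v comm_scalar_prod[of w d v] by (simp add: w_def)
qed (use spd_inverseD[OF assms] in auto)

section \<open>Determinant of a rank-one perturbation of the identity\<close>

text \<open>
  Both factorizations of the bordered matrix with blocks \<open>1\<close>, \<open>v\<^sup>T\<close>, \<open>- u\<close>, \<open>I\<close> have the same
  determinant; one ends in \<open>1 + v\<^sup>T u\<close>, the other in \<open>I + u v\<^sup>T\<close>.
\<close>
lemma det_one_plus_outer:
  fixes u v :: "real vec"
  assumes u: "u \<in> carrier_vec n" and v: "v \<in> carrier_vec n"
  shows "det (1\<^sub>m n + outer u v) = 1 + v \<bullet> u"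
proof -
  let ?U = "mat_of_cols n [u]" and ?V = "mat_of_rows n [v]"
  have UV: "?U * ?V = outer u v"
    using u v by (intro eq_matI) (auto simp: outer_def scalar_prod_def mat_of_cols_def mat_of_rows_def)
  have VU: "?V * ?U = mat 1 1 (\<lambda>_. v \<bullet> u)"
    using u v by (intro eq_matI) (auto simp: scalar_prod_def mat_of_cols_def mat_of_rows_def)
  have Uc: "?U \<in> carrier_mat n 1" and Vc: "?V \<in> carrier_mat 1 n" by auto
  let ?L = "four_block_mat (1\<^sub>m 1) (0\<^sub>m 1 n) (- ?U) (1\<^sub>m n)"
  let ?R = "four_block_mat (1\<^sub>m 1) ?V (0\<^sub>m n 1) (1\<^sub>m n + outer u v)"
  let ?S = "four_block_mat (1\<^sub>m 1 + ?V * ?U) ?V (0\<^sub>m n 1) (1\<^sub>m n)"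
  have O: "outer u v \<in> carrier_mat n n" using u v by simp
  have "?L * ?R = four_block_mat (1\<^sub>m 1) ?V (- ?U) (1\<^sub>m n)"
  proof -
    have "?L * ?R = four_block_mat (1\<^sub>m 1 * 1\<^sub>m 1 + 0\<^sub>m 1 n * 0\<^sub>m n 1)
        (1\<^sub>m 1 * ?V + 0\<^sub>m 1 n * (1\<^sub>m n + outer u v)) (- ?U * 1\<^sub>m 1 + 1\<^sub>m n * 0\<^sub>m n 1)
        (- ?U * ?V + 1\<^sub>m n * (1\<^sub>m n + outer u v))"
      by (rule mult_four_block_mat) (use O Uc Vc in auto)
    moreover have "- ?U * ?V + 1\<^sub>m n * (1\<^sub>m n + outer u v) = 1\<^sub>m n"
    proof -
      have "- ?U * ?V = - outer u v" using UV Uc Vc by simp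
      then show ?thesis using O by (intro eq_matI) auto
    qed
    ultimately show ?thesis using O Uc Vc by (simp add: left_add_zero_mat[of _ 1 n])
  qed
  moreover have "?S * ?L = four_block_mat (1\<^sub>m 1) ?V (- ?U) (1\<^sub>m n)"
  proof -
    have "?S * ?L = four_block_mat ((1\<^sub>m 1 + ?V * ?U) * 1\<^sub>m 1 + ?V * (- ?U))
        ((1\<^sub>m 1 + ?V * ?U) * 0\<^sub>m 1 n + ?V * 1\<^sub>m n) (0\<^sub>m n 1 * 1\<^sub>m 1 + 1\<^sub>m n * (- ?U))
        (0\<^sub>m n 1 * 0\<^sub>m 1 n + 1\<^sub>m n * 1\<^sub>m n)"
      by (rule mult_four_block_mat) (use Uc Vc in auto)
    moreover have "(1\<^sub>m 1 + ?V * ?U) * 1\<^sub>m 1 + ?V * (- ?U) = 1\<^sub>m 1"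
    proof -
      have "?V * (- ?U) = - (?V * ?U)" using Uc Vc by simp
      then show ?thesis unfolding VU by (intro eq_matI) auto
    qed
    moreover have "(1\<^sub>m 1 + ?V * ?U) * 0\<^sub>m 1 n = 0\<^sub>m 1 n"
      by (rule right_mult_zero_mat) (use Uc Vc in auto)
    ultimately show ?thesis using Uc Vc by (simp add: left_add_zero_mat[of _ 1 n] left_add_zero_mat[of _ n 1])
  qed
  ultimately have "det (?L * ?R) = det (?S * ?L)" by simp
  moreover have "?L \<in> carrier_mat (1 + n) (1 + n)" "?R \<in> carrier_mat (1 + n) (1 + n)"
    "?S \<in> carrier_mat (1 + n) (1 + n)"
    using O Uc Vc by auto
  ultimately have "det ?L * det ?R = det ?S * det ?L" by (simp add: det_mult[of _ "1+n"])
  moreover have "det ?L = 1"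
    by (subst det_four_block_mat_upper_right_zero[of _ 1 _ n]) (use Uc in auto)
  moreover have "det ?R = det (1\<^sub>m n + outer u v)"
    by (subst det_four_block_mat_lower_left_zero[of _ 1 _ n]) (use O in auto)
  moreover have "det ?S = det (1\<^sub>m 1 + ?V * ?U)"
    by (subst det_four_block_mat_lower_left_zero[of _ 1 _ n]) auto
  moreover have "det (1\<^sub>m 1 + ?V * ?U) = 1 + v \<bullet> u"
    unfolding VU by (subst det_single) auto
  ultimately show ?thesis by simp
qed

section \<open>The log-determinant inequality\<close>

definition mtrace :: "'a::comm_monoid_add mat \<Rightarrow> 'a" where
  "mtrace A = (\<Sum>i<dim_row A. A $$ (i, i))"

lemma mtrace_mult_commute:
  fixes A B :: "'a::comm_semiring_0 mat"
  assumes "A \<in> carrier_mat n n" "B \<in> carrier_mat n n"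
  shows "mtrace (A * B) = mtrace (B * A)"
proof -
  have "mtrace (A * B) = (\<Sum>i<n. \<Sum>j<n. A $$ (i, j) * B $$ (j, i))"
    using assms by (simp add: mtrace_def scalar_prod_def atLeast0LessThan)
  also have "\<dots> = (\<Sum>j<n. \<Sum>i<n. A $$ (i, j) * B $$ (j, i))" by (rule sum.swap)
  also have "\<dots> = mtrace (B * A)"
    using assms by (simp add: mtrace_def scalar_prod_def atLeast0LessThan mult.commute)
  finally show ?thesis .
qed

lemma mtrace_similar:
  fixes A :: "'a::comm_semiring_1 mat"
  assumes "similar_mat_wit A B P Q" shows "mtrace A = mtrace B"
proof -
  obtain n where n: "dim_row A = n" by blast
  note w = similar_mat_witD[OF n[symmetric] assms]
  have "mtrace A = mtrace (Q * (P * B))"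
    unfolding w(3) by (rule mtrace_mult_commute) (use w(5-7) in auto)
  also have "Q * (P * B) = Q * P * B" by (rule assoc_mult_mat[symmetric]) (use w(5-7) in auto)
  also have "\<dots> = B" using w(5) unfolding w(2) by simp
  finally show ?thesis .
qed

lemma map_vec_Re_Im_mult:
  fixes v :: "complex vec"
  assumes "A \<in> carrier_mat m n" "v \<in> carrier_vec n"
  shows "map_vec Re (map_mat complex_of_real A *\<^sub>v v) = A *\<^sub>v map_vec Re v"
    and "map_vec Im (map_mat complex_of_real A *\<^sub>v v) = A *\<^sub>v map_vec Im v"
  using assms by (auto intro!: eq_vecI simp: scalar_prod_def)

text \<open>
  Testing \<open>B v = k P v\<close> with the real and imaginary parts \<open>a\<close>, \<open>b\<close> of \<open>v\<close> and using symmetry gives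
  \<open>Im k (a\<^sup>T P a + b\<^sup>T P b) = 0\<close> and
  \<open>Re k (a\<^sup>T P a + b\<^sup>T P b) = a\<^sup>T B a + b\<^sup>T B b > 0\<close>.
\<close>
lemma pencil_eigenvalue_pos:
  assumes P: "spd d P" and B: "spd d B" and v: "v \<in> carrier_vec d" "v \<noteq> 0\<^sub>v d"
    and eq: "map_mat complex_of_real B *\<^sub>v v = k \<cdot>\<^sub>v (map_mat complex_of_real P *\<^sub>v v)"
  shows "Im k = 0" "Re k > 0"
proof -
  define a where "a = map_vec Re v"
  define b where "b = map_vec Im v"
  note P' = spdD[OF P] and B' = spdD[OF B]
  have ab: "a \<in> carrier_vec d" "b \<in> carrier_vec d" using v by (auto simp: a_def b_def)
  define p where "p = P *\<^sub>v a"
  define q where "q = P *\<^sub>v b"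
  have pq: "p \<in> carrier_vec d" "q \<in> carrier_vec d" using ab P' by (auto simp: p_def q_def)
  let ?w = "map_mat complex_of_real P *\<^sub>v v"
  have w: "?w \<in> carrier_vec d" using P' v by simp
  have "map_vec Re (k \<cdot>\<^sub>v ?w) = Re k \<cdot>\<^sub>v map_vec Re ?w - Im k \<cdot>\<^sub>v map_vec Im ?w"
    "map_vec Im (k \<cdot>\<^sub>v ?w) = Re k \<cdot>\<^sub>v map_vec Im ?w + Im k \<cdot>\<^sub>v map_vec Re ?w"
    using w by (auto intro!: eq_vecI)
  then have Ba: "B *\<^sub>v a = Re k \<cdot>\<^sub>v p - Im k \<cdot>\<^sub>v q" and Bb: "B *\<^sub>v b = Re k \<cdot>\<^sub>v q + Im k \<cdot>\<^sub>v p"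
    using eq map_vec_Re_Im_mult[OF P'(1) v(1)] map_vec_Re_Im_mult[OF B'(1) v(1)]
    by (simp_all add: a_def b_def p_def q_def)
  have sym: "a \<bullet> q = b \<bullet> p" unfolding p_def q_def by (rule form_sym[OF P'(1,2) ab])
  have aBa: "a \<bullet> (B *\<^sub>v a) = Re k * (a \<bullet> p) - Im k * (a \<bullet> q)"
    and bBb: "b \<bullet> (B *\<^sub>v b) = Re k * (b \<bullet> q) + Im k * (b \<bullet> p)"
    and aBb: "a \<bullet> (B *\<^sub>v b) = Re k * (a \<bullet> q) + Im k * (a \<bullet> p)"
    and bBa: "b \<bullet> (B *\<^sub>v a) = Re k * (b \<bullet> p) - Im k * (b \<bullet> q)"
    unfolding Ba Bb using ab pq
    by (simp_all add: scalar_prod_add_distrib[where n=d] scalar_prod_minus_distrib[where n=d])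
  have "a \<noteq> 0\<^sub>v d \<or> b \<noteq> 0\<^sub>v d"
  proof (rule ccontr)
    assume "\<not> ?thesis"
    then have "\<And>i. i < d \<Longrightarrow> map_vec Re v $ i = 0 \<and> map_vec Im v $ i = 0"
      by (auto simp: a_def b_def)
    then have "\<And>i. i < d \<Longrightarrow> v $ i = 0" using v(1) by (auto simp: complex_eq_iff)
    then show False using v by (auto intro!: eq_vecI)
  qed
  then have pos: "a \<bullet> p + b \<bullet> q > 0" "a \<bullet> (B *\<^sub>v a) + b \<bullet> (B *\<^sub>v b) > 0"
    using spd_nonneg[OF P ab(1)] spd_nonneg[OF P ab(2)] P'(3)[OF ab(1)] P'(3)[OF ab(2)]
      spd_nonneg[OF B ab(1)] spd_nonneg[OF B ab(2)] B'(3)[OF ab(1)] B'(3)[OF ab(2)]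
    unfolding p_def q_def by fastforce+
  have "a \<bullet> (B *\<^sub>v b) = b \<bullet> (B *\<^sub>v a)" by (rule form_sym[OF B'(1,2) ab])
  then have "Im k * (a \<bullet> p + b \<bullet> q) = 0" using aBb bBa sym by (simp add: algebra_simps)
  then show "Im k = 0" using pos by auto
  have "Re k * (a \<bullet> p + b \<bullet> q) > 0" using pos(2) aBa bBb sym by (simp add: algebra_simps)
  then show "Re k > 0" using pos(1) by (simp add: zero_less_mult_iff)
qed

lemma prod_list_le_exp:
  fixes xs :: "real list"
  assumes "\<And>x. x \<in> set xs \<Longrightarrow> x > 0"
  shows "prod_list xs > 0" "ln (prod_list xs) \<le> sum_list xs - length xs"
proof -
  have "prod_list xs > 0 \<and> ln (prod_list xs) \<le> sum_list xs - length xs"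
    using assms
  proof (induction xs)
    case (Cons x xs)
    then have "ln x \<le> x - 1" "x > 0" by (auto intro: ln_le_minus_one)
    then show ?case using Cons by (auto simp: ln_mult algebra_simps)
  qed simp
  then show "prod_list xs > 0" "ln (prod_list xs) \<le> sum_list xs - length xs" by auto
qed

text \<open>
  Trace and determinant of \<open>Q B\<close> are the sum and the product of its complex eigenvalues, read off a
  Schur form. These are eigenvalues of the pencil of \<open>B\<close> and \<open>P\<close>, so they are positive reals, and
  \<open>ln \<lambda> \<le> \<lambda> - 1\<close> can be summed.
\<close>
lemma ln_det_le_trace:
  assumes PQ: "spd_inverse d P Q" and B: "spd d B"
  shows "det (Q * B) > 0" "ln (det (Q * B)) \<le> mtrace (Q * B) - d"
proof -
  note PQ' = spd_inverseD[OF PQ] and B' = spdD[OF B]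
  let ?c = complex_of_real
  define A where "A = Q * B"
  have A: "A \<in> carrier_mat d d" using PQ' B' by (simp add: A_def)
  let ?A = "map_mat ?c A"
  have cA: "?A \<in> carrier_mat d d" using A by simp
  obtain as where as: "char_poly ?A = (\<Prod>a\<leftarrow>as. [:- a, 1:])" "length as = d"
    using char_poly_factorized[OF cA] by blast
  obtain T S S' where dec: "schur_decomposition ?A as = (T, S, S')" by (metis prod_cases3)
  have T: "similar_mat_wit ?A T S S'" "upper_triangular T" "diag_mat T = as"
    using schur_decomposition[OF cA as(1) dec] by auto
  have Tc: "T \<in> carrier_mat d d" using similar_mat_witD2[OF cA T(1)] by simp
  have real: "Im a = 0 \<and> Re a > 0" if a: "a \<in> set as" for a
  proof -
    have "poly (char_poly ?A) a = 0"
      using a unfolding as(1) by (auto simp: poly_prod_list prod_list_zero_iff)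
    then have "eigenvalue ?A a" using eigenvalue_root_char_poly[OF cA] by simp
    then obtain v where v: "v \<in> carrier_vec d" "v \<noteq> 0\<^sub>v d" "?A *\<^sub>v v = a \<cdot>\<^sub>v v"
      using cA A by (auto simp: eigenvalue_def eigenvector_def)
    have "P * A = P * Q * B" unfolding A_def by (rule assoc_mult_mat[symmetric]) (use PQ' B' in auto)
    then have "P * A = B" using PQ' B' by simp
    then have "map_mat ?c B *\<^sub>v v = map_mat ?c P *\<^sub>v (?A *\<^sub>v v)"
      using PQ'(2) A v of_real_hom.mat_hom_mult[of P d d A d, where ?'a = complex] assoc_mult_mat_vec[of "map_mat ?c P" d d ?A d v]
      unfolding \<open>P * A = B\<close> by (simp del: assoc_mult_mat_vec)
    also have "\<dots> = a \<cdot>\<^sub>v (map_mat ?c P *\<^sub>v v)" unfolding v(3) using PQ' v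
      by (simp add: mult_mat_vec[of _ d d])
    finally show ?thesis using pencil_eigenvalue_pos[OF PQ'(1) B v(1,2)] by simp
  qed
  have as_real: "as = map ?c (map Re as)"
    using real by (intro nth_equalityI) (auto simp: complex_eq_iff)
  have "det ?A = prod_list as"
    using det_similar[of ?A T] T det_upper_triangular[OF T(2) Tc] by (auto simp: similar_mat_def)
  also have "\<dots> = ?c (prod_list (map Re as))"
    by (subst as_real) (simp add: of_real_hom.hom_prod_list)
  finally have "det A = prod_list (map Re as)" by (simp add: of_real_hom.hom_det)
  moreover have "mtrace A = sum_list (map Re as)"
  proof -
    have "complex_of_real (mtrace A) = mtrace ?A" using A by (simp add: mtrace_def)
    also have "\<dots> = mtrace T" by (rule mtrace_similar[OF T(1)])
    also have "\<dots> = sum_list as"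
      unfolding T(3)[symmetric] diag_mat_def mtrace_def by (simp add: sum_list_sum_nth atLeast0LessThan)
    finally have "Re (complex_of_real (mtrace A)) = Re (sum_list as)" by (rule arg_cong)
    moreover have "Re (sum_list zs) = sum_list (map Re zs)" for zs by (induction zs) auto
    ultimately show ?thesis by simp
  qed
  ultimately show "det (Q * B) > 0" "ln (det (Q * B)) \<le> mtrace (Q * B) - d"
    using prod_list_le_exp[of "map Re as"] real as(2) by (auto simp: A_def)
qed

text \<open>
  The quadratic form of \<open>Q\<close> at \<open>l P s - z\<close> is nonnegative. With a suitable \<open>l\<close> this is the
  Cauchy-Schwarz inequality between the dual norms of \<open>P\<close> and \<open>Q\<close>.
\<close>
lemma spd_inverse_young:
  assumes PQ: "spd_inverse d P Q" and s: "s \<in> carrier_vec d" and z: "z \<in> carrier_vec d"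
  shows "0 \<le> l\<^sup>2 * (s \<bullet> (P *\<^sub>v s)) - 2 * l * (s \<bullet> z) + z \<bullet> (Q *\<^sub>v z)"
proof -
  note PQ' = spd_inverseD[OF PQ]
  define p where "p = P *\<^sub>v s"
  have p: "p \<in> carrier_vec d" "Q *\<^sub>v p = s" using s PQ' spd_inverse_cancel[OF PQ] by (auto simp: p_def)
  have Qz: "Q *\<^sub>v z \<in> carrier_vec d" using PQ' z by simp
  have "p \<bullet> (Q *\<^sub>v z) = z \<bullet> (Q *\<^sub>v p)" by (rule form_sym[OF PQ'(4,7) p(1) z])
  then have pz: "p \<bullet> (Q *\<^sub>v z) = s \<bullet> z" using p comm_scalar_prod[OF s z] by simp
  have "0 \<le> (z + (- l) \<cdot>\<^sub>v p) \<bullet> (Q *\<^sub>v (z + (- l) \<cdot>\<^sub>v p))"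
    by (rule spd_nonneg[OF spd_inverse_spd[OF PQ]]) (use z p in auto)
  also have "Q *\<^sub>v (z + (- l) \<cdot>\<^sub>v p) = Q *\<^sub>v z + (- l) \<cdot>\<^sub>v s"
    using mult_mat_vec_smult_add[OF PQ'(4) z p(1)] p(2) by simp
  also have "(z + (- l) \<cdot>\<^sub>v p) \<bullet> (Q *\<^sub>v z + (- l) \<cdot>\<^sub>v s)
      = z \<bullet> (Q *\<^sub>v z) - l * (z \<bullet> s) - l * (p \<bullet> (Q *\<^sub>v z)) + l\<^sup>2 * (p \<bullet> s)"
    using s z p(1) Qz
    by (simp add: add_scalar_prod_distrib[where n=d] scalar_prod_add_distrib[where n=d] power2_eq_square algebra_simps)
  also have "p \<bullet> s = s \<bullet> p" by (rule comm_scalar_prod[OF p(1) s])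
  also have "z \<bullet> s = s \<bullet> z" by (rule comm_scalar_prod[OF z s])
  finally show ?thesis unfolding pz by (simp add: p_def)
qed

section \<open>Determinant and definiteness of the BFGS update\<close>

lemma bfgs_update_carrier:
  assumes "B \<in> carrier_mat d d" "s \<in> carrier_vec d" "y \<in> carrier_vec d"
  shows "bfgs_update B s y \<in> carrier_mat d d"
  using assms by (auto simp: bfgs_update_def)

lemma mult_outer_mult:
  assumes B: "B \<in> carrier_mat d d" "B\<^sup>T = B" and s: "s \<in> carrier_vec d"
  shows "B * outer s s * B = outer (B *\<^sub>v s) (B *\<^sub>v s)"
proof (rule mat_eqI_form)
  fix u v :: "real vec" assume uv: "u \<in> carrier_vec d" "v \<in> carrier_vec d"
  have "B * outer s s * B *\<^sub>v v = B *\<^sub>v (outer s s *\<^sub>v (B *\<^sub>v v))"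
    using B s uv by (simp add: assoc_mult_mat_vec[of _ d d _ d])
  also have "\<dots> = (s \<bullet> (B *\<^sub>v v)) \<cdot>\<^sub>v (B *\<^sub>v s)"
    using B s uv by (simp add: outer_mult_vec[of _ d _ d] mult_mat_vec[of _ d d])
  also have "s \<bullet> (B *\<^sub>v v) = (B *\<^sub>v s) \<bullet> v"
    using form_sym[OF B s uv(2)] comm_scalar_prod[of "B *\<^sub>v s" d v] B s uv by simp
  finally show "u \<bullet> (B * outer s s * B *\<^sub>v v) = u \<bullet> (outer (B *\<^sub>v s) (B *\<^sub>v s) *\<^sub>v v)"
    using B s uv by (simp add: outer_mult_vec[of _ d _ d])
qed (use B s in auto)

lemma bfgs_update_form:
  assumes B: "B \<in> carrier_mat d d" "B\<^sup>T = B" and s: "s \<in> carrier_vec d" and y: "y \<in> carrier_vec d"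
    and u: "u \<in> carrier_vec d" and v: "v \<in> carrier_vec d"
  shows "u \<bullet> (bfgs_update B s y *\<^sub>v v) = u \<bullet> (B *\<^sub>v v)
      - (u \<bullet> (B *\<^sub>v s)) * ((B *\<^sub>v s) \<bullet> v) / (s \<bullet> (B *\<^sub>v s)) + (u \<bullet> y) * (y \<bullet> v) / (s \<bullet> y)"
proof -
  let ?z = "B *\<^sub>v s"
  have z: "?z \<in> carrier_vec d" and Bv: "B *\<^sub>v v \<in> carrier_vec d" using B s v by auto
  have "bfgs_update B s y *\<^sub>v v
      = B *\<^sub>v v - (1 / (s \<bullet> ?z) * (?z \<bullet> v)) \<cdot>\<^sub>v ?z + (1 / (s \<bullet> y) * (y \<bullet> v)) \<cdot>\<^sub>v y"
    unfolding bfgs_update_def mult_outer_mult[OF B s]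
    using B z y v
    by (simp add: add_mult_distrib_mat_vec[of _ d d] minus_mult_distrib_mat_vec[of _ d d]
        outer_mult_vec[of _ d _ d] smult_mat_vec[of _ d d] smult_smult_assoc minus_carrier_mat)
  then show ?thesis using Bv z y u
    by (simp add: scalar_prod_add_distrib[where n=d] scalar_prod_minus_distrib[where n=d] mult.commute)
qed

text \<open>
  The product form of the update: \<open>B\<^sub>+ = (I + w s\<^sup>T) B (I + s w\<^sup>T)\<close> with
  \<open>\<tau>\<^sup>2 = s\<^sup>T y / s\<^sup>T B s\<close> and \<open>w = (\<tau> / s\<^sup>T y) y - (1 / s\<^sup>T B s) B s\<close>,
  for which \<open>1 + s\<^sup>T w = \<tau>\<close>. Definiteness and determinant of the update can both be read off it.
\<close>
lemma bfgs_update_factor: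
  assumes B: "spd d B" and s: "s \<in> carrier_vec d" "s \<noteq> 0\<^sub>v d" and y: "y \<in> carrier_vec d" "s \<bullet> y > 0"
  obtains M where "M \<in> carrier_mat d d" "bfgs_update B s y = M\<^sup>T * (B * M)"
    "(det M)\<^sup>2 = (s \<bullet> y) / (s \<bullet> (B *\<^sub>v s))" "det M \<noteq> 0"
proof -
  note B' = spdD(1,2)[OF B]
  define z where "z = B *\<^sub>v s"
  define a where "a = s \<bullet> z"
  define b where "b = s \<bullet> y"
  define t where "t = sqrt (b / a)"
  have a: "a > 0" using spdD(3)[OF B s] by (simp add: a_def z_def)
  have b: "b > 0" using y by (simp add: b_def)
  have t: "t > 0" "t\<^sup>2 = b / a" using a b by (auto simp: t_def)
  have z: "z \<in> carrier_vec d" using B' s by (simp add: z_def)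
  define w where "w = (t / b) \<cdot>\<^sub>v y - (1 / a) \<cdot>\<^sub>v z"
  have w: "w \<in> carrier_vec d" using y z by (auto simp: w_def)
  define M where "M = 1\<^sub>m d + outer s w"
  have M: "M \<in> carrier_mat d d" using s w by (simp add: M_def)
  have Mv: "M *\<^sub>v v = v + (w \<bullet> v) \<cdot>\<^sub>v s" if "v \<in> carrier_vec d" for v
    using that s w unfolding M_def by (simp add: add_mult_distrib_mat_vec[of _ d d] outer_mult_vec[of _ d _ d])
  have wv: "w \<bullet> v = t / b * (y \<bullet> v) - (z \<bullet> v) / a" if "v \<in> carrier_vec d" for v
    using that y z by (simp add: w_def minus_scalar_prod_distrib[where n=d])
  have "bfgs_update B s y = M\<^sup>T * (B * M)"
  proof (rule mat_eqI_form)
    fix u v :: "real vec" assume u: "u \<in> carrier_vec d" and v: "v \<in> carrier_vec d"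
    have Mu: "M *\<^sub>v u \<in> carrier_vec d" and BMv: "B *\<^sub>v (M *\<^sub>v v) \<in> carrier_vec d"
      using M u v B' by auto
    have "M\<^sup>T * (B * M) *\<^sub>v v = M\<^sup>T *\<^sub>v (B *\<^sub>v (M *\<^sub>v v))"
      using B' M v by (simp add: assoc_mult_mat_vec[of _ d d _ d])
    then have "u \<bullet> (M\<^sup>T * (B * M) *\<^sub>v v) = (M\<^sup>T *\<^sub>v (B *\<^sub>v (M *\<^sub>v v))) \<bullet> u"
      using comm_scalar_prod[of u d "M\<^sup>T *\<^sub>v (B *\<^sub>v (M *\<^sub>v v))"] u M BMv by simp
    also have "\<dots> = (B *\<^sub>v (M *\<^sub>v v)) \<bullet> (M *\<^sub>v u)"
      by (rule transpose_vec_mult_scalar[OF M u BMv])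
    also have "B *\<^sub>v (M *\<^sub>v v) = B *\<^sub>v v + (w \<bullet> v) \<cdot>\<^sub>v z"
      using Mv[OF v] mult_mat_vec_smult_add[OF B'(1) v s(1)] by (simp add: z_def)
    also have "(B *\<^sub>v v + (w \<bullet> v) \<cdot>\<^sub>v z) \<bullet> (M *\<^sub>v u)
       = (B *\<^sub>v v) \<bullet> u + (w \<bullet> u) * ((B *\<^sub>v v) \<bullet> s) + (w \<bullet> v) * (z \<bullet> u) + (w \<bullet> v) * (w \<bullet> u) * (z \<bullet> s)"
      unfolding Mv[OF u] using u v s z B'
      by (simp add: add_scalar_prod_distrib[where n=d] scalar_prod_add_distrib[where n=d] algebra_simps)
    also have "(B *\<^sub>v v) \<bullet> s = z \<bullet> v"
      using form_sym[OF B' s(1) v] comm_scalar_prod[of _ d] s v z B' unfolding z_def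
      by (metis mult_mat_vec_carrier)
    also have "(B *\<^sub>v v) \<bullet> u = u \<bullet> (B *\<^sub>v v)" using comm_scalar_prod[of _ d] u v B'
      by (metis mult_mat_vec_carrier)
    also have "z \<bullet> s = a" unfolding a_def by (rule comm_scalar_prod[OF z s(1)])
    also have "u \<bullet> (B *\<^sub>v v) + (w \<bullet> u) * (z \<bullet> v) + (w \<bullet> v) * (z \<bullet> u) + (w \<bullet> v) * (w \<bullet> u) * a
        = u \<bullet> (B *\<^sub>v v) - (z \<bullet> u) * (z \<bullet> v) / a + ((t / b)\<^sup>2 * a) * (y \<bullet> u) * (y \<bullet> v)"
    proof -
      have "(T * p - q / a) * q' + (T * p' - q' / a) * q + (T * p' - q' / a) * (T * p - q / a) * a
          = - (q * q' / a) + (T\<^sup>2 * a) * p * p'" for T p q p' q' :: real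
        using a by (simp add: field_simps power2_eq_square)
      from this[of "t / b" "y \<bullet> u" "z \<bullet> u" "z \<bullet> v" "y \<bullet> v"] show ?thesis
        unfolding wv[OF u] wv[OF v] by linarith
    qed
    also have "(t / b)\<^sup>2 * a = 1 / b"
      using a b t(2) by (simp add: power_divide) (simp add: power2_eq_square)
    also have "u \<bullet> (B *\<^sub>v v) - (z \<bullet> u) * (z \<bullet> v) / a + 1 / b * (y \<bullet> u) * (y \<bullet> v)
        = u \<bullet> (bfgs_update B s y *\<^sub>v v)"
      unfolding bfgs_update_form[OF B' s(1) y(1) u v] z_def[symmetric] a_def[symmetric] b_def[symmetric]
        comm_scalar_prod[OF u z] comm_scalar_prod[OF u y(1)]
      by simp
    finally show "u \<bullet> (bfgs_update B s y *\<^sub>v v) = u \<bullet> (M\<^sup>T * (B * M) *\<^sub>v v)" ..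
  qed (use bfgs_update_carrier[OF B'(1) s(1) y(1)] M B' in auto)
  moreover have "det M = t"
  proof -
    have "det M = 1 + w \<bullet> s" unfolding M_def by (rule det_one_plus_outer[OF s(1) w])
    also have "\<dots> = t" unfolding wv[OF s(1)] comm_scalar_prod[OF z s(1)] comm_scalar_prod[OF y(1) s(1)]
        a_def[symmetric] b_def[symmetric] using a b by simp
    finally show ?thesis .
  qed
  ultimately show thesis using M t that[of M] by (simp add: a_def b_def z_def)
qed

lemma det_bfgs_update:
  assumes B: "spd d B" and s: "s \<in> carrier_vec d" "s \<noteq> 0\<^sub>v d" and y: "y \<in> carrier_vec d" "s \<bullet> y > 0"
  shows "det (bfgs_update B s y) = (s \<bullet> y) / (s \<bullet> (B *\<^sub>v s)) * det B"
proof -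
  obtain M where M: "M \<in> carrier_mat d d" "bfgs_update B s y = M\<^sup>T * (B * M)"
    "(det M)\<^sup>2 = (s \<bullet> y) / (s \<bullet> (B *\<^sub>v s))"
    using bfgs_update_factor[OF assms] by metis
  have "det (M\<^sup>T * (B * M)) = det M * (det B * det M)"
    using M(1) spdD(1)[OF B] by (simp add: det_mult[of _ d] det_transpose[of _ d])
  then show ?thesis unfolding M(2) M(3)[symmetric] by (simp add: power2_eq_square)
qed

lemma spd_bfgs_update:
  assumes B: "spd d B" and s: "s \<in> carrier_vec d" "s \<noteq> 0\<^sub>v d" and y: "y \<in> carrier_vec d" "s \<bullet> y > 0"
  shows "spd d (bfgs_update B s y)"
  unfolding spd_def
proof (intro conjI ballI impI)
  let ?A = "bfgs_update B s y"
  obtain M where M: "M \<in> carrier_mat d d" "?A = M\<^sup>T * (B * M)" "det M \<noteq> 0"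
    using bfgs_update_factor[OF assms] by metis
  note B' = spdD(1,2)[OF B]
  show "?A \<in> carrier_mat d d" using bfgs_update_carrier B' s y by blast
  have "?A\<^sup>T = (B * M)\<^sup>T * M" unfolding M(2) using M(1) B' by (subst transpose_mult[of _ d d _ d]) auto
  also have "(B * M)\<^sup>T = M\<^sup>T * B" using transpose_mult[OF B'(1) M(1)] B' by simp
  also have "M\<^sup>T * B * M = M\<^sup>T * (B * M)" by (rule assoc_mult_mat) (use M(1) B' in auto)
  finally show "?A\<^sup>T = ?A" using M by simp
  fix v :: "real vec" assume v: "v \<in> carrier_vec d" "v \<noteq> 0\<^sub>v d"
  have Mv: "M *\<^sub>v v \<in> carrier_vec d" "M *\<^sub>v v \<noteq> 0\<^sub>v d"
    using M(1,3) v det_0_iff_vec_prod_zero_field[OF M(1)] by auto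
  have BMv: "B *\<^sub>v (M *\<^sub>v v) \<in> carrier_vec d" using B' Mv by simp
  have "?A *\<^sub>v v = M\<^sup>T *\<^sub>v (B *\<^sub>v (M *\<^sub>v v))"
    unfolding M(2) using B' M(1) v by (simp add: assoc_mult_mat_vec[of _ d d _ d])
  then have "v \<bullet> (?A *\<^sub>v v) = (M\<^sup>T *\<^sub>v (B *\<^sub>v (M *\<^sub>v v))) \<bullet> v"
    using comm_scalar_prod[of v d "M\<^sup>T *\<^sub>v (B *\<^sub>v (M *\<^sub>v v))"] v M BMv by simp
  also have "\<dots> = (B *\<^sub>v (M *\<^sub>v v)) \<bullet> (M *\<^sub>v v)" by (rule transpose_vec_mult_scalar[OF M(1) v(1) BMv])
  also have "\<dots> = (M *\<^sub>v v) \<bullet> (B *\<^sub>v (M *\<^sub>v v))" by (rule comm_scalar_prod[OF BMv Mv(1)])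
  also have "\<dots> > 0" by (rule spdD(3)[OF B Mv])
  finally show "v \<bullet> (?A *\<^sub>v v) > 0" .
qed

section \<open>The trace-determinant potential\<close>

text \<open>
  The log-det divergence (Stein loss) of \<open>B\<close> from the inverse of \<open>Q\<close>.
\<close>
definition potential :: "nat \<Rightarrow> real mat \<Rightarrow> real mat \<Rightarrow> real" where
  "potential d Q B = mtrace (Q * B) - d - ln (det (Q * B))"

lemma potential_nonneg:
  assumes "spd_inverse d P Q" "spd d B" shows "potential d Q B \<ge> 0"
  using ln_det_le_trace[OF assms] by (simp add: potential_def)

lemma mtrace_mult_outer:
  assumes "Q \<in> carrier_mat d d" "u \<in> carrier_vec d" "v \<in> carrier_vec d"
  shows "mtrace (Q * outer u v) = v \<bullet> (Q *\<^sub>v u)"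
  using assms by (simp add: mtrace_def outer_def scalar_prod_def atLeast0LessThan sum_distrib_left mult_ac)

lemma mtrace_linear:
  fixes X Y Z :: "real mat"
  assumes "X \<in> carrier_mat d d" "Y \<in> carrier_mat d d" "Z \<in> carrier_mat d d" 
  shows "mtrace (X - a \<cdot>\<^sub>m Y + b \<cdot>\<^sub>m Z) = mtrace X - a * mtrace Y + b * mtrace Z"
  using assms by (simp add: mtrace_def sum.distrib sum_subtractf sum_distrib_left)

lemma potential_bfgs_update:
  assumes PQ: "spd_inverse d P Q" and B: "spd d B"
    and s: "s \<in> carrier_vec d" "s \<noteq> 0\<^sub>v d" and y: "y \<in> carrier_vec d" "s \<bullet> y > 0"
  shows "potential d Q (bfgs_update B s y) = potential d Q B
    - (B *\<^sub>v s) \<bullet> (Q *\<^sub>v (B *\<^sub>v s)) / (s \<bullet> (B *\<^sub>v s)) + y \<bullet> (Q *\<^sub>v y) / (s \<bullet> y)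
    - ln ((s \<bullet> y) / (s \<bullet> (B *\<^sub>v s)))"
proof -
  note B' = spdD(1,2)[OF B] and PQ' = spd_inverseD[OF PQ]
  let ?z = "B *\<^sub>v s"
  let ?r = "(s \<bullet> y) / (s \<bullet> ?z)"
  have z: "?z \<in> carrier_vec d" using B' s by simp
  have r: "?r > 0" using spdD(3)[OF B s] y by simp
  have "Q * bfgs_update B s y = Q * B - (1 / (s \<bullet> ?z)) \<cdot>\<^sub>m (Q * outer ?z ?z) + (1 / (s \<bullet> y)) \<cdot>\<^sub>m (Q * outer y y)"
    unfolding bfgs_update_def mult_outer_mult[OF B' s(1)] using B' z y PQ'(4)
    by (simp add: minus_carrier_mat mult_add_distrib_mat[of _ d d _ d] mult_minus_distrib_mat[of _ d d _ d] mult_smult_distrib[of _ d d _ d])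
  then have tr: "mtrace (Q * bfgs_update B s y)
      = mtrace (Q * B) - ?z \<bullet> (Q *\<^sub>v ?z) / (s \<bullet> ?z) + y \<bullet> (Q *\<^sub>v y) / (s \<bullet> y)"
    using B' z y PQ'(4) by (simp add: mtrace_linear[of _ d] mtrace_mult_outer[of _ d])
  have "det (Q * bfgs_update B s y) = ?r * det (Q * B)"
    using det_mult[OF PQ'(4) B'(1)] det_mult[OF PQ'(4) bfgs_update_carrier[OF B'(1) s(1) y(1)]]
      det_bfgs_update[OF B s y] by simp
  then have "ln (det (Q * bfgs_update B s y)) = ln ?r + ln (det (Q * B))"
    using r ln_det_le_trace(1)[OF PQ B] by (simp add: ln_mult_pos del: times_divide_eq_left)
  then show ?thesis using tr by (simp add: potential_def)
qed

text \<open>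
  With \<open>e = (B s)\<^sup>T Q (B s)\<close> and \<open>a = s\<^sup>T B s\<close>, the trace pays \<open>- e / a\<close>; bounding it by
  \<open>- 1 - ln (e / a)\<close> leaves exactly the logarithm of the scale-invariant angle quantity.
\<close>
lemma potential_decrease_angle:
  assumes PQ: "spd_inverse d P Q" and B: "spd d B"
    and s: "s \<in> carrier_vec d" "s \<noteq> 0\<^sub>v d" and y: "y \<in> carrier_vec d" "s \<bullet> y > 0"
  shows "potential d Q (bfgs_update B s y) \<le> potential d Q B + y \<bullet> (Q *\<^sub>v y) / (s \<bullet> y) - 1
    + ln ((s \<bullet> (B *\<^sub>v s))\<^sup>2 / ((B *\<^sub>v s) \<bullet> (Q *\<^sub>v (B *\<^sub>v s)) * (s \<bullet> y)))"
proof -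
  let ?z = "B *\<^sub>v s"
  define a where "a = s \<bullet> ?z"
  define b where "b = s \<bullet> y"
  define e where "e = ?z \<bullet> (Q *\<^sub>v ?z)"
  have z: "?z \<in> carrier_vec d" using spdD(1)[OF B] s by simp
  have a: "a > 0" unfolding a_def by (rule spdD(3)[OF B s])
  have b: "b > 0" using y by (simp add: b_def)
  have "?z \<noteq> 0\<^sub>v d" using a s by (auto simp: a_def)
  then have e: "e > 0" unfolding e_def using spdD(3)[OF spd_inverse_spd[OF PQ]] z by blast
  have "ln (e / a) \<le> e / a - 1" using e a by (intro ln_le_minus_one) auto
  moreover have "ln (a\<^sup>2 / (e * b)) = - ln (b / a) - ln (e / a)"
    using a b e by (simp add: ln_div ln_mult_pos power2_eq_square)
  ultimately show ?thesis
    using potential_bfgs_update[OF assms] unfolding a_def[symmetric] b_def[symmetric] e_def[symmetric] by linarith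
qed

text \<open>
  The other way to spend the term \<open>- e / a\<close> of the trace: by Cauchy-Schwarz it is at most minus the ratio
  of the curvatures of \<open>B\<close> and \<open>P\<close> along the step.
\<close>
lemma potential_decrease_ratio:
  assumes PQ: "spd_inverse d P Q" and B: "spd d B"
    and s: "s \<in> carrier_vec d" "s \<noteq> 0\<^sub>v d" and y: "y \<in> carrier_vec d" "s \<bullet> y > 0"
  shows "potential d Q (bfgs_update B s y) \<le> potential d Q B + y \<bullet> (Q *\<^sub>v y) / (s \<bullet> y)
    - (s \<bullet> (B *\<^sub>v s)) / (s \<bullet> (P *\<^sub>v s)) + ln ((s \<bullet> (B *\<^sub>v s)) / (s \<bullet> y))"
proof -
  let ?z = "B *\<^sub>v s"
  define a where "a = s \<bullet> ?z"
  define b where "b = s \<bullet> y"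
  define e where "e = ?z \<bullet> (Q *\<^sub>v ?z)"
  define p where "p = s \<bullet> (P *\<^sub>v s)"
  have z: "?z \<in> carrier_vec d" using spdD(1)[OF B] s by simp
  have a: "a > 0" unfolding a_def by (rule spdD(3)[OF B s])
  have p: "p > 0" unfolding p_def by (rule spdD(3)[OF spd_inverseD(1)[OF PQ] s])
  have b: "b > 0" using y by (simp add: b_def)
  have "0 \<le> (a / p)\<^sup>2 * p - 2 * (a / p) * a + e"
    using spd_inverse_young[OF PQ s(1) z, of "a / p"] by (simp add: a_def p_def e_def)
  then have "a / p \<le> e / a" using a p by (simp add: field_simps power2_eq_square)
  moreover have "ln (a / b) = - ln (b / a)" using a b by (simp add: ln_div)
  ultimately show ?thesis
    using potential_bfgs_update[OF assms]
    unfolding a_def[symmetric] b_def[symmetric] e_def[symmetric] p_def[symmetric] by linarith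
qed

lemma spd_inverse_scaled_one:
  assumes "c > 0" shows "spd_inverse d (c \<cdot>\<^sub>m 1\<^sub>m d) ((1 / c) \<cdot>\<^sub>m 1\<^sub>m d)"
proof -
  have "spd d (c \<cdot>\<^sub>m 1\<^sub>m d)"
    unfolding spd_def
  proof (intro conjI ballI impI)
    fix v :: "real vec" assume v: "v \<in> carrier_vec d" "v \<noteq> 0\<^sub>v d"
    have "v \<bullet> v > 0"
    proof (rule ccontr)
      assume "\<not> v \<bullet> v > 0"
      then have "(\<Sum>i<d. (v $ i)\<^sup>2) \<le> 0"
        using v by (simp add: scalar_prod_def atLeast0LessThan power2_eq_square)
      then have "\<forall>i<d. v $ i = 0"
        using sum_nonneg_eq_0_iff[of "{..<d}" "\<lambda>i. (v $ i)\<^sup>2"] sum_nonneg[of "{..<d}" "\<lambda>i. (v $ i)\<^sup>2"] by auto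
      then show False using v by auto
    qed
    then show "0 < v \<bullet> (c \<cdot>\<^sub>m 1\<^sub>m d *\<^sub>v v)" using v assms by (simp add: smult_mat_vec[of _ d d])
  qed (auto intro!: eq_matI)
  then show ?thesis
    using assms by (auto simp: spd_inverse_def mult_smult_assoc_mat[of _ d d _ d] mult_smult_distrib[of _ d d _ d] smult_smult_mat one_smult_mat)
qed

lemma potential_scaled_one: "c \<noteq> 0 \<Longrightarrow> potential d ((1 / c) \<cdot>\<^sub>m 1\<^sub>m d) (c \<cdot>\<^sub>m 1\<^sub>m d) = 0"
proof -
  assume c: "c \<noteq> 0"
  have *: "(1 / c) \<cdot>\<^sub>m 1\<^sub>m d * (c \<cdot>\<^sub>m 1\<^sub>m d) = 1\<^sub>m d"
    using c by (simp add: mult_smult_assoc_mat[of _ d d _ d] mult_smult_distrib[of _ d d _ d]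
        smult_smult_mat one_smult_mat)
  show ?thesis unfolding potential_def * by (simp add: mtrace_def)
qed

text \<open>
  The trace is bounded through the diagonal of \<open>Q\<close>, whose entries are at most \<open>1 / \<mu>\<close>. The
  determinant only helps, since \<open>ln (det (P / L)) \<le> tr (P / L) - d \<le> 0\<close>.
\<close>
lemma potential_init_le:
  assumes PQ: "spd_inverse d P Q" and mu: "\<mu> > 0" and L: "L > 0"
    and lo: "\<And>v. v \<in> carrier_vec d \<Longrightarrow> \<mu> * (v \<bullet> v) \<le> v \<bullet> (P *\<^sub>v v)"
    and hi: "\<And>v. v \<in> carrier_vec d \<Longrightarrow> v \<bullet> (P *\<^sub>v v) \<le> L * (v \<bullet> v)"
  shows "potential d Q (L \<cdot>\<^sub>m 1\<^sub>m d) \<le> d * (L / \<mu>)"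
proof -
  note PQ' = spd_inverseD[OF PQ]
  have QB: "Q * (L \<cdot>\<^sub>m 1\<^sub>m d) = L \<cdot>\<^sub>m Q" using PQ' by (simp add: mult_smult_distrib[of _ d d _ d])
  have diag: "A $$ (i, i) = unit_vec d i \<bullet> (A *\<^sub>v unit_vec d i)" if "A \<in> carrier_mat d d" "i < d" for A :: "real mat" and i
    using that by (simp add: mult_mat_vec_def)
  have Qii: "Q $$ (i, i) \<le> 1 / \<mu>" if i: "i < d" for i
  proof -
    define w where "w = Q *\<^sub>v unit_vec d i"
    have w: "w \<in> carrier_vec d" "P *\<^sub>v w = unit_vec d i"
      using PQ' spd_inverse_cancel[OF PQ] by (auto simp: w_def)
    have wi: "w $ i = Q $$ (i, i)" using i PQ'(4) by (simp add: w_def)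
    have "(w $ i)\<^sup>2 \<le> w \<bullet> w"
    proof -
      have "(w $ i)\<^sup>2 \<le> (\<Sum>j<d. (w $ j)\<^sup>2)" using i by (intro member_le_sum) auto
      then show ?thesis using w by (simp add: scalar_prod_def atLeast0LessThan power2_eq_square)
    qed
    then have "\<mu> * (w $ i)\<^sup>2 \<le> \<mu> * (w \<bullet> w)" using mu by simp
    also have "\<dots> \<le> w \<bullet> (P *\<^sub>v w)" by (rule lo[OF w(1)])
    also have "\<dots> = w $ i" using w i by simp
    finally have "w $ i * (\<mu> * w $ i - 1) \<le> 0" by (simp add: power2_eq_square algebra_simps)
    then have "\<mu> * w $ i \<le> 1 \<or> w $ i \<le> 0" by (auto simp: mult_le_0_iff)
    moreover have "w $ i \<le> 1 / \<mu>" if "w $ i \<le> 0"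
      using that mu by (meson divide_nonneg_pos order_trans zero_le_one)
    ultimately show ?thesis using mu wi by (auto simp: field_simps)
  qed
  have "mtrace (L \<cdot>\<^sub>m Q) = (\<Sum>i<d. L * Q $$ (i, i))" using PQ' by (simp add: mtrace_def)
  also have "\<dots> \<le> (\<Sum>i<d. L * (1 / \<mu>))" using Qii L by (intro sum_mono mult_left_mono) auto
  finally have tr: "mtrace (L \<cdot>\<^sub>m Q) \<le> d * (L / \<mu>)" by simp
  let ?X = "(1 / L) \<cdot>\<^sub>m P"
  have one: "spd_inverse d (1\<^sub>m d) (1\<^sub>m d)"
    using spd_inverse_scaled_one[of 1 d] by (simp add: one_smult_mat)
  have spdX: "spd d ?X" unfolding spd_def
  proof (intro conjI ballI impI)
    fix v :: "real vec" assume v: "v \<in> carrier_vec d" "v \<noteq> 0\<^sub>v d"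
    show "0 < v \<bullet> (?X *\<^sub>v v)" using spdD(3)[OF PQ'(1) v] PQ'(2) v L by (simp add: smult_mat_vec[of _ d d])
  next
    have "?X\<^sup>T = (1 / L) \<cdot>\<^sub>m P\<^sup>T" by (intro eq_matI) auto
    then show "?X\<^sup>T = ?X" using PQ'(3) by simp
  qed (use PQ' in auto)
  have X: "?X \<in> carrier_mat d d" using PQ' by simp
  have "mtrace (1\<^sub>m d * ?X) = (\<Sum>i<d. (1 / L) * P $$ (i, i))" using X PQ' by (simp add: mtrace_def)
  also have "\<dots> \<le> (\<Sum>i<d. 1)"
  proof (intro sum_mono)
    fix i assume "i \<in> {..<d}"
    then have "P $$ (i, i) \<le> L" using diag[OF PQ'(2), of i] hi[of "unit_vec d i"] by simp
    then show "(1 / L) * P $$ (i, i) \<le> 1" using L by simp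
  qed
  finally have "mtrace (1\<^sub>m d * ?X) \<le> d" by simp
  then have "ln (det ?X) \<le> 0" "det ?X > 0"
    using ln_det_le_trace[OF one spdX] unfolding left_mult_one_mat[OF X] by linarith+
  moreover have "det ?X * det (L \<cdot>\<^sub>m Q) = 1"
  proof -
    have "det ?X * det (L \<cdot>\<^sub>m Q) = det (?X * (L \<cdot>\<^sub>m Q))" using X PQ' by (simp add: det_mult[of _ d])
    also have "?X * (L \<cdot>\<^sub>m Q) = 1\<^sub>m d"
      using PQ' L by (simp add: mult_smult_assoc_mat[of _ d d _ d] mult_smult_distrib[of _ d d _ d]
          smult_smult_mat one_smult_mat)
    finally show ?thesis by simp
  qed
  ultimately have "det (L \<cdot>\<^sub>m Q) = inverse (det ?X)" "ln (det ?X) \<le> 0" "det ?X > 0"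
    by (auto simp only: inverse_unique)
  then have "ln (det (L \<cdot>\<^sub>m Q)) \<ge> 0" by (simp only: ln_inverse neg_0_le_iff_le)
  then show ?thesis unfolding potential_def QB using tr by simp
qed

section \<open>Euclidean norm\<close>

lemma scalar_self_nonneg: "v \<bullet> (v::real vec) \<ge> 0"
  by (auto simp: scalar_prod_def intro!: sum_nonneg)

lemma vnorm_nonneg: "vnorm v \<ge> 0"
  by (simp add: vnorm_def scalar_self_nonneg)

lemma vnorm_sq: "(vnorm v)\<^sup>2 = v \<bullet> v"
  by (simp add: vnorm_def scalar_self_nonneg)

lemma spd_inverse_one: "spd_inverse d (1\<^sub>m d) (1\<^sub>m d)"
  using spd_inverse_scaled_one[of 1 d] by (simp add: one_smult_mat)

lemma scalar_self_pos: "v \<in> carrier_vec d \<Longrightarrow> v \<noteq> 0\<^sub>v d \<Longrightarrow> v \<bullet> (v::real vec) > 0"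
  using spdD(3)[OF spd_inverseD(1)[OF spd_inverse_one]] by fastforce

lemma vnorm_zero [simp]: "vnorm (0\<^sub>v d) = 0"
  by (simp add: vnorm_def scalar_prod_def)

lemma vnorm_smult: "vnorm (c \<cdot>\<^sub>v v) = \<bar>c\<bar> * vnorm v"
proof -
  have "(c \<cdot>\<^sub>v v) \<bullet> (c \<cdot>\<^sub>v v) = c\<^sup>2 * (v \<bullet> v)"
    by (simp add: scalar_prod_def sum_distrib_left power2_eq_square mult_ac)
  then show ?thesis by (simp add: vnorm_def real_sqrt_mult)
qed

lemma abs_scalar_prod_le:
  assumes "u \<in> carrier_vec d" "v \<in> carrier_vec d"
  shows "\<bar>u \<bullet> v\<bar> \<le> vnorm u * vnorm v"
proof (cases "u = 0\<^sub>v d")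
  case False
  then have pos: "u \<bullet> u > 0" using scalar_self_pos assms by blast
  define l where "l = (u \<bullet> v) / (u \<bullet> u)"
  have "0 \<le> l\<^sup>2 * (u \<bullet> u) - 2 * l * (u \<bullet> v) + v \<bullet> v"
    using spd_inverse_young[OF spd_inverse_one assms, of l] assms by simp
  also have "\<dots> = v \<bullet> v - (u \<bullet> v)\<^sup>2 / (u \<bullet> u)"
    using pos by (simp add: l_def power2_eq_square field_simps)
  finally have "(u \<bullet> v)\<^sup>2 \<le> (vnorm u * vnorm v)\<^sup>2"
    using pos by (simp add: field_simps vnorm_sq)
  then show ?thesis using abs_le_square_iff[of "u \<bullet> v" "vnorm u * vnorm v"]
    by (simp add: vnorm_nonneg)
qed (use assms in simp)

lemma scalar_self_add:
  assumes "u \<in> carrier_vec d" "v \<in> carrier_vec d"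
  shows "(u + v) \<bullet> (u + v) = u \<bullet> u + 2 * (u \<bullet> v) + v \<bullet> (v::real vec)"
  using assms comm_scalar_prod[OF assms]
  by (simp add: add_scalar_prod_distrib[where n=d] scalar_prod_add_distrib[where n=d])

lemma vnorm_triangle:
  assumes "u \<in> carrier_vec d" "v \<in> carrier_vec d"
  shows "vnorm (u + v) \<le> vnorm u + vnorm v"
proof (rule power2_le_imp_le)
  show "(vnorm (u + v))\<^sup>2 \<le> (vnorm u + vnorm v)\<^sup>2"
    using abs_scalar_prod_le[OF assms]
    by (simp add: vnorm_sq scalar_self_add[OF assms] power2_sum)
qed (simp add: vnorm_nonneg)

text \<open>
  The supremum that defines the operator norm is over a bounded set, by the Frobenius bound; only then
  does it dominate its members.
\<close>
lemma vnorm_mult_le_op_norm: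
  assumes A: "A \<in> carrier_mat d d" and v: "v \<in> carrier_vec d"
  shows "vnorm (A *\<^sub>v v) \<le> op_norm A * vnorm v"
proof (cases "v = 0\<^sub>v d")
  case True
  then have "A *\<^sub>v v = 0\<^sub>v d" using A by auto
  then show ?thesis using True by simp
next
  case False
  define F where "F = sqrt (\<Sum>i<d. row A i \<bullet> row A i)"
  have F: "vnorm (A *\<^sub>v w) \<le> F * vnorm w" if w: "w \<in> carrier_vec d" for w
  proof (rule power2_le_imp_le)
    have "(row A i \<bullet> w)\<^sup>2 \<le> (row A i \<bullet> row A i) * (w \<bullet> w)" if "i < d" for i
    proof -
      have "row A i \<in> carrier_vec d" using A that by auto
      then have "\<bar>row A i \<bullet> w\<bar>\<^sup>2 \<le> (vnorm (row A i) * vnorm w)\<^sup>2"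
        using abs_scalar_prod_le[of "row A i" d w] w by (intro power_mono) auto
      then show ?thesis by (simp add: power_mult_distrib vnorm_sq)
    qed
    then have "(\<Sum>i<d. (row A i \<bullet> w)\<^sup>2) \<le> (\<Sum>i<d. (row A i \<bullet> row A i) * (w \<bullet> w))"
      by (intro sum_mono) auto
    moreover have "(vnorm (A *\<^sub>v w))\<^sup>2 = (\<Sum>i<d. (row A i \<bullet> w)\<^sup>2)"
      unfolding vnorm_sq using A
      by (simp add: scalar_prod_def[of "A *\<^sub>v w"] atLeast0LessThan power2_eq_square)
    moreover have "(F * vnorm w)\<^sup>2 = (\<Sum>i<d. (row A i \<bullet> row A i) * (w \<bullet> w))"
      by (simp add: power_mult_distrib F_def sum_nonneg scalar_self_nonneg vnorm_sq sum_distrib_right)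
    ultimately show "(vnorm (A *\<^sub>v w))\<^sup>2 \<le> (F * vnorm w)\<^sup>2" by simp
  qed (simp add: F_def vnorm_nonneg sum_nonneg scalar_self_nonneg)
  have "bdd_above ((\<lambda>w. vnorm (A *\<^sub>v w) / vnorm w) ` carrier_vec (dim_col A))"
  proof (rule bdd_aboveI2)
    fix w :: "real vec" assume "w \<in> carrier_vec (dim_col A)"
    then have "vnorm (A *\<^sub>v w) \<le> F * vnorm w" using F A by auto
    then show "vnorm (A *\<^sub>v w) / vnorm w \<le> F"
      using vnorm_nonneg[of w] by (cases "vnorm w = 0") (auto simp: F_def divide_le_eq sum_nonneg scalar_self_nonneg)
  qed
  then have "vnorm (A *\<^sub>v v) / vnorm v \<le> op_norm A"
    unfolding op_norm_def using A v by (intro cSUP_upper) auto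
  moreover have "vnorm v > 0" using scalar_self_pos[OF v False] by (simp add: vnorm_def)
  ultimately show ?thesis by (simp add: divide_le_eq)
qed

section \<open>Gradient and Hessian along line segments\<close>

lemma has_real_derivativeI_bound:
  fixes F :: "real \<Rightarrow> real"
  assumes "\<And>e. e > 0 \<Longrightarrow> \<exists>\<delta>>0. \<forall>k. \<bar>k\<bar> < \<delta> \<longrightarrow> \<bar>F (t + k) - F t - D * k\<bar> \<le> e * \<bar>k\<bar>"
  shows "(F has_real_derivative D) (at t)"
  unfolding DERIV_def
proof (rule LIM_I)
  fix r :: real assume r: "r > 0"
  obtain \<delta> where d: "\<delta> > 0" "\<And>k. \<bar>k\<bar> < \<delta> \<Longrightarrow> \<bar>F (t + k) - F t - D * k\<bar> \<le> r / 2 * \<bar>k\<bar>"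
    using assms[of "r / 2"] r by auto
  have "\<bar>(F (t + k) - F t) / k - D\<bar> < r" if k: "k \<noteq> 0" "\<bar>k\<bar> < \<delta>" for k
  proof -
    have "\<bar>(F (t + k) - F t) / k - D\<bar> = \<bar>F (t + k) - F t - D * k\<bar> / \<bar>k\<bar>"
      using k by (simp add: field_simps flip: abs_divide)
    also have "\<dots> \<le> r / 2" using d(2)[OF k(2)] k by (simp add: divide_le_eq)
    finally show ?thesis using r by simp
  qed
  then show "\<exists>s>0. \<forall>x. x \<noteq> 0 \<and> norm (x - 0) < s \<longrightarrow> norm ((F (t + x) - F t) / x - D) < r"
    using d(1) by auto
qed

lemma le_if_le_small:
  fixes a b c :: real
  assumes "\<And>t. 0 < t \<Longrightarrow> t \<le> 1 \<Longrightarrow> a \<le> b + c * t"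
  shows "a \<le> b"
proof (rule field_le_epsilon)
  fix e :: real assume e: "e > 0"
  define t where "t = min 1 (e / (\<bar>c\<bar> + 1))"
  have t: "0 < t" "t \<le> 1" "t \<le> e / (\<bar>c\<bar> + 1)" using e by (auto simp: t_def)
  have "c * t \<le> (\<bar>c\<bar> + 1) * t" using t by (intro mult_right_mono) auto
  also have "\<dots> \<le> e" using t(3) by (simp add: field_simps)
  finally show "a \<le> b + e" using assms[OF t(1,2)] by simp
qed

lemma lin_comb_line:
  assumes "x \<in> carrier_vec d" "h \<in> carrier_vec d"
  shows "x + (t + k) \<cdot>\<^sub>v h = (x + t \<cdot>\<^sub>v h) + k \<cdot>\<^sub>v (h::real vec)"
  using assms by (intro eq_vecI) (auto simp: algebra_simps)

locale smooth_objective =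
  fixes d :: nat and f :: "real vec \<Rightarrow> real" and Df :: "real vec \<Rightarrow> real vec"
    and Hf :: "real vec \<Rightarrow> real mat" and \<mu> L M :: real and xs :: "real vec"
  assumes mu_pos: "\<mu> > 0" and L_pos: "L > 0" and M_pos: "M > 0"
    and twice_diff: "twice_differentiable d f Df Hf"
    and sconvex: "strongly_convex d \<mu> f"
    and lip_grad: "lipschitz_gradient d L Df"
    and lip_hess: "lipschitz_hessian d M Hf"
    and minimizer: "is_minimizer d f xs"
begin

lemma Df_carrier [simp]: "x \<in> carrier_vec d \<Longrightarrow> Df x \<in> carrier_vec d"
  and Hf_carrier [simp]: "x \<in> carrier_vec d \<Longrightarrow> Hf x \<in> carrier_mat d d"
  using twice_diff by (auto simp: twice_differentiable_def has_gradient_at_def has_jacobian_at_def)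

lemma xs_carrier [simp]: "xs \<in> carrier_vec d"
  using minimizer by (simp add: is_minimizer_def)

lemma Hf_mult_carrier [simp]: "x \<in> carrier_vec d \<Longrightarrow> v \<in> carrier_vec d \<Longrightarrow> Hf x *\<^sub>v v \<in> carrier_vec d"
  by (rule mult_mat_vec_carrier[OF Hf_carrier])

lemma line_has_derivative:
  assumes x: "x \<in> carrier_vec d" and h: "h \<in> carrier_vec d"
  shows "((\<lambda>t. f (x + t \<cdot>\<^sub>v h)) has_real_derivative Df (x + t \<cdot>\<^sub>v h) \<bullet> h) (at t)"
proof (rule has_real_derivativeI_bound)
  fix e :: real assume e: "e > 0"
  define c where "c = vnorm h + 1"
  have c: "c > 0" "vnorm h \<le> c" using vnorm_nonneg[of h] by (auto simp: c_def)
  let ?z = "x + t \<cdot>\<^sub>v h"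
  have z: "?z \<in> carrier_vec d" using x h by simp
  have "has_gradient_at d f (Df ?z) ?z" using twice_diff z by (auto simp: twice_differentiable_def)
  then obtain \<delta> where \<delta>: "\<delta> > 0"
    "\<And>k. k \<in> carrier_vec d \<Longrightarrow> vnorm k < \<delta> \<Longrightarrow> \<bar>f (?z + k) - f ?z - Df ?z \<bullet> k\<bar> \<le> e / c * vnorm k"
    unfolding has_gradient_at_def using e c(1) by (metis divide_pos_pos)
  show "\<exists>\<delta>>0. \<forall>k. \<bar>k\<bar> < \<delta> \<longrightarrow>
      \<bar>f (x + (t + k) \<cdot>\<^sub>v h) - f ?z - (Df ?z \<bullet> h) * k\<bar> \<le> e * \<bar>k\<bar>"
  proof (intro exI[of _ "\<delta> / c"] conjI allI impI)
    fix k :: real assume k: "\<bar>k\<bar> < \<delta> / c"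
    have n: "vnorm (k \<cdot>\<^sub>v h) \<le> \<bar>k\<bar> * c" using c by (simp add: vnorm_smult mult_left_mono)
    also have "\<dots> < \<delta>" using k c by (simp add: field_simps)
    finally have "\<bar>f (?z + k \<cdot>\<^sub>v h) - f ?z - Df ?z \<bullet> (k \<cdot>\<^sub>v h)\<bar> \<le> e / c * vnorm (k \<cdot>\<^sub>v h)"
      using \<delta>(2) h by simp
    also have "\<dots> \<le> e / c * (\<bar>k\<bar> * c)" using n e c by (intro mult_left_mono) auto
    finally show "\<bar>f (x + (t + k) \<cdot>\<^sub>v h) - f ?z - (Df ?z \<bullet> h) * k\<bar> \<le> e * \<bar>k\<bar>"
      using h z c by (simp add: lin_comb_line[OF x h] mult.commute)
  qed (use \<delta> c in auto)
qed

lemma gradient_line_has_derivative: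
  assumes x: "x \<in> carrier_vec d" and h: "h \<in> carrier_vec d" and w: "w \<in> carrier_vec d"
  shows "((\<lambda>t. Df (x + t \<cdot>\<^sub>v h) \<bullet> w) has_real_derivative w \<bullet> (Hf (x + t \<cdot>\<^sub>v h) *\<^sub>v h)) (at t)"
proof (rule has_real_derivativeI_bound)
  fix e :: real assume e: "e > 0"
  define c where "c = vnorm h + 1"
  define b where "b = vnorm w + 1"
  have c: "c > 0" "vnorm h \<le> c" using vnorm_nonneg[of h] by (auto simp: c_def)
  have b: "b > 0" "vnorm w \<le> b" using vnorm_nonneg[of w] by (auto simp: b_def)
  let ?z = "x + t \<cdot>\<^sub>v h"
  have z: "?z \<in> carrier_vec d" using x h by simp
  have "has_jacobian_at d Df (Hf ?z) ?z" using twice_diff z by (auto simp: twice_differentiable_def)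
  moreover have "e / (c * b) > 0" using e c b by simp
  ultimately obtain \<delta> where \<delta>: "\<delta> > 0"
    "\<And>k. k \<in> carrier_vec d \<Longrightarrow> vnorm k < \<delta> \<Longrightarrow>
       vnorm (Df (?z + k) - Df ?z - Hf ?z *\<^sub>v k) \<le> e / (c * b) * vnorm k"
    unfolding has_jacobian_at_def by metis
  show "\<exists>\<delta>>0. \<forall>k. \<bar>k\<bar> < \<delta> \<longrightarrow>
      \<bar>Df (x + (t + k) \<cdot>\<^sub>v h) \<bullet> w - Df ?z \<bullet> w - (w \<bullet> (Hf ?z *\<^sub>v h)) * k\<bar> \<le> e * \<bar>k\<bar>"
  proof (intro exI[of _ "\<delta> / c"] conjI allI impI)
    fix k :: real assume k: "\<bar>k\<bar> < \<delta> / c"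
    have kh: "k \<cdot>\<^sub>v h \<in> carrier_vec d" using h by simp
    have n: "vnorm (k \<cdot>\<^sub>v h) \<le> \<bar>k\<bar> * c" using c by (simp add: vnorm_smult mult_left_mono)
    also have "\<dots> < \<delta>" using k c by (simp add: field_simps)
    finally have "vnorm (Df (?z + k \<cdot>\<^sub>v h) - Df ?z - Hf ?z *\<^sub>v (k \<cdot>\<^sub>v h)) \<le> e / (c * b) * vnorm (k \<cdot>\<^sub>v h)"
      using \<delta>(2) kh by simp
    also have "\<dots> \<le> e / (c * b) * (\<bar>k\<bar> * c)" using n e c b by (intro mult_left_mono) auto
    also have "\<dots> = e * \<bar>k\<bar> / b" using c b by simp
    finally have n2: "vnorm (Df (?z + k \<cdot>\<^sub>v h) - Df ?z - Hf ?z *\<^sub>v (k \<cdot>\<^sub>v h)) \<le> e * \<bar>k\<bar> / b" .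
    have zk: "?z + k \<cdot>\<^sub>v h \<in> carrier_vec d" using z kh by simp
    have "\<bar>w \<bullet> (Df (?z + k \<cdot>\<^sub>v h) - Df ?z - Hf ?z *\<^sub>v (k \<cdot>\<^sub>v h))\<bar>
        \<le> vnorm w * vnorm (Df (?z + k \<cdot>\<^sub>v h) - Df ?z - Hf ?z *\<^sub>v (k \<cdot>\<^sub>v h))"
      by (rule abs_scalar_prod_le[OF w]) (use z zk kh in auto)
    also have "\<dots> \<le> b * (e * \<bar>k\<bar> / b)" using n2 b vnorm_nonneg by (intro mult_mono) auto
    also have "\<dots> = e * \<bar>k\<bar>" using b by simp
    also have "w \<bullet> (Df (?z + k \<cdot>\<^sub>v h) - Df ?z - Hf ?z *\<^sub>v (k \<cdot>\<^sub>v h))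
        = Df (?z + k \<cdot>\<^sub>v h) \<bullet> w - Df ?z \<bullet> w - (w \<bullet> (Hf ?z *\<^sub>v h)) * k"
      using w z zk kh h mult_mat_vec[OF Hf_carrier[OF z] h, of k]
        comm_scalar_prod[OF w Df_carrier[OF zk]] comm_scalar_prod[OF w Df_carrier[OF z]]
      by (simp add: scalar_prod_minus_distrib[where n=d])
    finally show "\<bar>Df (x + (t + k) \<cdot>\<^sub>v h) \<bullet> w - Df ?z \<bullet> w - (w \<bullet> (Hf ?z *\<^sub>v h)) * k\<bar> \<le> e * \<bar>k\<bar>"
      by (simp only: lin_comb_line[OF x h])
  qed (use \<delta> c in auto)
qed

lemma f_mvt:
  assumes x: "x \<in> carrier_vec d" and h: "h \<in> carrier_vec d"
  obtains t where "0 < t" "t < 1" "f (x + h) - f x = Df (x + t \<cdot>\<^sub>v h) \<bullet> h"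
proof -
  obtain t :: real where "t > 0" "t < 1" "f (x + 1 \<cdot>\<^sub>v h) - f (x + 0 \<cdot>\<^sub>v h) = (1 - 0) * (Df (x + t \<cdot>\<^sub>v h) \<bullet> h)"
    using MVT2[of 0 1 "\<lambda>t. f (x + t \<cdot>\<^sub>v h)" "\<lambda>t. Df (x + t \<cdot>\<^sub>v h) \<bullet> h"] line_has_derivative[OF x h] by auto
  moreover have "x + 0 \<cdot>\<^sub>v h = x" "x + 1 \<cdot>\<^sub>v h = x + h" using x h by auto
  ultimately show thesis using that by simp
qed

lemma gradient_mvt:
  assumes x: "x \<in> carrier_vec d" and h: "h \<in> carrier_vec d" and w: "w \<in> carrier_vec d"
  obtains t where "0 < t" "t < 1" "Df (x + h) \<bullet> w - Df x \<bullet> w = w \<bullet> (Hf (x + t \<cdot>\<^sub>v h) *\<^sub>v h)"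
proof -
  obtain t :: real where "t > 0" "t < 1"
    "Df (x + 1 \<cdot>\<^sub>v h) \<bullet> w - Df (x + 0 \<cdot>\<^sub>v h) \<bullet> w = (1 - 0) * (w \<bullet> (Hf (x + t \<cdot>\<^sub>v h) *\<^sub>v h))"
    using MVT2[of 0 1 "\<lambda>t. Df (x + t \<cdot>\<^sub>v h) \<bullet> w" "\<lambda>t. w \<bullet> (Hf (x + t \<cdot>\<^sub>v h) *\<^sub>v h)"]
      gradient_line_has_derivative[OF x h w] by auto
  moreover have "x + 0 \<cdot>\<^sub>v h = x" "x + 1 \<cdot>\<^sub>v h = x + h" using x h by auto
  ultimately show thesis using that by simp
qed

lemma taylor2:
  assumes x: "x \<in> carrier_vec d" and h: "h \<in> carrier_vec d"
  obtains t where "0 < t" "t < 1" "f (x + h) = f x + Df x \<bullet> h + (h \<bullet> (Hf (x + t \<cdot>\<^sub>v h) *\<^sub>v h)) / 2"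
proof -
  let ?df = "\<lambda>m t. if m = 0 then f (x + t \<cdot>\<^sub>v h) else if m = 1 then Df (x + t \<cdot>\<^sub>v h) \<bullet> h
    else h \<bullet> (Hf (x + t \<cdot>\<^sub>v h) *\<^sub>v h)"
  have "\<exists>t>0. t < (1::real) \<and> f (x + 1 \<cdot>\<^sub>v h)
      = (\<Sum>m<2. ?df m 0 / fact m * 1 ^ m) + ?df (2::nat) t / fact 2 * 1 ^ 2"
  proof (rule Maclaurin)
    show "\<forall>m t. m < 2 \<and> 0 \<le> t \<and> t \<le> 1 \<longrightarrow> DERIV (?df m) t :> ?df (Suc m) t"
      using line_has_derivative[OF x h] gradient_line_has_derivative[OF x h h]
      by (auto simp: less_2_cases_iff)
  qed auto
  then obtain t where t: "t > 0" "t < 1" "f (x + 1 \<cdot>\<^sub>v h)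
      = (\<Sum>m<2. ?df m 0 / fact m * 1 ^ m) + ?df (2::nat) t / fact 2 * 1 ^ 2" by blast
  moreover have "x + 0 \<cdot>\<^sub>v h = x" "x + 1 \<cdot>\<^sub>v h = x + h" using x h by auto
  ultimately show thesis using that by (simp add: numeral_2_eq_2)
qed

lemma hess_lipschitz:
  assumes "x \<in> carrier_vec d" "y \<in> carrier_vec d" "u \<in> carrier_vec d" "v \<in> carrier_vec d"
  shows "\<bar>u \<bullet> (Hf x *\<^sub>v v) - u \<bullet> (Hf y *\<^sub>v v)\<bar> \<le> M * vnorm (x - y) * vnorm u * vnorm v"
proof -
  have A: "Hf x - Hf y \<in> carrier_mat d d" using assms by (simp add: minus_carrier_mat)
  have "u \<bullet> (Hf x *\<^sub>v v) - u \<bullet> (Hf y *\<^sub>v v) = u \<bullet> ((Hf x - Hf y) *\<^sub>v v)"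
    using assms by (simp add: minus_mult_distrib_mat_vec[where nr=d and nc=d] scalar_prod_minus_distrib[where n=d])
  also have "\<bar>\<dots>\<bar> \<le> vnorm u * vnorm ((Hf x - Hf y) *\<^sub>v v)"
    by (rule abs_scalar_prod_le) (use assms A in auto)
  also have "\<dots> \<le> vnorm u * (M * vnorm (x - y) * vnorm v)"
  proof (intro mult_left_mono)
    have "vnorm ((Hf x - Hf y) *\<^sub>v v) \<le> op_norm (Hf x - Hf y) * vnorm v"
      by (rule vnorm_mult_le_op_norm) (use assms A in auto)
    also have "\<dots> \<le> M * vnorm (x - y) * vnorm v"
      using lip_hess assms vnorm_nonneg by (intro mult_right_mono) (auto simp: lipschitz_hessian_def)
    finally show "vnorm ((Hf x - Hf y) *\<^sub>v v) \<le> M * vnorm (x - y) * vnorm v" .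
  qed (rule vnorm_nonneg)
  finally show ?thesis by (simp add: mult_ac)
qed

text \<open>
  The mean value theorem is applied first in direction \<open>u\<close>, to the difference of \<open>f\<close> over \<open>v\<close>, and
  then to the gradient in direction \<open>v\<close>. The left-hand side is symmetric in \<open>u\<close> and \<open>v\<close> apart from
  the Hessian term, which gives the symmetry of the Hessian.
\<close>
lemma second_difference:
  assumes x: "x \<in> carrier_vec d" and u: "u \<in> carrier_vec d" and v: "v \<in> carrier_vec d"
  shows "\<bar>f (x + u + v) - f (x + u) - f (x + v) + f x - u \<bullet> (Hf x *\<^sub>v v)\<bar>
      \<le> M * (vnorm u + vnorm v) * vnorm u * vnorm v"
proof -
  define g where "g = (\<lambda>t. f ((x + v) + t \<cdot>\<^sub>v u) - f (x + t \<cdot>\<^sub>v u))"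
  have "(g has_real_derivative (Df ((x + v) + t \<cdot>\<^sub>v u) \<bullet> u - Df (x + t \<cdot>\<^sub>v u) \<bullet> u)) (at t)" for t
    unfolding g_def by (intro DERIV_diff line_has_derivative) (use assms in auto)
  then obtain t :: real where t: "t > 0" "t < 1"
    "g 1 - g 0 = Df ((x + v) + t \<cdot>\<^sub>v u) \<bullet> u - Df (x + t \<cdot>\<^sub>v u) \<bullet> u"
    using MVT2[of 0 1 g "\<lambda>t. Df ((x + v) + t \<cdot>\<^sub>v u) \<bullet> u - Df (x + t \<cdot>\<^sub>v u) \<bullet> u"] by auto
  have xt: "x + t \<cdot>\<^sub>v u \<in> carrier_vec d" using assms by simp
  obtain r :: real where r: "r > 0" "r < 1"
    "Df ((x + t \<cdot>\<^sub>v u) + v) \<bullet> u - Df (x + t \<cdot>\<^sub>v u) \<bullet> u = u \<bullet> (Hf ((x + t \<cdot>\<^sub>v u) + r \<cdot>\<^sub>v v) *\<^sub>v v)"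
    using gradient_mvt[OF xt v u] by metis
  let ?z = "(x + t \<cdot>\<^sub>v u) + r \<cdot>\<^sub>v v"
  have "?z - x = t \<cdot>\<^sub>v u + r \<cdot>\<^sub>v v" using assms by (intro eq_vecI) auto
  then have "vnorm (?z - x) \<le> vnorm (t \<cdot>\<^sub>v u) + vnorm (r \<cdot>\<^sub>v v)"
    using vnorm_triangle[of "t \<cdot>\<^sub>v u" d "r \<cdot>\<^sub>v v"] assms by simp
  also have "\<dots> \<le> vnorm u + vnorm v" using t(1,2) r(1,2) vnorm_nonneg[of u] vnorm_nonneg[of v]
    by (intro add_mono) (auto simp: vnorm_smult mult_left_le_one_le)
  finally have zx: "vnorm (?z - x) \<le> vnorm u + vnorm v" .
  have "(x + v) + t \<cdot>\<^sub>v u = (x + t \<cdot>\<^sub>v u) + v" using assms by (intro eq_vecI) auto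
  then have "g 1 - g 0 = u \<bullet> (Hf ?z *\<^sub>v v)" using t(3) r(3) by simp
  moreover have "(x + v) + 1 \<cdot>\<^sub>v u = x + u + v" "x + 1 \<cdot>\<^sub>v u = x + u" "(x + v) + 0 \<cdot>\<^sub>v u = x + v" "x + 0 \<cdot>\<^sub>v u = x"
    using assms by (auto intro!: eq_vecI)
  ultimately have "f (x + u + v) - f (x + u) - f (x + v) + f x = u \<bullet> (Hf ?z *\<^sub>v v)"
    by (simp add: g_def)
  moreover have "\<bar>u \<bullet> (Hf ?z *\<^sub>v v) - u \<bullet> (Hf x *\<^sub>v v)\<bar> \<le> M * vnorm (?z - x) * vnorm u * vnorm v"
    by (rule hess_lipschitz) (use assms in auto)
  moreover have "M * vnorm (?z - x) * vnorm u * vnorm v \<le> M * (vnorm u + vnorm v) * vnorm u * vnorm v"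
    using zx M_pos vnorm_nonneg by (intro mult_right_mono mult_left_mono) auto
  ultimately show ?thesis by linarith
qed

lemma hess_form_sym:
  assumes x: "x \<in> carrier_vec d" and u: "u \<in> carrier_vec d" and v: "v \<in> carrier_vec d"
  shows "u \<bullet> (Hf x *\<^sub>v v) = v \<bullet> (Hf x *\<^sub>v u)"
proof -
  define K where "K = M * (vnorm u + vnorm v) * vnorm u * vnorm v"
  have main: "\<bar>u \<bullet> (Hf x *\<^sub>v v) - v \<bullet> (Hf x *\<^sub>v u)\<bar> \<le> 0 + 2 * K * t" if t: "0 < t" "t \<le> 1" for t
  proof -
    let ?u = "t \<cdot>\<^sub>v u" and ?v = "t \<cdot>\<^sub>v v"
    \<comment> \<open>At scale \<open>t\<close> the Hessian terms are of order \<open>t\<^sup>2\<close> and the error is of order \<open>t\<^sup>3\<close>.\<close>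
    have e: "x + ?u + ?v = x + ?v + ?u" using assms by (intro eq_vecI) auto
    define S where "S = f (x + ?u + ?v) - f (x + ?u) - f (x + ?v) + f x"
    define X where "X = u \<bullet> (Hf x *\<^sub>v v)"
    define Y where "Y = v \<bullet> (Hf x *\<^sub>v u)"
    have S: "S = f (x + ?v + ?u) - f (x + ?v) - f (x + ?u) + f x" unfolding S_def e by simp
    have "\<bar>S - ?u \<bullet> (Hf x *\<^sub>v ?v)\<bar>
        \<le> M * (vnorm ?u + vnorm ?v) * vnorm ?u * vnorm ?v"
      unfolding S_def by (rule second_difference) (use assms in auto)
    moreover have "\<bar>S - ?v \<bullet> (Hf x *\<^sub>v ?u)\<bar>
        \<le> M * (vnorm ?v + vnorm ?u) * vnorm ?v * vnorm ?u"
      unfolding S by (rule second_difference) (use assms in auto)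
    moreover have "M * (vnorm ?u + vnorm ?v) * vnorm ?u * vnorm ?v = K * t * t\<^sup>2"
      "M * (vnorm ?v + vnorm ?u) * vnorm ?v * vnorm ?u = K * t * t\<^sup>2"
      using t by (simp_all add: vnorm_smult K_def power2_eq_square algebra_simps)
    moreover have "?u \<bullet> (Hf x *\<^sub>v ?v) = t\<^sup>2 * X" "?v \<bullet> (Hf x *\<^sub>v ?u) = t\<^sup>2 * Y"
      using assms by (simp_all add: mult_mat_vec[OF Hf_carrier[OF x]] power2_eq_square X_def Y_def)
    ultimately have "\<bar>S - t\<^sup>2 * X\<bar> \<le> K * t * t\<^sup>2" "\<bar>S - t\<^sup>2 * Y\<bar> \<le> K * t * t\<^sup>2" by simp_all
    then have "\<bar>t\<^sup>2 * X - t\<^sup>2 * Y\<bar> \<le> 2 * (K * t * t\<^sup>2)" by linarith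
    also have "t\<^sup>2 * X - t\<^sup>2 * Y = t\<^sup>2 * (X - Y)" by (simp add: right_diff_distrib)
    finally have "t\<^sup>2 * \<bar>X - Y\<bar> \<le> t\<^sup>2 * (0 + 2 * K * t)" by (simp add: abs_mult mult_ac)
    then have "\<bar>X - Y\<bar> \<le> 0 + 2 * K * t" using t by (simp only: mult_le_cancel_left_pos zero_less_power)
    then show ?thesis unfolding X_def Y_def .
  qed
  have "\<bar>u \<bullet> (Hf x *\<^sub>v v) - v \<bullet> (Hf x *\<^sub>v u)\<bar> \<le> 0"
    by (rule le_if_le_small[where c = "2 * K"]) (rule main)
  then show ?thesis by simp
qed

lemma Hf_transpose: assumes x: "x \<in> carrier_vec d" shows "(Hf x)\<^sup>T = Hf x"
proof (rule mat_eqI_form)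
  fix u v :: "real vec" assume uv: "u \<in> carrier_vec d" "v \<in> carrier_vec d"
  have "u \<bullet> ((Hf x)\<^sup>T *\<^sub>v v) = ((Hf x)\<^sup>T *\<^sub>v v) \<bullet> u"
    by (rule comm_scalar_prod[OF uv(1)]) (use uv x mult_mat_vec_carrier[of "(Hf x)\<^sup>T" d d] in auto)
  also have "\<dots> = v \<bullet> (Hf x *\<^sub>v u)" by (rule transpose_vec_mult_scalar) (use uv x in auto)
  also have "\<dots> = u \<bullet> (Hf x *\<^sub>v v)" by (rule hess_form_sym) (use uv x in auto)
  finally show "u \<bullet> ((Hf x)\<^sup>T *\<^sub>v v) = u \<bullet> (Hf x *\<^sub>v v)" .
qed (use x in auto)

lemma gradient_lipschitz:
  assumes "x \<in> carrier_vec d" "h \<in> carrier_vec d" "v \<in> carrier_vec d"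
  shows "\<bar>Df (x + h) \<bullet> v - Df x \<bullet> v\<bar> \<le> L * vnorm h * vnorm v"
proof -
  have xh: "x + h \<in> carrier_vec d" using assms by simp
  have "Df (x + h) \<bullet> v - Df x \<bullet> v = (Df (x + h) - Df x) \<bullet> v"
    using assms xh by (simp add: minus_scalar_prod_distrib[where n=d])
  also have "\<bar>\<dots>\<bar> \<le> vnorm (Df (x + h) - Df x) * vnorm v"
    by (rule abs_scalar_prod_le) (use assms xh in auto)
  also have "\<dots> \<le> L * vnorm (x + h - x) * vnorm v"
    using lip_grad assms xh vnorm_nonneg by (intro mult_right_mono) (auto simp: lipschitz_gradient_def)
  also have "x + h - x = h" using assms by (intro eq_vecI) auto
  finally show ?thesis .
qed

text \<open>
  Divide the definition of strong convexity on the segment by its parameter and let it tend to \<open>0\<close>.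
\<close>
lemma f_lower:
  assumes x: "x \<in> carrier_vec d" and h: "h \<in> carrier_vec d"
  shows "f x + Df x \<bullet> h + \<mu> / 2 * (h \<bullet> h) \<le> f (x + h)"
proof (rule le_if_le_small[where c = "(L + \<mu> / 2) * (h \<bullet> h)"])
  fix t :: real assume t: "0 < t" "t \<le> 1"
  have th: "t \<cdot>\<^sub>v h \<in> carrier_vec d" and xh: "x + h \<in> carrier_vec d" using x h by auto
  obtain z where z: "0 < z" "z < 1" "f (x + t \<cdot>\<^sub>v h) - f x = Df (x + z \<cdot>\<^sub>v (t \<cdot>\<^sub>v h)) \<bullet> (t \<cdot>\<^sub>v h)"
    using f_mvt[OF x th] by metis
  have zt: "(z * t) \<cdot>\<^sub>v h \<in> carrier_vec d" "x + (z * t) \<cdot>\<^sub>v h \<in> carrier_vec d" using x h by auto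
  have "\<bar>Df (x + (z * t) \<cdot>\<^sub>v h) \<bullet> h - Df x \<bullet> h\<bar> \<le> L * vnorm ((z * t) \<cdot>\<^sub>v h) * vnorm h"
    by (rule gradient_lipschitz[OF x zt(1) h])
  also have "\<dots> = z * (L * t * (h \<bullet> h))"
    using z t by (simp add: vnorm_smult vnorm_sq[symmetric] power2_eq_square)
  also have "\<dots> \<le> L * t * (h \<bullet> h)"
    using z t L_pos scalar_self_nonneg[of h] by (intro mult_left_le_one_le) auto
  finally have "Df (x + (z * t) \<cdot>\<^sub>v h) \<bullet> h \<ge> Df x \<bullet> h - L * t * (h \<bullet> h)" by linarith
  then have "t * (Df x \<bullet> h - L * t * (h \<bullet> h)) \<le> t * (Df (x + (z * t) \<cdot>\<^sub>v h) \<bullet> h)"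
    using t by (intro mult_left_mono) auto
  also have "\<dots> = f (x + t \<cdot>\<^sub>v h) - f x" using z h zt by (simp add: smult_smult_assoc)
  finally have 1: "t * (Df x \<bullet> h - L * t * (h \<bullet> h)) \<le> f (x + t \<cdot>\<^sub>v h) - f x" .
  have "(1 - t) \<cdot>\<^sub>v x + t \<cdot>\<^sub>v (x + h) = x + t \<cdot>\<^sub>v h" using x h by (intro eq_vecI) (auto simp: algebra_simps)
  moreover have "(vnorm (x - (x + h)))\<^sup>2 = h \<bullet> h"
  proof -
    have "x - (x + h) = (-1) \<cdot>\<^sub>v h" using x h by (intro eq_vecI) auto
    then show ?thesis by (simp add: vnorm_smult vnorm_sq)
  qed
  ultimately have "f (x + t \<cdot>\<^sub>v h) \<le> (1 - t) * f x + t * f (x + h) - \<mu> / 2 * t * (1 - t) * (h \<bullet> h)"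
    using sconvex x xh t unfolding strongly_convex_def by (metis atLeastAtMost_iff less_imp_le)
  then have "t * (Df x \<bullet> h - L * t * (h \<bullet> h)) \<le> t * (f (x + h) - f x - \<mu> / 2 * (1 - t) * (h \<bullet> h))"
    using 1 by (simp add: algebra_simps)
  then have "Df x \<bullet> h - L * t * (h \<bullet> h) \<le> f (x + h) - f x - \<mu> / 2 * (1 - t) * (h \<bullet> h)"
    using t by simp
  then show "f x + Df x \<bullet> h + \<mu> / 2 * (h \<bullet> h) \<le> f (x + h) + (L + \<mu> / 2) * (h \<bullet> h) * t"
    by (simp add: algebra_simps add_divide_distrib diff_divide_distrib)
qed

lemma hess_lower:
  assumes x: "x \<in> carrier_vec d" and h: "h \<in> carrier_vec d"
  shows "\<mu> * (h \<bullet> h) \<le> h \<bullet> (Hf x *\<^sub>v h)"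
proof (rule le_if_le_small[where c = "M * vnorm h * vnorm h * vnorm h"])
  fix t :: real assume t: "0 < t" "t \<le> 1"
  have th: "t \<cdot>\<^sub>v h \<in> carrier_vec d" using h by auto
  obtain z where z: "0 < z" "z < 1" "f (x + t \<cdot>\<^sub>v h) = f x + Df x \<bullet> (t \<cdot>\<^sub>v h)
      + ((t \<cdot>\<^sub>v h) \<bullet> (Hf (x + z \<cdot>\<^sub>v (t \<cdot>\<^sub>v h)) *\<^sub>v (t \<cdot>\<^sub>v h))) / 2"
    using taylor2[OF x th] by metis
  define q where "q = x + (z * t) \<cdot>\<^sub>v h"
  have zc: "q \<in> carrier_vec d" using x h by (simp add: q_def)
  have "f x + Df x \<bullet> (t \<cdot>\<^sub>v h) + \<mu> / 2 * ((t \<cdot>\<^sub>v h) \<bullet> (t \<cdot>\<^sub>v h)) \<le> f (x + t \<cdot>\<^sub>v h)" by (rule f_lower[OF x th])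
  then have "\<mu> * ((t \<cdot>\<^sub>v h) \<bullet> (t \<cdot>\<^sub>v h)) \<le> (t \<cdot>\<^sub>v h) \<bullet> (Hf q *\<^sub>v (t \<cdot>\<^sub>v h))"
    using z(3) by (simp add: smult_smult_assoc q_def)
  then have "t\<^sup>2 * (\<mu> * (h \<bullet> h)) \<le> t\<^sup>2 * (h \<bullet> (Hf q *\<^sub>v h))"
    using h zc by (simp add: mult_mat_vec[OF Hf_carrier[OF zc] h] power2_eq_square mult_ac)
  then have "\<mu> * (h \<bullet> h) \<le> h \<bullet> (Hf q *\<^sub>v h)" using t by simp
  moreover have "\<bar>h \<bullet> (Hf q *\<^sub>v h) - h \<bullet> (Hf x *\<^sub>v h)\<bar> \<le> M * vnorm (q - x) * vnorm h * vnorm h"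
    by (rule hess_lipschitz[OF zc x h h])
  moreover have "vnorm (q - x) \<le> vnorm h * t"
  proof -
    have "q - x = (z * t) \<cdot>\<^sub>v h" using x h unfolding q_def by (intro eq_vecI) auto
    then show ?thesis using z t vnorm_nonneg[of h] by (simp add: vnorm_smult mult_left_le_one_le mult_ac)
  qed
  then have "M * vnorm (q - x) * vnorm h * vnorm h \<le> M * (vnorm h * t) * vnorm h * vnorm h"
    using M_pos vnorm_nonneg by (intro mult_right_mono mult_left_mono) auto
  ultimately show "\<mu> * (h \<bullet> h) \<le> h \<bullet> (Hf x *\<^sub>v h) + M * vnorm h * vnorm h * vnorm h * t"
    by (simp add: mult_ac)
qed

lemma hess_upper:
  assumes x: "x \<in> carrier_vec d" and h: "h \<in> carrier_vec d"
  shows "h \<bullet> (Hf x *\<^sub>v h) \<le> L * (h \<bullet> h)"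
proof (rule le_if_le_small[where c = "M * vnorm h * vnorm h * vnorm h"])
  fix t :: real assume t: "0 < t" "t \<le> 1"
  have th: "t \<cdot>\<^sub>v h \<in> carrier_vec d" using h by auto
  obtain z where z: "0 < z" "z < 1" "Df (x + t \<cdot>\<^sub>v h) \<bullet> h - Df x \<bullet> h
      = h \<bullet> (Hf (x + z \<cdot>\<^sub>v (t \<cdot>\<^sub>v h)) *\<^sub>v (t \<cdot>\<^sub>v h))"
    using gradient_mvt[OF x th h] by metis
  define q where "q = x + (z * t) \<cdot>\<^sub>v h"
  have zc: "q \<in> carrier_vec d" using x h by (simp add: q_def)
  have "\<bar>Df (x + t \<cdot>\<^sub>v h) \<bullet> h - Df x \<bullet> h\<bar> \<le> L * vnorm (t \<cdot>\<^sub>v h) * vnorm h"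
    by (rule gradient_lipschitz[OF x th h])
  then have "h \<bullet> (Hf q *\<^sub>v (t \<cdot>\<^sub>v h)) \<le> t * (L * (h \<bullet> h))"
    using z(3) t by (simp add: q_def smult_smult_assoc vnorm_smult vnorm_sq[symmetric] power2_eq_square mult_ac)
  then have "t * (h \<bullet> (Hf q *\<^sub>v h)) \<le> t * (L * (h \<bullet> h))"
    using h zc by (simp add: mult_mat_vec[OF Hf_carrier[OF zc] h])
  then have "h \<bullet> (Hf q *\<^sub>v h) \<le> L * (h \<bullet> h)" using t by simp
  moreover have "\<bar>h \<bullet> (Hf q *\<^sub>v h) - h \<bullet> (Hf x *\<^sub>v h)\<bar> \<le> M * vnorm (q - x) * vnorm h * vnorm h"
    by (rule hess_lipschitz[OF zc x h h])
  moreover have "vnorm (q - x) \<le> vnorm h * t"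
  proof -
    have "q - x = (z * t) \<cdot>\<^sub>v h" using x h unfolding q_def by (intro eq_vecI) auto
    then show ?thesis using z t vnorm_nonneg[of h] by (simp add: vnorm_smult mult_left_le_one_le mult_ac)
  qed
  then have "M * vnorm (q - x) * vnorm h * vnorm h \<le> M * (vnorm h * t) * vnorm h * vnorm h"
    using M_pos vnorm_nonneg by (intro mult_right_mono mult_left_mono) auto
  ultimately show "h \<bullet> (Hf x *\<^sub>v h) \<le> L * (h \<bullet> h) + M * vnorm h * vnorm h * vnorm h * t"
    by (simp add: mult_ac)
qed

lemma spd_Hf: "x \<in> carrier_vec d \<Longrightarrow> spd d (Hf x)"
  unfolding spd_def
  using hess_lower mu_pos scalar_self_pos[of _ d] Hf_transpose
  by (meson Hf_carrier less_le_trans mult_pos_pos)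

section \<open>Curvature relative to the Hessian at the minimizer\<close>

lemma dim_xs [simp]: "dim_vec xs = d"
  using xs_carrier by (simp only: carrier_vecD)

lemma dim_Df [simp]: "x \<in> carrier_vec d \<Longrightarrow> dim_vec (Df x) = d"
  using Df_carrier by (simp only: carrier_vecD)

lemma gradient_at_minimizer: "Df xs = 0\<^sub>v d"
proof (rule ccontr)
  assume "Df xs \<noteq> 0\<^sub>v d"
  then have pos: "Df xs \<bullet> Df xs > 0" by (intro scalar_self_pos) auto
  have z: "xs + 0 \<cdot>\<^sub>v Df xs = xs"
    by (intro eq_vecI) auto
  have "Df (xs + 0 \<cdot>\<^sub>v Df xs) \<bullet> Df xs = 0"
  proof (rule DERIV_local_min[OF line_has_derivative])
    show "\<forall>y. \<bar>0 - y\<bar> < 1 \<longrightarrow> f (xs + 0 \<cdot>\<^sub>v Df xs) \<le> f (xs + y \<cdot>\<^sub>v Df xs)"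
      unfolding z using minimizer by (auto simp: is_minimizer_def)
  qed auto
  then show False using pos z by simp
qed

lemma f_min: "x \<in> carrier_vec d \<Longrightarrow> f xs \<le> f x"
  using minimizer by (simp add: is_minimizer_def)

lemma add_diff_cancel_vec: "x \<in> carrier_vec d \<Longrightarrow> y \<in> carrier_vec d \<Longrightarrow> y + (x - y) = (x::real vec)"
  by (intro eq_vecI) auto

lemma dist_minimizer_le:
  assumes x: "x \<in> carrier_vec d"
  shows "(vnorm (x - xs))\<^sup>2 \<le> 2 * (f x - f xs) / \<mu>"
proof -
  have "f xs + Df xs \<bullet> (x - xs) + \<mu> / 2 * ((x - xs) \<bullet> (x - xs)) \<le> f (xs + (x - xs))"
    by (rule f_lower) (use x in auto)
  moreover have "Df xs \<bullet> (x - xs) = 0" using x by (simp add: gradient_at_minimizer)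
  ultimately show ?thesis using x mu_pos by (simp add: add_diff_cancel_vec vnorm_sq field_simps)
qed

text \<open>
  Minimize the quadratic lower bound for \<open>f\<close> over all displacements.
\<close>
lemma polyak_lojasiewicz:
  assumes x: "x \<in> carrier_vec d"
  shows "2 * \<mu> * (f x - f xs) \<le> Df x \<bullet> Df x"
proof -
  let ?h = "xs - x" and ?g = "Df x"
  have h: "?h \<in> carrier_vec d" and g: "?g \<in> carrier_vec d" using x by auto
  have "f x + ?g \<bullet> ?h + \<mu> / 2 * (?h \<bullet> ?h) \<le> f (x + ?h)" by (rule f_lower[OF x h])
  then have 1: "2 * \<mu> * (f x - f xs) \<le> 2 * \<mu> * (- (?g \<bullet> ?h) - \<mu> / 2 * (?h \<bullet> ?h))"
    using x mu_pos by (intro mult_left_mono) (auto simp: add_diff_cancel_vec)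
  have "0 \<le> (?g + \<mu> \<cdot>\<^sub>v ?h) \<bullet> (?g + \<mu> \<cdot>\<^sub>v ?h)" by (rule scalar_self_nonneg)
  also have "\<dots> = ?g \<bullet> ?g + 2 * \<mu> * (?g \<bullet> ?h) + \<mu>\<^sup>2 * (?h \<bullet> ?h)"
    using g h by (subst scalar_self_add[of _ d]) (auto simp: power2_eq_square)
  finally show ?thesis using 1 by (simp add: algebra_simps power2_eq_square)
qed

lemma mu_le_L:
  fixes v :: "real vec"
  assumes "v \<in> carrier_vec d" "v \<noteq> 0\<^sub>v d"
  shows "\<mu> \<le> L"
proof -
  have "\<mu> * (v \<bullet> v) \<le> L * (v \<bullet> v)"
    using hess_lower[OF xs_carrier assms(1)] hess_upper[OF xs_carrier assms(1)] by linarith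
  then show ?thesis using scalar_self_pos[OF assms] by simp
qed

text \<open>
  A Baillon-Haddad inequality that needs the curvature bound on the segment only. The integral of the Hessian is
  avoided by applying the mean value theorem to the gradient in the single direction \<open>Q y - (c / 2) s\<close>:
  at every point of the segment, nonnegativity of the Hessian at \<open>Q y - c s\<close> bounds the
  derivative by \<open>(y\<^sup>T Q y) / 2\<close>. Hessians at different mean value points are never compared, which keeps
  the result linear in \<open>c\<close>.
\<close>
lemma gradient_cocoercive:
  assumes PQ: "spd_inverse d P Q" and c: "c > 0" and x: "x \<in> carrier_vec d" and s: "s \<in> carrier_vec d"
    and bound: "\<And>t v. 0 \<le> t \<Longrightarrow> t \<le> 1 \<Longrightarrow> v \<in> carrier_vec d \<Longrightarrow>
      v \<bullet> (Hf (x + t \<cdot>\<^sub>v s) *\<^sub>v v) \<le> c * (v \<bullet> (P *\<^sub>v v))"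
  shows "(Df (x + s) - Df x) \<bullet> (Q *\<^sub>v (Df (x + s) - Df x)) \<le> c * (s \<bullet> (Df (x + s) - Df x))"
proof -
  note PQ' = spd_inverseD[OF PQ]
  define y where "y = Df (x + s) - Df x"
  define w where "w = Q *\<^sub>v y"
  have xs: "x + s \<in> carrier_vec d" using x s by simp
  have y: "y \<in> carrier_vec d" using x xs by (simp add: y_def)
  have w: "w \<in> carrier_vec d" using y PQ' by (simp add: w_def)
  have Pw: "P *\<^sub>v w = y" using spd_inverse_cancel[OF PQ y] by (simp add: w_def)
  \<comment> \<open>This direction makes the form of a symmetric \<open>H\<close> at \<open>w - c s\<close> equal to
    \<open>w\<^sup>T H w - 2 c e\<^sup>T H s\<close>.\<close>
  define e where "e = w + (- c / 2) \<cdot>\<^sub>v s"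
  have e: "e \<in> carrier_vec d" using w s by (simp add: e_def)
  obtain t where t: "0 < t" "t < 1" "Df (x + s) \<bullet> e - Df x \<bullet> e = e \<bullet> (Hf (x + t \<cdot>\<^sub>v s) *\<^sub>v s)"
    using gradient_mvt[OF x s e] by metis
  define H where "H = Hf (x + t \<cdot>\<^sub>v s)"
  have xt: "x + t \<cdot>\<^sub>v s \<in> carrier_vec d" using x s by simp
  have H: "H \<in> carrier_mat d d" "H\<^sup>T = H" using Hf_transpose[OF xt] xt by (auto simp: H_def)
  have Hs: "H *\<^sub>v s \<in> carrier_vec d" and Hw: "H *\<^sub>v w \<in> carrier_vec d" using H s w by auto
  have "y \<bullet> e = e \<bullet> (H *\<^sub>v s)"
    using t(3) x xs e by (simp add: y_def H_def minus_scalar_prod_distrib[where n=d])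
  moreover have "y \<bullet> e = y \<bullet> w - c / 2 * (s \<bullet> y)"
    using y w s comm_scalar_prod[OF y s] by (simp add: e_def scalar_prod_add_distrib[where n=d])
  moreover have "e \<bullet> (H *\<^sub>v s) = w \<bullet> (H *\<^sub>v s) - c / 2 * (s \<bullet> (H *\<^sub>v s))"
    using Hs w s by (simp add: e_def add_scalar_prod_distrib[where n=d])
  ultimately have 1: "y \<bullet> w - c / 2 * (s \<bullet> y) = w \<bullet> (H *\<^sub>v s) - c / 2 * (s \<bullet> (H *\<^sub>v s))" by simp
  have "0 \<le> (w + (- c) \<cdot>\<^sub>v s) \<bullet> (H *\<^sub>v (w + (- c) \<cdot>\<^sub>v s))"
    unfolding H_def by (rule spd_nonneg[OF spd_Hf[OF xt]]) (use w s in auto)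
  also have "H *\<^sub>v (w + (- c) \<cdot>\<^sub>v s) = H *\<^sub>v w + (- c) \<cdot>\<^sub>v (H *\<^sub>v s)"
    by (rule mult_mat_vec_smult_add[OF H(1) w s])
  also have "(w + (- c) \<cdot>\<^sub>v s) \<bullet> (H *\<^sub>v w + (- c) \<cdot>\<^sub>v (H *\<^sub>v s))
      = w \<bullet> (H *\<^sub>v w) - c * (w \<bullet> (H *\<^sub>v s)) - c * (s \<bullet> (H *\<^sub>v w)) + c\<^sup>2 * (s \<bullet> (H *\<^sub>v s))"
    using Hs Hw w s by (simp add: add_scalar_prod_distrib[where n=d] scalar_prod_add_distrib[where n=d]
        power2_eq_square algebra_simps)
  also have "s \<bullet> (H *\<^sub>v w) = w \<bullet> (H *\<^sub>v s)" by (rule form_sym[OF H s w])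
  finally have "2 * c * (w \<bullet> (H *\<^sub>v s) - c / 2 * (s \<bullet> (H *\<^sub>v s))) \<le> w \<bullet> (H *\<^sub>v w)"
    by (simp add: power2_eq_square algebra_simps)
  also have "\<dots> \<le> c * (w \<bullet> (P *\<^sub>v w))" unfolding H_def using t w by (intro bound) auto
  also have "w \<bullet> (P *\<^sub>v w) = y \<bullet> w" unfolding Pw by (rule comm_scalar_prod[OF w y])
  finally have "c * (2 * (y \<bullet> w - c / 2 * (s \<bullet> y))) \<le> c * (y \<bullet> w)" unfolding 1 by (simp add: mult_ac)
  then have "y \<bullet> w \<le> c * (s \<bullet> y)" using c by simp
  then show ?thesis by (simp add: y_def w_def)
qed

definition C :: "real vec \<Rightarrow> real" where "C x = C_const M \<mu> f xs x"

text \<open>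
  The Hessians at \<open>x\<close> and at the minimizer agree up to the factor \<open>1 + c\<close> in both directions.
\<close>
definition near :: "real \<Rightarrow> real vec \<Rightarrow> bool" where
  "near c x \<longleftrightarrow> x \<in> carrier_vec d \<and> (\<forall>v\<in>carrier_vec d.
     v \<bullet> (Hf x *\<^sub>v v) \<le> (1 + c) * (v \<bullet> (Hf xs *\<^sub>v v)) \<and>
     v \<bullet> (Hf xs *\<^sub>v v) \<le> (1 + c) * (v \<bullet> (Hf x *\<^sub>v v)))"

lemma nearD:
  assumes "near c x" "v \<in> carrier_vec d"
  shows "v \<bullet> (Hf x *\<^sub>v v) \<le> (1 + c) * (v \<bullet> (Hf xs *\<^sub>v v))"
    "v \<bullet> (Hf xs *\<^sub>v v) \<le> (1 + c) * (v \<bullet> (Hf x *\<^sub>v v))"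
  using assms by (auto simp: near_def)

lemma near_if_dist:
  assumes x: "x \<in> carrier_vec d" and c: "M * vnorm (x - xs) / \<mu> \<le> c"
  shows "near c x"
  unfolding near_def
proof (intro conjI ballI x)
  fix v :: "real vec" assume v: "v \<in> carrier_vec d"
  let ?a = "v \<bullet> (Hf x *\<^sub>v v)" and ?b = "v \<bullet> (Hf xs *\<^sub>v v)"
  have "\<bar>?a - ?b\<bar> \<le> M * vnorm (x - xs) * vnorm v * vnorm v"
    by (rule hess_lipschitz) (use x v in auto)
  also have "\<dots> = M * vnorm (x - xs) / \<mu> * (\<mu> * (v \<bullet> v))"
    using mu_pos by (simp add: vnorm_sq[symmetric] power2_eq_square)
  also have "\<dots> \<le> c * (\<mu> * (v \<bullet> v))"
    using mu_pos scalar_self_nonneg[of v] by (intro mult_right_mono c) auto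
  finally have ab: "\<bar>?a - ?b\<bar> \<le> c * (\<mu> * (v \<bullet> v))" .
  have c0: "c \<ge> 0" using c M_pos mu_pos vnorm_nonneg[of "x - xs"] by (smt (verit) divide_nonneg_nonneg mult_nonneg_nonneg)
  have "c * (\<mu> * (v \<bullet> v)) \<le> c * ?a" "c * (\<mu> * (v \<bullet> v)) \<le> c * ?b"
    using hess_lower[OF x v] hess_lower[OF xs_carrier v] c0 by (auto intro: mult_left_mono)
  then show "?a \<le> (1 + c) * ?b" "?b \<le> (1 + c) * ?a" using ab by (auto simp: algebra_simps)
qed

lemma C_eq: "C x = M / \<mu> * sqrt (2 * (f x - f xs) / \<mu>)"
proof -
  have "\<mu> powr (3/2) = \<mu> * sqrt \<mu>"
    using mu_pos powr_add[of \<mu> 1 "1/2"] by (simp add: powr_half_sqrt)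
  then show ?thesis by (simp add: C_def C_const_def real_sqrt_divide)
qed

lemma C_nonneg: "x \<in> carrier_vec d \<Longrightarrow> C x \<ge> 0"
  using f_min mu_pos M_pos by (simp add: C_eq)

lemma near_sublevel:
  assumes z: "z \<in> carrier_vec d" and fz: "f z \<le> f x"
  shows "near (C x) z"
proof (rule near_if_dist[OF z])
  have "(vnorm (z - xs))\<^sup>2 \<le> 2 * (f z - f xs) / \<mu>" by (rule dist_minimizer_le[OF z])
  also have "\<dots> \<le> 2 * (f x - f xs) / \<mu>" using fz mu_pos by (intro divide_right_mono) auto
  finally have "vnorm (z - xs) \<le> sqrt (2 * (f x - f xs) / \<mu>)" by (rule real_le_rsqrt)
  then have "M / \<mu> * vnorm (z - xs) \<le> M / \<mu> * sqrt (2 * (f x - f xs) / \<mu>)"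
    using M_pos mu_pos by (intro mult_left_mono) auto
  then show "M * vnorm (z - xs) / \<mu> \<le> C x" by (simp add: C_eq)
qed

lemma near_segment:
  assumes x: "x \<in> carrier_vec d" and s: "s \<in> carrier_vec d"
    and f: "f x \<le> f u" "f (x + s) \<le> f u" and t: "0 \<le> t" "t \<le> 1"
  shows "near (C u) (x + t \<cdot>\<^sub>v s)"
proof (rule near_sublevel)
  have xs: "x + s \<in> carrier_vec d" using x s by simp
  have "(1 - t) \<cdot>\<^sub>v x + t \<cdot>\<^sub>v (x + s) = x + t \<cdot>\<^sub>v s" using x s by (intro eq_vecI) (auto simp: algebra_simps)
  then have "f (x + t \<cdot>\<^sub>v s) \<le> (1 - t) * f x + t * f (x + s) - \<mu> / 2 * t * (1 - t) * (vnorm (x - (x + s)))\<^sup>2"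
    using sconvex x xs t unfolding strongly_convex_def by (metis atLeastAtMost_iff)
  also have "\<dots> \<le> (1 - t) * f x + t * f (x + s)" using mu_pos t by simp
  also have "\<dots> \<le> (1 - t) * f u + t * f u" using f t by (intro add_mono mult_left_mono) auto
  also have "\<dots> = f u" by (simp add: algebra_simps)
  finally show "f (x + t \<cdot>\<^sub>v s) \<le> f u" .
qed (use x s in auto)

lemma step_cocoercive:
  assumes PQ: "spd_inverse d (Hf xs) Q"
    and x: "x \<in> carrier_vec d" and s: "s \<in> carrier_vec d" and f: "f x \<le> f u" "f (x + s) \<le> f u"
  shows "(Df (x + s) - Df x) \<bullet> (Q *\<^sub>v (Df (x + s) - Df x)) \<le> (1 + C u) * (s \<bullet> (Df (x + s) - Df x))"
proof (rule gradient_cocoercive[OF PQ _ x s])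
  show "0 < 1 + C u"
  proof -
    have "f xs \<le> f u" using f(1) f_min[OF x] by linarith
    then show ?thesis using mu_pos M_pos by (simp add: C_eq add_pos_nonneg)
  qed
  fix t :: real and v :: "real vec" assume "0 \<le> t" "t \<le> 1" "v \<in> carrier_vec d"
  then show "v \<bullet> (Hf (x + t \<cdot>\<^sub>v s) *\<^sub>v v) \<le> (1 + C u) * (v \<bullet> (Hf xs *\<^sub>v v))"
    using near_segment[OF x s f] nearD(1) by blast
qed

lemma gradient_diff_form:
  assumes x: "x \<in> carrier_vec d" and s: "s \<in> carrier_vec d"
  obtains t where "0 < t" "t < 1" "s \<bullet> (Df (x + s) - Df x) = s \<bullet> (Hf (x + t \<cdot>\<^sub>v s) *\<^sub>v s)"
proof -
  have xs: "x + s \<in> carrier_vec d" using x s by simp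
  have "s \<bullet> (Df (x + s) - Df x) = Df (x + s) \<bullet> s - Df x \<bullet> s"
    using x xs s comm_scalar_prod[OF s Df_carrier[OF x]] comm_scalar_prod[OF s Df_carrier[OF xs]]
    by (simp add: scalar_prod_minus_distrib[where n=d])
  then show thesis using gradient_mvt[OF x s s] that by metis
qed

lemma step_curvature:
  assumes x: "x \<in> carrier_vec d" and s: "s \<in> carrier_vec d" and f: "f x \<le> f u" "f (x + s) \<le> f u"
  shows "s \<bullet> (Hf xs *\<^sub>v s) \<le> (1 + C u) * (s \<bullet> (Df (x + s) - Df x))"
    and "s \<bullet> (Df (x + s) - Df x) \<le> (1 + C u) * (s \<bullet> (Hf xs *\<^sub>v s))"
proof -
  obtain t where t: "0 < t" "t < 1" "s \<bullet> (Df (x + s) - Df x) = s \<bullet> (Hf (x + t \<cdot>\<^sub>v s) *\<^sub>v s)"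
    using gradient_diff_form[OF x s] by metis
  then have "near (C u) (x + t \<cdot>\<^sub>v s)" using near_segment[OF x s f] by simp
  then show "s \<bullet> (Hf xs *\<^sub>v s) \<le> (1 + C u) * (s \<bullet> (Df (x + s) - Df x))"
    "s \<bullet> (Df (x + s) - Df x) \<le> (1 + C u) * (s \<bullet> (Hf xs *\<^sub>v s))"
    unfolding t(3) using nearD s by blast+
qed

lemma suboptimality_bounds:
  assumes x: "x \<in> carrier_vec d"
  shows "f x - f xs \<le> (1 + C x) / 2 * ((x - xs) \<bullet> (Hf xs *\<^sub>v (x - xs)))"
    and "(x - xs) \<bullet> (Hf xs *\<^sub>v (x - xs)) \<le> 2 * (1 + C x) * (f x - f xs)"
proof -
  let ?e = "x - xs"
  have e: "?e \<in> carrier_vec d" using x by simp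
  obtain t where t: "0 < t" "t < 1"
    "f (xs + ?e) = f xs + Df xs \<bullet> ?e + (?e \<bullet> (Hf (xs + t \<cdot>\<^sub>v ?e) *\<^sub>v ?e)) / 2"
    using taylor2[OF xs_carrier e] by metis
  have "near (C x) (xs + t \<cdot>\<^sub>v ?e)"
    using t f_min[OF x] x by (intro near_segment) (auto simp: add_diff_cancel_vec)
  moreover have "Df xs \<bullet> ?e = 0" using e by (simp add: gradient_at_minimizer)
  then have form: "?e \<bullet> (Hf (xs + t \<cdot>\<^sub>v ?e) *\<^sub>v ?e) = 2 * (f x - f xs)"
    using t(3) x by (simp add: add_diff_cancel_vec)
  ultimately show "f x - f xs \<le> (1 + C x) / 2 * (?e \<bullet> (Hf xs *\<^sub>v ?e))"
    "?e \<bullet> (Hf xs *\<^sub>v ?e) \<le> 2 * (1 + C x) * (f x - f xs)"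
    using nearD[of "C x" "xs + t \<cdot>\<^sub>v ?e" ?e, unfolded form] e by (auto simp: algebra_simps)
qed

text \<open>
  All three comparisons are along the segment from the minimizer to \<open>x\<close>, where the Hessian is within
  \<open>1 + C x\<close> of the one at the minimizer: gap and \<open>g\<^sup>T Q g\<close> are both compared with the
  weighted square of \<open>x - xs\<close>.
\<close>
lemma weighted_gradient_bounds:
  assumes PQ: "spd_inverse d (Hf xs) Q" and x: "x \<in> carrier_vec d"
  shows "2 * (f x - f xs) / (1 + C x) ^ 3 \<le> Df x \<bullet> (Q *\<^sub>v Df x)"
    and "Df x \<bullet> (Q *\<^sub>v Df x) \<le> 2 * (1 + C x) ^ 3 * (f x - f xs)"
proof -
  let ?e = "x - xs" and ?g = "Df x"
  define c where "c = 1 + C x"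
  have c: "c > 0" using C_nonneg[OF x] by (simp add: c_def)
  have e: "?e \<in> carrier_vec d" and g: "?g \<in> carrier_vec d" using x by auto
  define E where "E = ?e \<bullet> (Hf xs *\<^sub>v ?e)"
  have y: "Df (xs + ?e) - Df xs = ?g"
    using x g by (simp add: add_diff_cancel_vec gradient_at_minimizer)
  have f: "f xs \<le> f x" "f (xs + ?e) \<le> f x" using f_min[OF x] x by (auto simp: add_diff_cancel_vec)
  have eg: "E \<le> c * (?e \<bullet> ?g)" "?e \<bullet> ?g \<le> c * E"
    using step_curvature[OF xs_carrier e f] unfolding y by (auto simp: E_def c_def)
  have sub: "f x - f xs \<le> c / 2 * E" "E \<le> 2 * c * (f x - f xs)"
    using suboptimality_bounds[OF x] by (auto simp: E_def c_def)
  have "0 \<le> (1 / c)\<^sup>2 * E - 2 * (1 / c) * (?e \<bullet> ?g) + ?g \<bullet> (Q *\<^sub>v ?g)"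
    using spd_inverse_young[OF PQ e g, of "1 / c"] by (simp add: E_def)
  moreover have "2 * (1 / c) * (?e \<bullet> ?g) \<ge> 2 * (1 / c)\<^sup>2 * E"
    using eg(1) c by (simp add: field_simps power2_eq_square)
  ultimately have "(1 / c)\<^sup>2 * E \<le> ?g \<bullet> (Q *\<^sub>v ?g)" by linarith
  moreover have "2 * (f x - f xs) / c ^ 3 \<le> (1 / c)\<^sup>2 * E"
  proof -
    have "2 * (f x - f xs) / c ^ 3 \<le> c * E / c ^ 3" using sub(1) c by (intro divide_right_mono) auto
    also have "\<dots> = (1 / c)\<^sup>2 * E" using c by (simp add: power2_eq_square power3_eq_cube)
    finally show ?thesis .
  qed
  ultimately show "2 * (f x - f xs) / (1 + C x) ^ 3 \<le> ?g \<bullet> (Q *\<^sub>v ?g)" by (simp add: c_def)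
  have "?g \<bullet> (Q *\<^sub>v ?g) \<le> c * (?e \<bullet> ?g)"
    using step_cocoercive[OF PQ xs_carrier e f] unfolding y by (simp add: c_def)
  also have "\<dots> \<le> c * (c * E)" using eg(2) c by (intro mult_left_mono) auto
  also have "\<dots> \<le> c * (c * (2 * c * (f x - f xs)))" using sub(2) c by (intro mult_left_mono) auto
  finally show "?g \<bullet> (Q *\<^sub>v ?g) \<le> 2 * (1 + C x) ^ 3 * (f x - f xs)"
    by (simp add: c_def[symmetric] power3_eq_cube mult_ac)
qed

text \<open>
  Before the step is accepted nothing is known about \<open>f (x + p)\<close>, so the end point cannot be controlled by
  the sublevel set of \<open>x\<close>. Instead the length of \<open>p\<close> is bounded through
  \<open>\<rho>\<^sup>2 p\<^sup>T P p \<le> g\<^sup>T Q g\<close>, which makes \<open>p\<close> at most four times as long as the bound on the distance of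
  \<open>x\<close> to the minimizer.
\<close>
lemma near_unit_segment:
  assumes PQ: "spd_inverse d (Hf xs) Q" and x: "x \<in> carrier_vec d" and p: "p \<in> carrier_vec d"
    and rho: "- (Df x \<bullet> p) = \<rho> * (p \<bullet> (Hf xs *\<^sub>v p))" "3/4 \<le> \<rho>"
    and C: "5 * C x \<le> \<delta>" "\<delta> \<le> 1" and t: "0 \<le> t" "t \<le> 1"
  shows "near \<delta> (x + t \<cdot>\<^sub>v p)"
proof (rule near_if_dist)
  let ?g = "Df x"
  have g: "?g \<in> carrier_vec d" using x by simp
  define E where "E = p \<bullet> (Hf xs *\<^sub>v p)"
  define D where "D = f x - f xs"
  have D: "D \<ge> 0" using f_min[OF x] by (simp add: D_def)
  have C0: "C x \<ge> 0" by (rule C_nonneg[OF x])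
  have "0 \<le> (- \<rho>)\<^sup>2 * E - 2 * (- \<rho>) * (p \<bullet> ?g) + ?g \<bullet> (Q *\<^sub>v ?g)"
    using spd_inverse_young[OF PQ p g, of "- \<rho>"] by (simp add: E_def)
  also have "p \<bullet> ?g = - \<rho> * E" using rho(1) comm_scalar_prod[OF p g] by (simp add: E_def)
  finally have "\<rho>\<^sup>2 * E \<le> ?g \<bullet> (Q *\<^sub>v ?g)" by (simp add: power2_eq_square mult_ac)
  also have "\<dots> \<le> 2 * (1 + C x) ^ 3 * D" using weighted_gradient_bounds(2)[OF PQ x] by (simp add: D_def)
  also have "\<dots> \<le> 2 * (6/5) ^ 3 * D"
    using C C0 D by (intro mult_right_mono mult_left_mono power_mono) auto
  finally have "\<rho>\<^sup>2 * E \<le> 2 * (6/5) ^ 3 * D" .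
  moreover have E: "E \<ge> 0" unfolding E_def by (rule spd_nonneg[OF spd_Hf p]) simp
  have "(3/4)\<^sup>2 * E \<le> \<rho>\<^sup>2 * E" using rho(2) E by (intro mult_right_mono power_mono) auto
  ultimately have "(3/4)\<^sup>2 * E \<le> 2 * (6/5) ^ 3 * D" by linarith
  then have "E \<le> 32 * D" using D by (simp add: power2_eq_square power3_eq_cube)
  moreover have "\<mu> * (p \<bullet> p) \<le> E" unfolding E_def by (rule hess_lower) (use p in auto)
  ultimately have "\<mu> * (p \<bullet> p) \<le> 32 * D" by linarith
  then have "(vnorm p)\<^sup>2 \<le> 4\<^sup>2 * (2 * D / \<mu>)" using mu_pos by (simp add: vnorm_sq field_simps)
  then have "vnorm p \<le> sqrt (4\<^sup>2 * (2 * D / \<mu>))" by (rule real_le_rsqrt)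
  then have np: "vnorm p \<le> 4 * sqrt (2 * D / \<mu>)" by (simp only: real_sqrt_mult real_sqrt_abs abs_numeral)
  have nx: "vnorm (x - xs) \<le> sqrt (2 * D / \<mu>)"
    using dist_minimizer_le[OF x] by (auto simp: D_def intro: real_le_rsqrt)
  have "x + t \<cdot>\<^sub>v p - xs = (x - xs) + t \<cdot>\<^sub>v p" using x p by (intro eq_vecI) auto
  then have "vnorm (x + t \<cdot>\<^sub>v p - xs) \<le> vnorm (x - xs) + vnorm (t \<cdot>\<^sub>v p)"
    using vnorm_triangle[of "x - xs" d "t \<cdot>\<^sub>v p"] x p by simp
  also have "vnorm (t \<cdot>\<^sub>v p) \<le> vnorm p"
    using t vnorm_nonneg[of p] by (simp add: vnorm_smult mult_left_le_one_le)
  finally have "vnorm (x + t \<cdot>\<^sub>v p - xs) \<le> 5 * sqrt (2 * D / \<mu>)" using np nx by simp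
  then have "M / \<mu> * vnorm (x + t \<cdot>\<^sub>v p - xs) \<le> M / \<mu> * (5 * sqrt (2 * D / \<mu>))"
    using M_pos mu_pos by (intro mult_left_mono) auto
  also have "\<dots> = 5 * C x" by (simp add: C_eq D_def)
  finally show "M * vnorm (x + t \<cdot>\<^sub>v p - xs) / \<mu> \<le> \<delta>" using C(1) by simp
qed (use x p in auto)

text \<open>
  For a quadratic with Hessian \<open>P\<close>, the sufficient decrease condition reads
  \<open>2 (1 - \<alpha>) \<rho> \<ge> 1\<close> and the curvature condition
  \<open>(1 - \<beta>) \<rho> \<le> 1\<close>. At \<open>\<rho> = 1\<close> both are strict because \<open>\<alpha> < 1/2\<close> and
  \<open>\<beta> > 0\<close>, which leaves room for a relative perturbation of size \<open>\<delta>\<close>.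
\<close>
lemma unit_step_admissible:
  assumes PQ: "spd_inverse d (Hf xs) Q" and x: "x \<in> carrier_vec d"
    and p: "p \<in> carrier_vec d" "p \<noteq> 0\<^sub>v d"
    and rho: "- (Df x \<bullet> p) = \<rho> * (p \<bullet> (Hf xs *\<^sub>v p))" "\<bar>\<rho> - 1\<bar> \<le> \<delta>"
    and C: "5 * C x \<le> \<delta>" and delta: "\<delta> \<le> 1/4" "4 * \<delta> \<le> 1 - 2 * \<alpha>" "4 * \<delta> \<le> \<beta>"
    and ab: "0 < \<alpha>" "\<alpha> < 1" "0 < \<beta>" "\<beta> < 1"
  shows "armijo_wolfe \<alpha> \<beta> f Df x p 1"
proof -
  define E where "E = p \<bullet> (Hf xs *\<^sub>v p)"
  have E: "E > 0" unfolding E_def by (rule spdD(3)[OF spd_Hf p]) simp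
  have rho': "1 - \<delta> \<le> \<rho>" "\<rho> \<le> 1 + \<delta>" "3/4 \<le> \<rho>" using rho(2) delta(1) by auto
  have delta0: "\<delta> \<ge> 0" using rho(2) by linarith
  have gp: "Df x \<bullet> p = - \<rho> * E" using rho(1) by (simp add: E_def)
  have near: "near \<delta> (x + t \<cdot>\<^sub>v p)" if "0 < t" "t < 1" for t
    by (rule near_unit_segment[OF PQ x p(1) rho(1) rho'(3) C]) (use that delta in auto)
  have p1: "1 \<cdot>\<^sub>v p = p" by simp
  obtain t where t: "0 < t" "t < 1" "f (x + p) = f x + Df x \<bullet> p + (p \<bullet> (Hf (x + t \<cdot>\<^sub>v p) *\<^sub>v p)) / 2"
    using taylor2[OF x p(1)] by metis
  have "p \<bullet> (Hf (x + t \<cdot>\<^sub>v p) *\<^sub>v p) \<le> (1 + \<delta>) * E"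
    using nearD(1)[OF near[OF t(1,2)] p(1)] by (simp add: E_def)
  then have "f (x + p) \<le> f x + (- \<rho> + (1 + \<delta>) / 2) * E" unfolding t(3) gp by (simp add: algebra_simps)
  also have "(- \<rho> + (1 + \<delta>) / 2) * E \<le> (\<alpha> * (- \<rho>)) * E"
  proof (rule mult_right_mono)
    have "(1 - \<alpha>) * (1 - \<delta>) \<le> (1 - \<alpha>) * \<rho>" using rho' ab by (intro mult_left_mono) auto
    moreover have "(1 + \<delta>) / 2 \<le> (1 - \<alpha>) * (1 - \<delta>)"
    proof -
      have "\<alpha> * \<delta> \<ge> 0" using ab delta0 by simp
      have "(1 + \<delta>) / 2 \<le> 1 - \<alpha> - \<delta>" using delta delta0 by (simp add: field_simps)
      also have "\<dots> \<le> (1 - \<alpha>) * (1 - \<delta>)" using \<open>\<alpha> * \<delta> \<ge> 0\<close> by (simp add: algebra_simps)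
      finally show ?thesis .
    qed
    ultimately show "- \<rho> + (1 + \<delta>) / 2 \<le> \<alpha> * (- \<rho>)" by (simp add: algebra_simps)
  qed (use E in simp)
  finally have armijo: "f (x + p) \<le> f x + \<alpha> * 1 * (Df x \<bullet> p)" by (simp add: gp algebra_simps)
  obtain r where r: "0 < r" "r < 1" "Df (x + p) \<bullet> p - Df x \<bullet> p = p \<bullet> (Hf (x + r \<cdot>\<^sub>v p) *\<^sub>v p)"
    using gradient_mvt[OF x p(1) p(1)] by metis
  define h where "h = p \<bullet> (Hf (x + r \<cdot>\<^sub>v p) *\<^sub>v p)"
  have Eh: "E \<le> (1 + \<delta>) * h" using nearD(2)[OF near[OF r(1,2)] p(1)] by (simp add: E_def h_def)
  have "(1 - \<beta>) * \<rho> * E \<le> h"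
  proof -
    have "(1 - \<beta>) * \<rho> * (1 + \<delta>) \<le> (1 - \<beta>) * (1 + \<delta>) * (1 + \<delta>)"
      using rho' ab delta0 by (intro mult_right_mono mult_left_mono) auto
    also have "\<dots> \<le> (1 - \<beta>) * (1 + 3 * \<delta>)"
    proof -
      have "(1 + \<delta>) * (1 + \<delta>) \<le> 1 + 3 * \<delta>"
        using delta0 delta(1) mult_left_mono[of \<delta> "1/4" \<delta>] by (simp add: algebra_simps)
      then show ?thesis using ab by (simp only: mult.assoc mult_left_mono)
    qed
    also have "\<dots> \<le> 1"
    proof -
      have "\<beta> * \<delta> \<ge> 0" "3 * \<delta> \<le> \<beta>" using ab delta delta0 by auto
      then show ?thesis by (simp add: algebra_simps)
    qed
    finally have "(1 - \<beta>) * \<rho> * (1 + \<delta>) \<le> 1" .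
    moreover have h0: "h \<ge> 0" using Eh E delta0 by (smt (verit) mult_nonneg_nonpos)
    moreover have "(1 - \<beta>) * \<rho> * E \<le> (1 - \<beta>) * \<rho> * ((1 + \<delta>) * h)"
      using Eh ab rho' by (intro mult_left_mono) auto
    moreover have "((1 - \<beta>) * \<rho> * (1 + \<delta>)) * h \<le> 1 * h"
      using calculation(1) h0 by (rule mult_right_mono)
    ultimately show ?thesis by (simp add: mult_ac)
  qed
  then have "Df (x + p) \<bullet> p \<ge> \<beta> * (Df x \<bullet> p)" using r(3) gp by (simp add: h_def algebra_simps)
  then show ?thesis using armijo by (simp add: armijo_wolfe_def p1)
qed

end

section \<open>Scalar inequalities\<close>

text \<open>
  With \<open>G\<close> the geometric mean of the \<open>1 - r i\<close>, the inequality of arithmetic and geometric means is used twice: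
  the mean of the \<open>1 - r i\<close> is at least \<open>G\<close>, and the geometric mean of the \<open>r i\<close> is at most their
  arithmetic mean, which is then at most \<open>1 - G\<close>.
\<close>
lemma prod_le_of_sum_ln:
  fixes r :: "nat \<Rightarrow> real"
  assumes t: "t > 0" and r: "\<And>i. i < t \<Longrightarrow> 0 < r i \<and> r i < 1"
    and A: "- A \<le> (\<Sum>i<t. ln (1 - r i))"
  shows "(\<Prod>i<t. r i) \<le> (1 - exp (- A / t)) ^ t"
proof -
  define S where "S = (\<Sum>i<t. ln (1 - r i))"
  define G where "G = exp (S / t)"
  have G: "G > 0" by (simp add: G_def)
  have "(\<Sum>i<t. 1 + (ln (1 - r i) - S / t)) \<le> (\<Sum>i<t. (1 - r i) / G)"
  proof (intro sum_mono)
    fix i assume "i \<in> {..<t}"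
    then have "(1 - r i) / G = exp (ln (1 - r i) - S / t)" using r[of i] by (simp add: exp_diff G_def)
    then show "1 + (ln (1 - r i) - S / t) \<le> (1 - r i) / G" using exp_ge_add_one_self by metis
  qed
  also have "(\<Sum>i<t. 1 + (ln (1 - r i) - S / t)) = real t"
    using t by (simp add: sum.distrib sum_subtractf S_def)
  also have "(\<Sum>i<t. (1 - r i) / G) = (t - (\<Sum>i<t. r i)) / G"
    by (simp add: sum_subtractf flip: sum_divide_distrib)
  finally have sum: "(\<Sum>i<t. r i) \<le> t * (1 - G)" using G by (simp add: field_simps)
  have "0 < (\<Sum>i<t. r i)" using t r by (intro sum_pos) auto
  then have G1: "1 - G > 0" using sum t by (smt (verit) mult_nonneg_nonpos of_nat_0_le_iff)
  have "(\<Prod>i<t. r i / (1 - G)) \<le> (\<Prod>i<t. exp (r i / (1 - G) - 1))"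
  proof (intro prod_mono conjI)
    fix i assume "i \<in> {..<t}"
    then show "0 \<le> r i / (1 - G)" using r[of i] G1 by simp
    show "r i / (1 - G) \<le> exp (r i / (1 - G) - 1)" using exp_ge_add_one_self[of "r i / (1 - G) - 1"] by simp
  qed
  also have "\<dots> = exp ((\<Sum>i<t. r i) / (1 - G) - t)"
    by (simp add: sum_subtractf sum_divide_distrib flip: exp_sum)
  also have "\<dots> \<le> 1" using sum G1 by (simp add: divide_le_eq)
  also have "(\<Prod>i<t. r i / (1 - G)) = (\<Prod>i<t. r i) / (1 - G) ^ t" by (simp add: prod_dividef)
  finally have "(\<Prod>i<t. r i) \<le> (1 - G) ^ t" using G1 by (simp add: divide_le_eq)
  also have "\<dots> \<le> (1 - exp (- A / t)) ^ t"
  proof (rule power_mono)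
    have "- A / t \<le> S / t" using A t unfolding S_def by (intro divide_right_mono) auto
    then have "exp (- A / t) \<le> G" unfolding G_def by (simp only: exp_le_cancel_iff)
    then show "1 - G \<le> 1 - exp (- A / t)" by simp
  qed (use G1 in simp)
  finally show ?thesis .
qed

definition omega :: "real \<Rightarrow> real" where
  "omega \<rho> = \<rho> - 1 - ln \<rho>"

text \<open>
  A form of \<open>ln u \<le> u - 1\<close> at \<open>u = sqrt \<rho>\<close>; it yields quadratic growth near \<open>1\<close> and a positive
  lower bound away from \<open>1\<close>.
\<close>
lemma omega_ge_sqrt: 
  assumes "\<rho> > 0" shows "(sqrt \<rho> - 1)\<^sup>2 \<le> omega \<rho>"
proof -
  have "ln \<rho> = 2 * ln (sqrt \<rho>)" using assms by (simp add: ln_sqrt)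
  also have "\<dots> \<le> 2 * (sqrt \<rho> - 1)" using assms ln_le_minus_one[of "sqrt \<rho>"] by simp
  finally show ?thesis using assms by (simp add: omega_def power2_diff)
qed

lemma omega_nonneg: "\<rho> > 0 \<Longrightarrow> omega \<rho> \<ge> 0"
  using omega_ge_sqrt[of \<rho>] zero_le_power2[of "sqrt \<rho> - 1"] by linarith

lemma diff_one_factor: "\<rho> > 0 \<Longrightarrow> \<rho> - 1 = (sqrt \<rho> - 1) * (sqrt \<rho> + 1)"
  by (simp add: algebra_simps)

lemma omega_ge_square:
  assumes "\<bar>\<rho> - 1\<bar> \<le> 1/4" shows "(\<rho> - 1)\<^sup>2 \<le> 5 * omega \<rho>"
proof -
  have rho: "\<rho> > 0" "\<rho> \<le> 5/4" using assms unfolding abs_le_iff by linarith+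
  have "sqrt \<rho> \<le> 9/8" using rho by (intro real_le_lsqrt) (auto simp: power2_eq_square)
  then have "(sqrt \<rho> + 1)\<^sup>2 \<le> (17/8)\<^sup>2" using rho by (intro power_mono) auto
  then have "(sqrt \<rho> + 1)\<^sup>2 \<le> 5" by (simp add: power2_eq_square)
  then have "(sqrt \<rho> - 1)\<^sup>2 * (sqrt \<rho> + 1)\<^sup>2 \<le> (sqrt \<rho> - 1)\<^sup>2 * 5" by (intro mult_left_mono) auto
  also have "\<dots> \<le> omega \<rho> * 5" by (intro mult_right_mono omega_ge_sqrt rho) auto
  finally show ?thesis unfolding diff_one_factor[OF rho(1)] power_mult_distrib by simp
qed

lemma omega_ge_far:
  assumes rho: "\<rho> > 0" and delta: "0 < \<delta>" "\<delta> \<le> 1" and far: "\<delta> < \<bar>\<rho> - 1\<bar>"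
  shows "\<delta>\<^sup>2 / 9 \<le> omega \<rho>"
proof (rule ccontr)
  assume "\<not> ?thesis"
  then have "(sqrt \<rho> - 1)\<^sup>2 < (\<delta> / 3)\<^sup>2" using omega_ge_sqrt[OF rho] by (simp add: power_divide)
  then have *: "\<bar>sqrt \<rho> - 1\<bar> < \<delta> / 3" using delta abs_le_square_iff[of "\<delta> / 3" "sqrt \<rho> - 1"] by linarith
  have "\<bar>\<rho> - 1\<bar> = \<bar>sqrt \<rho> - 1\<bar> * (sqrt \<rho> + 1)"
    unfolding diff_one_factor[OF rho] abs_mult using rho by simp
  also have "\<dots> \<le> \<delta> / 3 * 3"
  proof (rule mult_mono)
    show "sqrt \<rho> + 1 \<le> 3" using * delta unfolding abs_less_iff by linarith
  qed (use * rho delta in auto)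
  finally show False using far by simp
qed

text \<open>
  On a quadratic with \<open>C = 0\<close> the expression equals \<open>1 - (1 - 1 / \<rho>)\<^sup>2\<close>, and the deviation of
  \<open>\<rho>\<close> from \<open>1\<close> enters only to second order, as it does in \<open>omega \<rho>\<close>.
\<close>
lemma unit_step_progress:
  assumes C: "0 \<le> C" "C \<le> 1/20" and rho: "\<bar>\<rho> - 1\<bar> \<le> 1/4"
  defines "V \<equiv> 2 * ((1 - (1 + C) / (2 * \<rho>)) * (1 / ((1 + C) * \<rho>)))"
  shows "V > 0" "- 20 * (C + omega \<rho>) \<le> ln V"
proof -
  define u where "u = 1 / \<rho>"
  define z where "z = (1 - u)\<^sup>2 + C * u\<^sup>2"
  have rho': "\<rho> > 0" "3/4 \<le> \<rho>" "\<rho> \<le> 5/4" using rho unfolding abs_le_iff by linarith+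
  have u: "4/5 \<le> u" "u \<le> 4/3" using rho' by (auto simp: u_def field_simps)
  have u2: "u\<^sup>2 \<le> (4/3)\<^sup>2" using u by (intro power_mono) auto
  have "1 - u = (\<rho> - 1) * u" using rho' by (simp add: u_def field_simps)
  then have "(1 - u)\<^sup>2 = (\<rho> - 1)\<^sup>2 * u\<^sup>2" by (simp add: power_mult_distrib)
  also have "\<dots> \<le> (\<rho> - 1)\<^sup>2 * (4/3)\<^sup>2" using u2 by (intro mult_left_mono) auto
  also have "\<dots> \<le> 2 * (\<rho> - 1)\<^sup>2" by (simp add: power2_eq_square)
  finally have u1: "(1 - u)\<^sup>2 \<le> 2 * (\<rho> - 1)\<^sup>2" .
  have "\<bar>1 - u\<bar> \<le> 1/3" unfolding abs_le_iff using u by auto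
  then have "\<bar>1 - u\<bar>\<^sup>2 \<le> (1/3)\<^sup>2" by (intro power_mono) auto
  then have "(1 - u)\<^sup>2 \<le> 1/9" by (simp add: power2_eq_square)
  moreover have "C * u\<^sup>2 \<le> 1/20 * (4/3)\<^sup>2" using C u2 by (intro mult_mono) auto
  ultimately have z: "0 \<le> z" "z \<le> 1/2" using C by (auto simp: z_def power2_eq_square)
  have V: "V = (1 - z) / (1 + C)"
  proof -
    have "V = u * (2 - (1 + C) * u) / (1 + C)"
    proof -
      have "(1 + C) / (2 * \<rho>) = (1 + C) * u / 2" "1 / ((1 + C) * \<rho>) = u / (1 + C)" by (simp_all add: u_def)
      moreover have "2 * ((1 - a / 2) * (u / k)) = u * (2 - a) / k" for a k :: real
        by (simp add: algebra_simps diff_divide_distrib)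
      ultimately show ?thesis unfolding V_def by (simp only:)
    qed
    also have "u * (2 - (1 + C) * u) = 1 - z" by (simp add: z_def power2_eq_square algebra_simps)
    finally show ?thesis .
  qed
  show "V > 0" using V z C by simp
  have "ln V = ln (1 - z) - ln (1 + C)" using V z C by (simp add: ln_div)
  moreover have "ln (1 + C) \<le> C" using C by (intro ln_add_one_self_le_self) auto
  moreover have "- z - 2 * z\<^sup>2 \<le> ln (1 - z)" using z by (intro ln_one_minus_pos_lower_bound)
  moreover have "z\<^sup>2 \<le> z / 2" using z by (simp add: power2_eq_square mult_left_mono[of z "1/2" z, simplified])
  moreover have "z \<le> 2 * (\<rho> - 1)\<^sup>2 + 2 * C"
  proof -
    have "C * u\<^sup>2 \<le> C * (4/3)\<^sup>2" using C u2 by (intro mult_left_mono) auto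
    also have "\<dots> \<le> 2 * C" using C by (simp add: power2_eq_square)
    finally show ?thesis using u1 by (simp add: z_def)
  qed
  moreover have "(\<rho> - 1)\<^sup>2 \<le> 5 * omega \<rho>" by (rule omega_ge_square[OF rho])
  moreover have "omega \<rho> \<ge> 0" by (rule omega_nonneg[OF rho'(1)])
  ultimately show "- 20 * (C + omega \<rho>) \<le> ln V" using C(1) by argo
qed

lemma sum_sqrt_geometric_le:
  fixes x :: real
  assumes x: "0 < x" "x \<le> 1"
  shows "(\<Sum>i<t. sqrt ((1 - x) ^ i)) \<le> 2 / x"
proof -
  \<comment> \<open>\<open>sqrt (1 - x) \<le> 1 - x / 2\<close> turns the square roots into a geometric series.\<close>
  define y where "y = 1 - x / 2"
  have y: "0 \<le> y" "y < 1" using x by (auto simp: y_def)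
  have "sqrt (1 - x) \<le> y" using x y by (intro real_le_lsqrt) (auto simp: y_def power2_eq_square algebra_simps)
  then have "(\<Sum>i<t. sqrt ((1 - x) ^ i)) \<le> (\<Sum>i<t. y ^ i)"
    using x by (intro sum_mono) (auto simp: real_sqrt_power intro: power_mono)
  also have "\<dots> = (1 - y ^ t) / (1 - y)" using y by (simp add: sum_gp_strict)
  also have "\<dots> \<le> 1 / (1 - y)" using y by (intro divide_right_mono) auto
  also have "\<dots> = 2 / x" by (simp add: y_def)
  finally show ?thesis .
qed

lemma linear_threshold:
  assumes x: "0 < x" "x \<le> 1" and t: "l / x \<le> real t"
  shows "(1 - x) ^ t \<le> exp (- l)"
proof -
  have "(1 - x) ^ t \<le> exp (- x) ^ t" using x exp_ge_add_one_self[of "- x"] by (intro power_mono) auto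
  also have "\<dots> = exp (- (x * t))" by (simp add: exp_of_nat_mult[symmetric] mult.commute)
  also have "\<dots> \<le> exp (- l)" using t x by (simp add: divide_le_eq mult.commute)
  finally show ?thesis .
qed

text \<open>
  After \<open>A\<close> steps the contraction factor is at most \<open>1 - 1 / e\<close>.
\<close>
lemma improved_linear_threshold:
  assumes A: "0 \<le> A" and t: "t > 0" "A \<le> real t" "l \<le> exp (-1) * real t"
  shows "(1 - exp (- A / t)) ^ t \<le> exp (- l)"
proof -
  have "- 1 \<le> - A / t" using t by (simp add: field_simps)
  then have "exp (-1) \<le> exp (- A / t)" by simp
  then have "(1 - exp (- A / t)) ^ t \<le> (1 - exp (- 1)) ^ t"
    using A t by (intro power_mono) auto
  also have "\<dots> \<le> exp (- l)" using t(3) by (intro linear_threshold) (auto simp: divide_le_eq mult.commute)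
  finally show ?thesis .
qed

text \<open>
  The base \<open>1 - exp (- K X / t)\<close> is at most \<open>K X / t\<close>. The number
  \<open>z = 1/2 + sqrt (1/4 + l / X)\<close> solves \<open>z (z - 1) = l / X\<close>, so \<open>ln z \<le> z - 1\<close> gives
  \<open>l / ln z \<ge> X z\<close>. Hence \<open>K X / t \<le> 1 / z\<close>, and \<open>t \<ge> l / ln z\<close> finishes.
\<close>
lemma superlinear_threshold:
  assumes X: "0 < X" and l: "0 < l" and K: "1 \<le> K"
    and t: "K * (l / ln (1/2 + sqrt (1/4 + l / X))) \<le> real t"
  shows "t > 0" "(1 - exp (- (K * X) / t)) ^ t \<le> exp (- l)"
proof -
  define s where "s = sqrt (1/4 + l / X)"
  define z where "z = 1/2 + s"
  define T where "T = l / ln z"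
  have q: "l / X > 0" using X l by simp
  have "sqrt ((1/2)\<^sup>2) < s" unfolding s_def using q by (intro real_sqrt_less_mono) (simp add: power2_eq_square)
  then have "1/2 < s" by simp
  then have z: "z > 1" by (simp add: z_def)
  have "s\<^sup>2 = 1/4 + l / X" using q by (simp add: s_def)
  then have zz: "z * (z - 1) = l / X" by (simp add: z_def power2_eq_square algebra_simps)
  have lnz: "0 < ln z" "ln z \<le> z - 1" using z by (auto intro: ln_le_minus_one)
  have T: "T > 0" using l lnz by (simp add: T_def)
  have "X * z = l / (z - 1)" using zz X z by (simp add: field_simps)
  also have "\<dots> \<le> T" unfolding T_def using lnz l by (intro divide_left_mono) auto
  finally have XT: "X * z \<le> T" .
  have tT: "K * T \<le> t" using t by (simp add: T_def z_def s_def)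
  have KT: "T \<le> K * T" using mult_right_mono[OF K, of T] T by simp
  then have t0: "real t > 0" using tT T by linarith
  then show tp: "t > 0" by simp
  have "K * X * z \<le> K * T" using mult_left_mono[OF XT, of K] K by (simp add: mult.assoc)
  then have "K * X * z \<le> t" using tT by linarith
  then have "K * X / t \<le> 1 / z" using t0 z by (simp add: field_simps)
  moreover have "1 - exp (- (K * X) / t) \<le> K * X / t"
    using exp_ge_add_one_self[of "- (K * X) / t"] by simp
  ultimately have "(1 - exp (- (K * X) / t)) ^ t \<le> (1 / z) ^ t"
    using K X t0 by (intro power_mono) auto
  also have "\<dots> = exp (- (ln z * t))"
    using z by (simp add: exp_minus exp_of_nat2_mult power_one_over inverse_eq_divide)
  also have "\<dots> \<le> exp (- l)"
  proof -
    have "l = ln z * T" using lnz by (simp add: T_def)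
    also have "\<dots> \<le> ln z * t" using KT tT lnz by (intro mult_left_mono) auto
    finally show ?thesis by simp
  qed
  finally show "(1 - exp (- (K * X) / t)) ^ t \<le> exp (- l)" .
qed

section \<open>A BFGS run with a unit-step-first line search\<close>

text \<open>
  How far \<open>\<rho>\<close> may be from \<open>1\<close> (and \<open>5 C\<close> from \<open>0\<close>) for the unit step to be accepted.
\<close>
definition unit_radius :: "real \<Rightarrow> real \<Rightarrow> real" where
  "unit_radius \<alpha> \<beta> = min ((1 - 2 * \<alpha>) / 4) (\<beta> / 4)"

text \<open>
  The guaranteed value of the line search factor, times the constant \<open>2\<close> of the gradient dominance.
\<close>
definition worst_progress :: "real \<Rightarrow> real \<Rightarrow> real" where
  "worst_progress \<alpha> \<beta> = 2 * \<alpha> * (1 - \<beta>)"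

text \<open>
  The first entry serves the steps of \<open>unit_step_progress\<close>. In all other steps \<open>C + omega \<rho>\<close> is at least
  \<open>(unit_radius \<alpha> \<beta>)\<^sup>2 / 9\<close>, so the second entry covers the worst line search factor.
\<close>
definition loss_const :: "real \<Rightarrow> real \<Rightarrow> real" where
  "loss_const \<alpha> \<beta> = max 20 (- ln (worst_progress \<alpha> \<beta>) * 9 / (unit_radius \<alpha> \<beta>)\<^sup>2)"

text \<open>
  Summing the losses gives the coefficient \<open>3 loss_const + 4\<close> for the sum of the \<open>C (x i)\<close>; that sum
  is a geometric series, which contributes \<open>2 / worst_progress\<close>.
\<close>
definition total_const :: "real \<Rightarrow> real \<Rightarrow> real" where
  "total_const \<alpha> \<beta> = (3 * loss_const \<alpha> \<beta> + 4) * 2 / worst_progress \<alpha> \<beta>"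

locale bfgs_run = smooth_objective d f Df Hf \<mu> L M xs
  for d f Df Hf \<mu> L M xs +
  fixes \<alpha> \<beta> :: real and x :: "nat \<Rightarrow> real vec" and B :: "nat \<Rightarrow> real mat" and \<eta> :: "nat \<Rightarrow> real"
  assumes alpha: "0 < \<alpha>" "\<alpha> < 1/2" and beta: "\<alpha> < \<beta>" "\<beta> < 1"
    and iterates: "bfgs_iterates d Df (L \<cdot>\<^sub>m 1\<^sub>m d) x B \<eta>"
    and line_search: "armijo_wolfe_unit_first \<alpha> \<beta> f Df x B \<eta>"
begin

abbreviation g :: "nat \<Rightarrow> real vec" where "g t \<equiv> Df (x t)"
definition p :: "nat \<Rightarrow> real vec" where "p t = bfgs_direction (B t) (g t)"
definition s :: "nat \<Rightarrow> real vec" where "s t = x (Suc t) - x t"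
definition y :: "nat \<Rightarrow> real vec" where "y t = g (Suc t) - g t"
abbreviation gap :: "nat \<Rightarrow> real" where "gap t \<equiv> f (x t) - f xs"
definition r :: "nat \<Rightarrow> real" where "r t = gap (Suc t) / gap t"

lemma x0: "x 0 \<in> carrier_vec d" and B0: "B 0 = L \<cdot>\<^sub>m 1\<^sub>m d"
  and g_nz: "g t \<noteq> 0\<^sub>v d" and eta_pos: "\<eta> t > 0"
  and x_Suc: "x (Suc t) = x t + \<eta> t \<cdot>\<^sub>v p t"
  and B_Suc: "B (Suc t) = bfgs_update (B t) (s t) (y t)"
  using iterates by (auto simp: bfgs_iterates_def p_def s_def y_def)

lemma direction:
  assumes x: "x t \<in> carrier_vec d" and B: "spd d (B t)"
  shows "p t \<in> carrier_vec d" "p t \<noteq> 0\<^sub>v d" "B t *\<^sub>v p t = - g t"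
proof -
  have g: "g t \<in> carrier_vec d" using x by simp
  note B' = spdD(1)[OF B]
  obtain Q where Q: "mat_inverse (B t) = Some Q" "B t * Q = 1\<^sub>m d" "Q \<in> carrier_mat d d"
    using spd_mat_inverse[OF B] by metis
  have p: "p t = - (Q *\<^sub>v g t)" using Q(1) by (simp add: p_def bfgs_direction_def)
  have Qg: "Q *\<^sub>v g t \<in> carrier_vec d" using Q g by simp
  then show pc: "p t \<in> carrier_vec d" by (simp add: p)
  have "- (Q *\<^sub>v g t) = (- 1) \<cdot>\<^sub>v (Q *\<^sub>v g t)" using Qg by (intro eq_vecI) auto
  then have "B t *\<^sub>v p t = (- 1) \<cdot>\<^sub>v (B t *\<^sub>v (Q *\<^sub>v g t))"
    unfolding p by (simp only: mult_mat_vec[OF B' Qg])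
  also have "B t *\<^sub>v (Q *\<^sub>v g t) = (B t * Q) *\<^sub>v g t" by (rule assoc_mult_mat_vec[symmetric, OF B' Q(3) g])
  also have "\<dots> = g t" using g by (simp add: Q(2))
  also have "(- 1) \<cdot>\<^sub>v g t = - g t" using g by (intro eq_vecI) auto
  finally show Bp: "B t *\<^sub>v p t = - g t" .
  show "p t \<noteq> 0\<^sub>v d"
  proof
    assume "p t = 0\<^sub>v d"
    then have "B t *\<^sub>v p t = 0\<^sub>v d" using B' by auto
    then have "g t = 0\<^sub>v d" using Bp g by (metis uminus_uminus_vec uminus_zero_vec)
    then show False using g_nz by blast
  qed
qed

lemma step_facts:
  assumes x: "x t \<in> carrier_vec d" and B: "spd d (B t)"
  shows "s t = \<eta> t \<cdot>\<^sub>v p t" "s t \<in> carrier_vec d" "s t \<noteq> 0\<^sub>v d" "x (Suc t) = x t + s t"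
    "x (Suc t) \<in> carrier_vec d" "y t \<in> carrier_vec d" "s t \<bullet> y t > 0"
    "B t *\<^sub>v s t = (- \<eta> t) \<cdot>\<^sub>v g t"
proof -
  note p = direction[OF x B]
  show s: "s t = \<eta> t \<cdot>\<^sub>v p t" using x p(1) unfolding s_def x_Suc by (intro eq_vecI) auto
  show sc: "s t \<in> carrier_vec d" using p by (simp add: s)
  show snz: "s t \<noteq> 0\<^sub>v d"
  proof
    assume "s t = 0\<^sub>v d"
    then have "(1 / \<eta> t) \<cdot>\<^sub>v (\<eta> t \<cdot>\<^sub>v p t) = 0\<^sub>v d" unfolding s by auto
    then show False using p(2) eta_pos[of t] by (simp add: smult_smult_assoc)
  qed
  show xs': "x (Suc t) = x t + s t" by (simp add: x_Suc s)
  show xc: "x (Suc t) \<in> carrier_vec d" using x sc xs' by simp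
  show yc: "y t \<in> carrier_vec d" using x xc by (simp add: y_def)
  obtain a where a: "0 < a" "a < 1" "s t \<bullet> (Df (x t + s t) - g t) = s t \<bullet> (Hf (x t + a \<cdot>\<^sub>v s t) *\<^sub>v s t)"
    using gradient_diff_form[OF x sc] by metis
  have "0 < s t \<bullet> (Hf (x t + a \<cdot>\<^sub>v s t) *\<^sub>v s t)" by (rule spdD(3)[OF spd_Hf sc snz]) (use x sc in simp)
  then show "s t \<bullet> y t > 0" using a(3) by (simp add: y_def xs')
  have "B t *\<^sub>v s t = \<eta> t \<cdot>\<^sub>v (- g t)" unfolding s using p by (simp add: mult_mat_vec[OF spdD(1)[OF B]])
  also have "\<dots> = (- \<eta> t) \<cdot>\<^sub>v g t" using x by (intro eq_vecI) auto
  finally show "B t *\<^sub>v s t = (- \<eta> t) \<cdot>\<^sub>v g t" .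
qed

lemma invariant: "x t \<in> carrier_vec d \<and> spd d (B t)"
proof (induction t)
  case 0
  then show ?case using x0 B0 spd_inverseD(1)[OF spd_inverse_scaled_one[OF L_pos]] by simp
next
  case (Suc t)
  then show ?case using step_facts[of t] spd_bfgs_update[of d "B t" "s t" "y t"] by (simp add: B_Suc)
qed

lemma x_carrier [simp]: "x t \<in> carrier_vec d" and spd_B: "spd d (B t)"
  using invariant by auto

lemmas step = step_facts[OF x_carrier spd_B]

lemma g_carrier [simp]: "g t \<in> carrier_vec d" by simp

definition slope :: "nat \<Rightarrow> real" where "slope t = - (g t \<bullet> s t)"

lemma curvature_eq: "s t \<bullet> (B t *\<^sub>v s t) = \<eta> t * slope t"
  using step[of t] comm_scalar_prod[OF step(2)[of t] g_carrier[of t]] by (simp add: slope_def)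

lemma slope_pos: "slope t > 0"
proof -
  have "0 < s t \<bullet> (B t *\<^sub>v s t)" by (rule spdD(3)[OF spd_B step(2,3)])
  then show ?thesis unfolding curvature_eq using eta_pos[of t] by (simp add: zero_less_mult_iff)
qed

lemma armijo: "\<alpha> * slope t \<le> f (x t) - f (x (Suc t))"
  and wolfe: "(1 - \<beta>) * slope t \<le> s t \<bullet> y t"
proof -
  note st = step[of t]
  have aw: "armijo_wolfe \<alpha> \<beta> f Df (x t) (p t) (\<eta> t)"
    using line_search by (simp add: armijo_wolfe_unit_first_def Let_def p_def)
  have p: "p t \<in> carrier_vec d" by (rule direction(1)[OF x_carrier spd_B])
  have gs: "\<eta> t * (g t \<bullet> p t) = - slope t" using p st(1) by (simp add: slope_def)
  show "\<alpha> * slope t \<le> f (x t) - f (x (Suc t))"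
    using aw gs by (simp add: armijo_wolfe_def x_Suc mult.assoc)
  have "\<eta> t * (\<beta> * (g t \<bullet> p t)) \<le> \<eta> t * (g (Suc t) \<bullet> p t)"
    using aw eta_pos[of t] by (intro mult_left_mono) (auto simp: armijo_wolfe_def x_Suc)
  then have "- \<beta> * slope t \<le> g (Suc t) \<bullet> s t" using p st(1) gs by (simp add: mult.left_commute)
  moreover have "s t \<bullet> y t = g (Suc t) \<bullet> s t - g t \<bullet> s t"
    using st(2) comm_scalar_prod[OF st(2) g_carrier] by (simp add: y_def scalar_prod_minus_distrib[where n=d])
  ultimately show "(1 - \<beta>) * slope t \<le> s t \<bullet> y t" by (simp add: slope_def algebra_simps)
qed

lemma decreasing: "f (x (Suc t)) < f (x t)"
  using armijo[of t] mult_pos_pos[OF alpha(1) slope_pos[of t]] by linarith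

lemma gap_pos: "gap t > 0"
  using decreasing[of t] f_min[OF x_carrier[of "Suc t"]] by linarith

lemma r_bounds: "0 < r t" "r t < 1"
  using gap_pos[of t] gap_pos[of "Suc t"] decreasing[of t] by (auto simp: r_def)

lemma prod_r: "(\<Prod>i<t. r i) = gap t / gap 0"
proof (induction t)
  case (Suc t)
  then show ?case using gap_pos[of t] by (simp add: r_def)
qed (use gap_pos[of 0] in simp)

text \<open>
  The relative decrease of \<open>f\<close> times the relative curvature, both measured by the slope along the step;
  the two Armijo-Wolfe conditions bound one factor each.
\<close>
definition progress :: "nat \<Rightarrow> real" where
  "progress t = (f (x t) - f (x (Suc t))) / slope t * (s t \<bullet> y t / slope t)"

lemma progress_ge: "2 * progress t \<ge> worst_progress \<alpha> \<beta>"
proof -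
  have "\<alpha> * (1 - \<beta>) \<le> progress t"
    unfolding progress_def
    using armijo[of t] wolfe[of t] slope_pos[of t] alpha beta decreasing[of t]
    by (intro mult_mono) (auto simp: pos_le_divide_eq)
  then show ?thesis by (simp add: worst_progress_def)
qed

lemma worst_progress_pos: "worst_progress \<alpha> \<beta> > 0" "worst_progress \<alpha> \<beta> < 1"
proof -
  show "worst_progress \<alpha> \<beta> > 0" using alpha beta by (simp add: worst_progress_def)
  have "2 * \<alpha> * (1 - \<beta>) \<le> 2 * \<alpha> * 1" using alpha beta by (intro mult_left_mono) auto
  also have "\<dots> < 1" using alpha by simp
  finally show "worst_progress \<alpha> \<beta> < 1" by (simp only: worst_progress_def)
qed

text \<open>
  \<open>1 - r t\<close> is the product of \<open>progress t\<close>, the gradient dominance \<open>g\<^sup>T Q g / gap\<close> and the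
  quantity whose logarithm \<open>potential_decrease_angle\<close> controls. In the latter \<open>B s = - \<eta> g\<close>, and the
  step size cancels.
\<close>
lemma ln_one_minus_r:
  assumes PQ: "spd_inverse d P Q"
  shows "ln (progress t) + ln (g t \<bullet> (Q *\<^sub>v g t) / gap t)
      + potential d Q (B (Suc t)) - potential d Q (B t) + 1 - y t \<bullet> (Q *\<^sub>v y t) / (s t \<bullet> y t)
    \<le> ln (1 - r t)"
proof -
  note st = step[of t]
  note PQ' = spd_inverseD[OF PQ]
  define e where "e = g t \<bullet> (Q *\<^sub>v g t)"
  define b where "b = s t \<bullet> y t"
  define a where "a = slope t"
  have e: "e > 0" unfolding e_def by (rule spdD(3)[OF spd_inverse_spd[OF PQ]]) (use g_nz in auto)
  have b: "b > 0" using st by (simp add: b_def)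
  have a: "a > 0" using slope_pos by (simp add: a_def)
  have pr: "progress t > 0" using progress_ge[of t] worst_progress_pos by linarith
  have "(B t *\<^sub>v s t) \<bullet> (Q *\<^sub>v (B t *\<^sub>v s t)) = (\<eta> t)\<^sup>2 * e"
    unfolding st(8) using PQ'(4) by (simp add: mult_mat_vec[OF PQ'(4) g_carrier] e_def power2_eq_square)
  moreover have "potential d Q (B (Suc t)) \<le> potential d Q (B t) + y t \<bullet> (Q *\<^sub>v y t) / b - 1
    + ln ((s t \<bullet> (B t *\<^sub>v s t))\<^sup>2 / ((B t *\<^sub>v s t) \<bullet> (Q *\<^sub>v (B t *\<^sub>v s t)) * b))"
    unfolding B_Suc b_def by (rule potential_decrease_angle[OF PQ spd_B st(2,3,6,7)])
  moreover have "(\<eta> t * a)\<^sup>2 / ((\<eta> t)\<^sup>2 * e * b) = a\<^sup>2 / (e * b)"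
    using eta_pos[of t] by (simp add: power_mult_distrib)
  ultimately have pot: "potential d Q (B (Suc t)) \<le> potential d Q (B t) + y t \<bullet> (Q *\<^sub>v y t) / b - 1
    + ln (a\<^sup>2 / (e * b))" unfolding curvature_eq a_def[symmetric] by simp
  have "1 - r t = (f (x t) - f (x (Suc t))) / gap t"
    using gap_pos[of t] by (simp add: r_def diff_divide_eq_iff)
  also have "\<dots> = progress t * (e / gap t) * (a\<^sup>2 / (e * b))"
    using a b e gap_pos[of t] unfolding progress_def a_def[symmetric] b_def[symmetric]
    by (simp add: power2_eq_square)
  finally have eq: "1 - r t = progress t * (e / gap t) * (a\<^sup>2 / (e * b))" .
  have pos: "e / gap t > 0" "a\<^sup>2 / (e * b) > 0" using e a b gap_pos[of t] by simp_all
  have "ln (1 - r t) = ln (progress t) + ln (e / gap t) + ln (a\<^sup>2 / (e * b))"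
    unfolding eq ln_mult_pos[OF mult_pos_pos[OF pr pos(1)] pos(2)] ln_mult_pos[OF pr pos(1)] ..
  then show ?thesis using pot unfolding e_def b_def by linarith
qed

section \<open>Global linear rate\<close>

lemma kappa_ge_1: "L / \<mu> \<ge> 1"
  using mu_le_L[OF g_carrier g_nz] mu_pos by simp

lemma rate_bounds: "0 < worst_progress \<alpha> \<beta> / (L / \<mu>)" "worst_progress \<alpha> \<beta> / (L / \<mu>) \<le> 1"
proof -
  have k: "0 < L / \<mu>" using kappa_ge_1 by linarith
  have "worst_progress \<alpha> \<beta> \<le> 1 * (L / \<mu>)" using worst_progress_pos(2) kappa_ge_1 by linarith
  then show "0 < worst_progress \<alpha> \<beta> / (L / \<mu>)" "worst_progress \<alpha> \<beta> / (L / \<mu>) \<le> 1"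
    using divide_pos_pos[OF worst_progress_pos(1) k] by (simp_all only: pos_divide_le_eq[OF k])
qed

lemma d_pos: "d > 0"
proof (rule ccontr)
  assume "\<not> d > 0"
  then have "g 0 = 0\<^sub>v d" using carrier_vecD[OF g_carrier[of 0]] by (intro eq_vecI) auto
  then show False using g_nz by blast
qed

text \<open>
  The weight is \<open>L I\<close>: the potential starts at \<open>0\<close>, the error \<open>y\<^sup>T Q y / s\<^sup>T y\<close> is at most \<open>1\<close>
  by cocoercivity, and the gradient dominance is \<open>2 \<mu> / L\<close>.
\<close>
lemma linear_rate: "gap t / gap 0 \<le> (1 - worst_progress \<alpha> \<beta> / (L / \<mu>)) ^ t"
proof (cases "t = 0")
  case False
  let ?P = "L \<cdot>\<^sub>m 1\<^sub>m d" and ?Q = "(1 / L) \<cdot>\<^sub>m 1\<^sub>m d"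
  let ?c = "worst_progress \<alpha> \<beta>"
  have PQ: "spd_inverse d ?P ?Q" by (rule spd_inverse_scaled_one[OF L_pos])
  have Qv: "?Q *\<^sub>v v = (1 / L) \<cdot>\<^sub>v v" if "v \<in> carrier_vec d" for v
    using that by (simp add: smult_mat_vec[of _ d d])
  have q: "ln (?c / (L / \<mu>)) + potential d ?Q (B (Suc i)) - potential d ?Q (B i) \<le> ln (1 - r i)" for i
  proof -
    note st = step[of i]
    have "y i \<bullet> (?Q *\<^sub>v y i) \<le> 1 * (s i \<bullet> y i)"
      unfolding y_def st(4)
    proof (rule gradient_cocoercive[OF PQ])
      fix a :: real and v :: "real vec" assume v: "v \<in> carrier_vec d"
      have "v \<bullet> (Hf (x i + a \<cdot>\<^sub>v s i) *\<^sub>v v) \<le> L * (v \<bullet> v)" by (rule hess_upper) (use v st in auto)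
      then show "v \<bullet> (Hf (x i + a \<cdot>\<^sub>v s i) *\<^sub>v v) \<le> 1 * (v \<bullet> (?P *\<^sub>v v))"
        using v by (simp add: smult_mat_vec[of _ d d])
    qed (use st in auto)
    then have 1: "y i \<bullet> (?Q *\<^sub>v y i) / (s i \<bullet> y i) \<le> 1" using st(7) by simp
    have "2 * (\<mu> / L) \<le> g i \<bullet> (?Q *\<^sub>v g i) / gap i"
    proof -
      have "2 * \<mu> * gap i / L \<le> g i \<bullet> g i / L"
        using polyak_lojasiewicz[OF x_carrier[of i]] L_pos by (intro divide_right_mono) auto
      then have "2 * (\<mu> / L) * gap i \<le> g i \<bullet> (?Q *\<^sub>v g i)" by (simp add: Qv)
      then show ?thesis by (simp only: pos_le_divide_eq[OF gap_pos[of i]])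
    qed
    then have "(?c / 2) * (2 * (\<mu> / L)) \<le> progress i * (g i \<bullet> (?Q *\<^sub>v g i) / gap i)"
      using progress_ge[of i] worst_progress_pos mu_pos L_pos by (intro mult_mono) auto
    then have 2: "?c / (L / \<mu>) \<le> progress i * (g i \<bullet> (?Q *\<^sub>v g i) / gap i)" by simp
    have pp: "progress i > 0" using progress_ge[of i] worst_progress_pos by linarith
    have cpos: "0 < ?c / (L / \<mu>)" using worst_progress_pos mu_pos L_pos by simp
    have qp: "g i \<bullet> (?Q *\<^sub>v g i) / gap i > 0" using 2 cpos pp by (smt (verit) mult_nonneg_nonpos)
    have "ln (?c / (L / \<mu>)) \<le> ln (progress i * (g i \<bullet> (?Q *\<^sub>v g i) / gap i))"
      using 2 cpos by (intro ln_mono) auto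
    also have "\<dots> = ln (progress i) + ln (g i \<bullet> (?Q *\<^sub>v g i) / gap i)" by (rule ln_mult_pos[OF pp qp])
    finally show ?thesis using ln_one_minus_r[OF PQ, of i] 1 by linarith
  qed
  let ?l = "ln (?c / (L / \<mu>))"
  have "(\<Sum>i<t. ?l + potential d ?Q (B (Suc i)) - potential d ?Q (B i)) \<le> (\<Sum>i<t. ln (1 - r i))"
    by (intro sum_mono q)
  moreover have "(\<Sum>i<t. ?l + potential d ?Q (B (Suc i)) - potential d ?Q (B i))
      = t * ?l + (\<Sum>i<t. potential d ?Q (B (Suc i)) - potential d ?Q (B i))"
    by (simp add: sum.distrib sum_subtractf)
  moreover have "\<dots> = t * ?l + potential d ?Q (B t) - potential d ?Q (B 0)"
    using sum_lessThan_telescope[of "\<lambda>i. potential d ?Q (B i)" t] by simp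
  moreover have "potential d ?Q (B 0) = 0" unfolding B0 using L_pos by (intro potential_scaled_one) simp
  moreover have "potential d ?Q (B t) \<ge> 0" by (rule potential_nonneg[OF PQ spd_B])
  ultimately have "- (- (t * ?l)) \<le> (\<Sum>i<t. ln (1 - r i))" by linarith
  then have "(\<Prod>i<t. r i) \<le> (1 - exp (- (- (t * ?l)) / t)) ^ t"
    using False r_bounds by (intro prod_le_of_sum_ln) auto
  also have "exp (- (- (t * ?l)) / t) = ?c / (L / \<mu>)"
    using False worst_progress_pos mu_pos L_pos by simp
  finally show ?thesis by (simp add: prod_r)
qed (use gap_pos[of 0] in simp)

lemma C_le: "C (x t) \<le> C (x 0) * sqrt ((1 - worst_progress \<alpha> \<beta> / (L / \<mu>)) ^ t)"
proof -
  have "C (x t) = M / \<mu> * sqrt (2 * gap 0 / \<mu> * (gap t / gap 0))"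
  proof -
    have "2 * a / \<mu> * (b / a) = 2 * b / \<mu>" if "a \<noteq> 0" for a b :: real using that by simp
    from this[of "gap 0" "gap t"] show ?thesis unfolding C_eq using gap_pos[of 0] by (simp only:)
  qed
  also have "\<dots> = C (x 0) * sqrt (gap t / gap 0)"
    unfolding C_eq real_sqrt_mult[of "2 * gap 0 / \<mu>" "gap t / gap 0"] by (simp only: mult.assoc)
  also have "\<dots> \<le> C (x 0) * sqrt ((1 - worst_progress \<alpha> \<beta> / (L / \<mu>)) ^ t)"
    using linear_rate by (intro mult_left_mono C_nonneg) auto
  finally show ?thesis .
qed

lemma sum_C_le: "(\<Sum>i<t. C (x i)) \<le> 2 / worst_progress \<alpha> \<beta> * (C (x 0) * (L / \<mu>))"
proof -
  let ?c = "worst_progress \<alpha> \<beta>"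
  let ?x = "?c / (L / \<mu>)"
  note x = rate_bounds
  have "(\<Sum>i<t. C (x i)) \<le> C (x 0) * (\<Sum>i<t. sqrt ((1 - ?x) ^ i))"
    unfolding sum_distrib_left by (intro sum_mono C_le)
  also have "\<dots> \<le> C (x 0) * (2 / ?x)"
    by (intro mult_left_mono sum_sqrt_geometric_le x C_nonneg) auto
  finally show ?thesis by (simp add: mult_ac)
qed

section \<open>Summable loss relative to the Hessian at the minimizer\<close>

abbreviation "Ps \<equiv> Hf xs"

lemma spd_inverse_Ps: obtains Q where "spd_inverse d Ps Q"
  using spd_mat_inverse[OF spd_Hf[OF xs_carrier]] spd_Hf[OF xs_carrier] unfolding spd_inverse_def by metis

text \<open>
  The Rayleigh quotient of the pencil of \<open>B\<^sub>t\<close> and the Hessian at the minimizer along the step; it is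
  \<open>1\<close> when the quasi-Newton model is exact in that direction.
\<close>
definition \<rho> :: "nat \<Rightarrow> real" where
  "\<rho> t = (s t \<bullet> (B t *\<^sub>v s t)) / (s t \<bullet> (Ps *\<^sub>v s t))"

lemma sPs_pos: "s t \<bullet> (Ps *\<^sub>v s t) > 0"
  by (rule spdD(3)[OF spd_Hf[OF xs_carrier] step(2,3)])

lemma rho_pos: "\<rho> t > 0"
  unfolding \<rho>_def using sPs_pos[of t] spdD(3)[OF spd_B step(2,3)[of t]] by simp

lemma weighted_cocoercive:
  assumes PQ: "spd_inverse d Ps Q"
  shows "y t \<bullet> (Q *\<^sub>v y t) / (s t \<bullet> y t) \<le> 1 + C (x t)"
proof -
  have "y t \<bullet> (Q *\<^sub>v y t) \<le> (1 + C (x t)) * (s t \<bullet> y t)"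
    unfolding y_def step(4)[of t]
    by (rule step_cocoercive[OF PQ x_carrier step(2)]) (use decreasing[of t] step(4)[of t] in auto)
  then show ?thesis using step(7)[of t] by (simp add: divide_le_eq)
qed

lemma weighted_curvature: "s t \<bullet> (Ps *\<^sub>v s t) \<le> (1 + C (x t)) * (s t \<bullet> y t)"
  unfolding y_def step(4)[of t]
  by (rule step_curvature(1)[OF x_carrier step(2)]) (use decreasing[of t] step(4)[of t] in auto)

lemma omega_rho_le:
  assumes PQ: "spd_inverse d Ps Q"
  shows "omega (\<rho> t) \<le> potential d Q (B t) - potential d Q (B (Suc t)) + 2 * C (x t)"
proof -
  note st = step[of t]
  have C0: "C (x t) \<ge> 0" by (rule C_nonneg) simp
  have "(s t \<bullet> (B t *\<^sub>v s t)) / (s t \<bullet> y t) \<le> \<rho> t * (1 + C (x t))"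
  proof -
    have "s t \<bullet> (B t *\<^sub>v s t) = \<rho> t * (s t \<bullet> (Ps *\<^sub>v s t))" using sPs_pos[of t] by (simp add: \<rho>_def)
    also have "\<dots> \<le> \<rho> t * ((1 + C (x t)) * (s t \<bullet> y t))"
      using weighted_curvature[of t] rho_pos[of t] by (intro mult_left_mono) auto
    finally show ?thesis using st(7) by (simp add: divide_le_eq mult.assoc)
  qed
  moreover have "(s t \<bullet> (B t *\<^sub>v s t)) / (s t \<bullet> y t) > 0" using spdD(3)[OF spd_B st(2,3)] st(7) by simp
  ultimately have "ln ((s t \<bullet> (B t *\<^sub>v s t)) / (s t \<bullet> y t)) \<le> ln (\<rho> t * (1 + C (x t)))"
    by (intro ln_mono) auto
  also have "\<dots> = ln (\<rho> t) + ln (1 + C (x t))" using rho_pos[of t] C0 by (intro ln_mult_pos) auto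
  also have "ln (1 + C (x t)) \<le> C (x t)" by (rule ln_add_one_self_le_self[OF C0])
  finally show ?thesis
    using potential_decrease_ratio[OF PQ spd_B[of t] st(2,3,6,7)] weighted_cocoercive[OF PQ, of t]
    unfolding B_Suc[symmetric] \<rho>_def[symmetric] by (simp add: omega_def)
qed

abbreviation "\<delta> \<equiv> unit_radius \<alpha> \<beta>"

lemma delta: "0 < \<delta>" "\<delta> \<le> 1/4" "4 * \<delta> \<le> 1 - 2 * \<alpha>" "4 * \<delta> \<le> \<beta>"
  using alpha beta by (auto simp: unit_radius_def min_def field_simps)

text \<open>
  The unit step is admissible, hence chosen, and then \<open>slope t = \<rho> t (s\<^sup>T P s)\<close>; Taylor expansion
  bounds the two factors of \<open>progress\<close> in terms of \<open>\<rho> t\<close>.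
\<close>
lemma good_step_progress:
  assumes good: "5 * C (x t) \<le> \<delta>" "\<bar>\<rho> t - 1\<bar> \<le> \<delta>"
  shows "- 20 * (C (x t) + omega (\<rho> t)) \<le> ln (2 * progress t)"
proof -
  note st = step[of t]
  obtain Q where PQ: "spd_inverse d Ps Q" by (rule spd_inverse_Ps)
  have p: "p t \<in> carrier_vec d" "p t \<noteq> 0\<^sub>v d" "B t *\<^sub>v p t = - g t"
    using direction[OF x_carrier spd_B] by auto
  have "armijo_wolfe \<alpha> \<beta> f Df (x t) (p t) 1"
  proof (rule unit_step_admissible[OF PQ x_carrier p(1,2) _ good(2,1)])
    have "s t \<bullet> (B t *\<^sub>v s t) = (\<eta> t)\<^sup>2 * (- (g t \<bullet> p t))"
    proof -
      have "slope t = - (\<eta> t * (g t \<bullet> p t))" unfolding slope_def st(1) using p(1) by simp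
      then show ?thesis unfolding curvature_eq by (simp add: power2_eq_square)
    qed
    moreover have "s t \<bullet> (Ps *\<^sub>v s t) = (\<eta> t)\<^sup>2 * (p t \<bullet> (Ps *\<^sub>v p t))"
      unfolding st(1) using p(1) by (simp add: mult_mat_vec[OF Hf_carrier[OF xs_carrier]] power2_eq_square)
    ultimately have "\<rho> t = (- (g t \<bullet> p t)) / (p t \<bullet> (Ps *\<^sub>v p t))"
      unfolding \<rho>_def using eta_pos[of t] by simp
    moreover have "p t \<bullet> (Ps *\<^sub>v p t) > 0" by (rule spdD(3)[OF spd_Hf[OF xs_carrier] p(1,2)])
    ultimately show "- (g t \<bullet> p t) = \<rho> t * (p t \<bullet> (Ps *\<^sub>v p t))" by (simp add: field_simps)
  qed (use delta alpha beta in auto)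
  then have eta: "\<eta> t = 1"
    using line_search by (simp add: armijo_wolfe_unit_first_def Let_def p_def)
  define E where "E = s t \<bullet> (Ps *\<^sub>v s t)"
  define c where "c = C (x t)"
  have E: "E > 0" using sPs_pos by (simp add: E_def)
  have c0: "c \<ge> 0" by (simp add: c_def C_nonneg)
  have rho: "\<rho> t > 0" by (rule rho_pos)
  have slope: "slope t = \<rho> t * E"
    using curvature_eq[of t] eta E by (simp add: \<rho>_def E_def)
  obtain a where a: "0 < a" "a < 1"
    "f (x t + s t) = f (x t) + g t \<bullet> s t + (s t \<bullet> (Hf (x t + a \<cdot>\<^sub>v s t) *\<^sub>v s t)) / 2"
    using taylor2[OF x_carrier st(2)] by metis
  have "near c (x t + a \<cdot>\<^sub>v s t)"
    unfolding c_def by (rule near_segment) (use st a decreasing[of t] in auto)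
  then have "s t \<bullet> (Hf (x t + a \<cdot>\<^sub>v s t) *\<^sub>v s t) \<le> (1 + c) * E" unfolding E_def by (rule nearD(1)[OF _ st(2)])
  then have "f (x t) - f (x (Suc t)) \<ge> \<rho> t * E - (1 + c) / 2 * E"
    using a(3) slope by (simp add: st(4)[symmetric] slope_def)
  then have "(f (x t) - f (x (Suc t))) / slope t \<ge> (\<rho> t * E - (1 + c) / 2 * E) / (\<rho> t * E)"
    unfolding slope using rho E by (intro divide_right_mono) auto
  also have "(\<rho> t * E - (1 + c) / 2 * E) / (\<rho> t * E) = 1 - (1 + c) / (2 * \<rho> t)"
    using rho E by (simp add: field_simps)
  finally have P: "1 - (1 + c) / (2 * \<rho> t) \<le> (f (x t) - f (x (Suc t))) / slope t" .
  have N: "1 / ((1 + c) * \<rho> t) \<le> s t \<bullet> y t / slope t"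
  proof -
    have "E / ((1 + c) * (\<rho> t * E)) \<le> ((1 + c) * (s t \<bullet> y t)) / ((1 + c) * (\<rho> t * E))"
      using weighted_curvature[of t] rho E c0 unfolding E_def[symmetric] c_def[symmetric]
      by (intro divide_right_mono) auto
    moreover have "E / ((1 + c) * (\<rho> t * E)) = 1 / ((1 + c) * \<rho> t)" using E by simp
    moreover have "((1 + c) * (s t \<bullet> y t)) / ((1 + c) * (\<rho> t * E)) = s t \<bullet> y t / slope t"
      using c0 unfolding slope by simp
    ultimately show ?thesis by simp
  qed
  have rho': "\<bar>\<rho> t - 1\<bar> \<le> 1/4" and c20: "c \<le> 1/20" using good delta(2) by (auto simp: c_def)
  define V where "V = 2 * ((1 - (1 + c) / (2 * \<rho> t)) * (1 / ((1 + c) * \<rho> t)))"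
  have V: "V > 0" "- 20 * (c + omega (\<rho> t)) \<le> ln V"
    using unit_step_progress[OF c0 c20 rho'] by (simp_all add: V_def)
  have pos: "1 / ((1 + c) * \<rho> t) > 0" using rho c0 by simp
  have half: "0 < q" if "0 < 2 * q" for q :: real using that by simp
  have "1 - (1 + c) / (2 * \<rho> t) > 0"
    by (rule zero_less_mult_pos2[OF half[OF V(1)[unfolded V_def]] pos])
  then have "V \<le> 2 * progress t" unfolding V_def progress_def using P N pos
    by (intro mult_left_mono mult_mono) auto
  then have "ln V \<le> ln (2 * progress t)" using V(1) by (intro ln_mono) auto
  then show ?thesis using V(2) by (simp add: c_def)
qed

abbreviation "K\<^sub>1 \<equiv> loss_const \<alpha> \<beta>"

lemma K1_ge: "20 \<le> K\<^sub>1" by (simp add: loss_const_def)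

text \<open>
  A step outside the range of \<open>good_step_progress\<close> loses a bounded factor only, and
  \<open>C (x t) + omega (\<rho> t)\<close> is bounded away from \<open>0\<close> there.
\<close>
lemma step_progress: "- K\<^sub>1 * (C (x t) + omega (\<rho> t)) \<le> ln (2 * progress t)"
proof (cases "5 * C (x t) \<le> \<delta> \<and> \<bar>\<rho> t - 1\<bar> \<le> \<delta>")
  case True
  have "C (x t) + omega (\<rho> t) \<ge> 0" using C_nonneg[OF x_carrier[of t]] omega_nonneg[OF rho_pos[of t]] by simp
  then have "20 * (C (x t) + omega (\<rho> t)) \<le> K\<^sub>1 * (C (x t) + omega (\<rho> t))"
    by (intro mult_right_mono K1_ge)
  then show ?thesis using good_step_progress[of t] True by simp
next
  case False
  have C0: "C (x t) \<ge> 0" and om: "omega (\<rho> t) \<ge> 0"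
    using C_nonneg[OF x_carrier[of t]] omega_nonneg[OF rho_pos[of t]] by simp_all
  have bad: "\<delta>\<^sup>2 / 9 \<le> C (x t) + omega (\<rho> t)"
  proof (cases "5 * C (x t) \<le> \<delta>")
    case True
    then have "\<delta> < \<bar>\<rho> t - 1\<bar>" using False by simp
    then have "\<delta>\<^sup>2 / 9 \<le> omega (\<rho> t)" using delta by (intro omega_ge_far[OF rho_pos]) auto
    then show ?thesis using C0 by simp
  next
    case False
    have "\<delta>\<^sup>2 \<le> \<delta> * 1" unfolding power2_eq_square using delta by (intro mult_left_mono) auto
    then show ?thesis using False om delta(1) by simp
  qed
  let ?c = "worst_progress \<alpha> \<beta>"
  have "- ln ?c = (- ln ?c * 9 / \<delta>\<^sup>2) * (\<delta>\<^sup>2 / 9)" using delta by simp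
  also have "\<dots> \<le> K\<^sub>1 * (\<delta>\<^sup>2 / 9)" by (intro mult_right_mono) (auto simp: loss_const_def)
  also have "\<dots> \<le> K\<^sub>1 * (C (x t) + omega (\<rho> t))" using K1_ge by (intro mult_left_mono bad) auto
  finally have "- K\<^sub>1 * (C (x t) + omega (\<rho> t)) \<le> ln ?c" by simp
  also have "ln ?c \<le> ln (2 * progress t)" using progress_ge worst_progress_pos by (intro ln_mono) auto
  finally show ?thesis .
qed

text \<open>
  The constant \<open>2\<close> of the gradient dominance is used up by \<open>step_progress\<close>, so that no term proportional
  to the number of steps remains: only the sum of the \<open>C (x i)\<close>, the initial potential, and the sum of the
  \<open>omega (\<rho> i)\<close>, which the first two bound.
\<close>
lemma sum_ln_ge:
  "- (total_const \<alpha> \<beta> * (d * (L / \<mu>) + C (x 0) * (L / \<mu>))) \<le> (\<Sum>i<t. ln (1 - r i))"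
proof -
  obtain Q where PQ: "spd_inverse d Ps Q" by (rule spd_inverse_Ps)
  let ?c = "worst_progress \<alpha> \<beta>"
  let ?pot = "\<lambda>i. potential d Q (B i)"
  have one: "- (3 * K\<^sub>1) * C (x i) - 4 * C (x i) + (K\<^sub>1 + 1) * (?pot (Suc i) - ?pot i) \<le> ln (1 - r i)" for i
  proof -
    have C0: "C (x i) \<ge> 0" by (rule C_nonneg) simp
    have q: "ln 2 - 3 * C (x i) \<le> ln (g i \<bullet> (Q *\<^sub>v g i) / gap i)"
    proof -
      have "2 * gap i / (1 + C (x i)) ^ 3 \<le> g i \<bullet> (Q *\<^sub>v g i)"
        by (rule weighted_gradient_bounds(1)[OF PQ x_carrier])
      then have "2 / (1 + C (x i)) ^ 3 \<le> g i \<bullet> (Q *\<^sub>v g i) / gap i"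
        using gap_pos[of i] by (simp add: pos_le_divide_eq)
      then have "ln (2 / (1 + C (x i)) ^ 3) \<le> ln (g i \<bullet> (Q *\<^sub>v g i) / gap i)"
        using C0 by (intro ln_mono) auto
      moreover have "ln (2 / (1 + C (x i)) ^ 3) = ln 2 - 3 * ln (1 + C (x i))"
        using C0 by (simp add: ln_div ln_realpow)
      moreover have "ln (1 + C (x i)) \<le> C (x i)" by (rule ln_add_one_self_le_self[OF C0])
      ultimately show ?thesis by linarith
    qed
    have "progress i > 0" using progress_ge[of i] worst_progress_pos by linarith
    then have "ln (2 * progress i) = ln 2 + ln (progress i)" by (simp add: ln_mult_pos)
    moreover have "K\<^sub>1 * (C (x i) + omega (\<rho> i)) \<le> K\<^sub>1 * (3 * C (x i) + (?pot i - ?pot (Suc i)))"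
      using omega_rho_le[OF PQ, of i] K1_ge by (intro mult_left_mono) auto
    moreover have "K\<^sub>1 * (3 * C (x i) + (?pot i - ?pot (Suc i)))
        = 3 * K\<^sub>1 * C (x i) - K\<^sub>1 * (?pot (Suc i) - ?pot i)" by (simp add: algebra_simps)
    ultimately show ?thesis
      using step_progress[of i] ln_one_minus_r[OF PQ, of i] q weighted_cocoercive[OF PQ, of i]
      by (simp add: algebra_simps)
  qed
  have tele: "(\<Sum>i<t. ?pot (Suc i) - ?pot i) = ?pot t - ?pot 0" by (rule sum_lessThan_telescope)
  have "(\<Sum>i<t. - (3 * K\<^sub>1) * C (x i) - 4 * C (x i) + (K\<^sub>1 + 1) * (?pot (Suc i) - ?pot i))
      = - (3 * K\<^sub>1 + 4) * (\<Sum>i<t. C (x i)) + (K\<^sub>1 + 1) * (?pot t - ?pot 0)"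
    unfolding tele[symmetric] sum_distrib_left sum.distrib[symmetric]
    by (intro sum.cong) (auto simp: algebra_simps)
  moreover have "(\<Sum>i<t. - (3 * K\<^sub>1) * C (x i) - 4 * C (x i) + (K\<^sub>1 + 1) * (?pot (Suc i) - ?pot i))
      \<le> (\<Sum>i<t. ln (1 - r i))" by (intro sum_mono one)
  ultimately have "- (3 * K\<^sub>1 + 4) * (\<Sum>i<t. C (x i)) + (K\<^sub>1 + 1) * (?pot t - ?pot 0) \<le> (\<Sum>i<t. ln (1 - r i))"
    by simp
  moreover have "(3 * K\<^sub>1 + 4) * (\<Sum>i<t. C (x i)) \<le> total_const \<alpha> \<beta> * (C (x 0) * (L / \<mu>))"
  proof -
    have "(3 * K\<^sub>1 + 4) * (\<Sum>i<t. C (x i)) \<le> (3 * K\<^sub>1 + 4) * (2 / ?c * (C (x 0) * (L / \<mu>)))"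
      using K1_ge by (intro mult_left_mono sum_C_le) auto
    then show ?thesis
      by (simp only: total_const_def times_divide_eq_right times_divide_eq_left mult.assoc)
  qed
  moreover have "(K\<^sub>1 + 1) * (?pot 0 - ?pot t) \<le> total_const \<alpha> \<beta> * (d * (L / \<mu>))"
  proof -
    have "?pot 0 \<le> d * (L / \<mu>)"
      unfolding B0 by (rule potential_init_le[OF PQ mu_pos L_pos]) (simp_all add: hess_lower hess_upper)
    moreover have "?pot t \<ge> 0" by (rule potential_nonneg[OF PQ spd_B])
    ultimately have "?pot 0 - ?pot t \<le> d * (L / \<mu>)" by linarith
    then have "(K\<^sub>1 + 1) * (?pot 0 - ?pot t) \<le> (K\<^sub>1 + 1) * (d * (L / \<mu>))"
      using K1_ge by (intro mult_left_mono) auto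
    also have "\<dots> \<le> total_const \<alpha> \<beta> * (d * (L / \<mu>))"
    proof (rule mult_right_mono)
      have "K\<^sub>1 + 1 \<le> (3 * K\<^sub>1 + 4) * 2 / 1" using K1_ge by simp
      also have "\<dots> \<le> (3 * K\<^sub>1 + 4) * 2 / ?c"
        using K1_ge worst_progress_pos by (intro divide_left_mono) auto
      finally show "K\<^sub>1 + 1 \<le> total_const \<alpha> \<beta>" by (simp add: total_const_def)
    qed (use L_pos mu_pos in auto)
    finally show ?thesis .
  qed
  ultimately show ?thesis by (simp add: algebra_simps)
qed

end

section \<open>The iteration bound\<close>

theorem mainTheorem8:
  fixes \<alpha> \<beta> :: real
  assumes "0 < \<alpha>" and "\<alpha> < \<beta>" and "\<beta> < 1" and "\<alpha> < 1/2"
  shows "\<exists>K>0. \<forall>(d::nat) (f :: real vec \<Rightarrow> real) (Df :: real vec \<Rightarrow> real vec)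
      (Hf :: real vec \<Rightarrow> real mat) (\<mu>::real) (L::real) (M::real) (xs :: real vec)
      (x :: nat \<Rightarrow> real vec) (B :: nat \<Rightarrow> real mat) (\<eta> :: nat \<Rightarrow> real).
    \<mu> > 0 \<longrightarrow> L > 0 \<longrightarrow> M > 0 \<longrightarrow>
    twice_differentiable d f Df Hf \<longrightarrow>
    strongly_convex d \<mu> f \<longrightarrow>
    lipschitz_gradient d L Df \<longrightarrow>
    lipschitz_hessian d M Hf \<longrightarrow>
    is_minimizer d f xs \<longrightarrow>
    bfgs_iterates d Df (L \<cdot>\<^sub>m 1\<^sub>m d) x B \<eta> \<longrightarrow>
    armijo_wolfe_unit_first \<alpha> \<beta> f Df x B \<eta> \<longrightarrow>
    (let \<kappa> = L / \<mu>; C0 = C_const M \<mu> f xs (x 0) in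
      \<forall>\<epsilon>. 0 < \<epsilon> \<and> \<epsilon> < 1 \<longrightarrow>
        (\<forall>t::nat.
          real t \<ge> K * Min {\<kappa> * ln (1 / \<epsilon>),
                            (real d + C0) * \<kappa> + ln (1 / \<epsilon>),
                            ln (1 / \<epsilon>) /
                              ln (1/2 + sqrt (1/4 + 1 / (real d * \<kappa> + C0 * \<kappa>) * ln (1 / \<epsilon>)))} \<longrightarrow>
          (f (x t) - f xs) / (f (x 0) - f xs) \<le> \<epsilon>))"
proof -
  let ?c = "worst_progress \<alpha> \<beta>"
  \<comment> \<open>The three summands serve the bound on the sum of logarithms, the linear rate, and the factor
    \<open>1 - 1 / e\<close> that is reached after \<open>A\<close> steps.\<close>
  define K where "K = total_const \<alpha> \<beta> + 1 / ?c + exp 1"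
  have c: "?c > 0" using assms by (simp add: worst_progress_def)
  have "loss_const \<alpha> \<beta> \<ge> 20" by (simp add: loss_const_def)
  then have tc: "total_const \<alpha> \<beta> > 0" using c by (simp add: total_const_def)
  have e1: "exp 1 \<ge> (1::real)" by simp
  have c': "1 / ?c > 0" using c by simp
  have K: "K \<ge> total_const \<alpha> \<beta>" "K \<ge> 1 / ?c" "K \<ge> exp 1" "K \<ge> 1" "K > 0"
    using c' tc e1 unfolding K_def by linarith+
  show ?thesis
  proof (intro exI[of _ K] conjI K(5) allI impI, unfold Let_def, intro allI impI, elim conjE)
    fix d :: nat and f :: "real vec \<Rightarrow> real" and Df :: "real vec \<Rightarrow> real vec"
      and Hf :: "real vec \<Rightarrow> real mat" and \<mu> L M :: real and xs :: "real vec"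
      and x :: "nat \<Rightarrow> real vec" and B :: "nat \<Rightarrow> real mat" and \<eta> :: "nat \<Rightarrow> real"
      and \<epsilon> :: real and t :: nat
    assume *: "\<mu> > 0" "L > 0" "M > 0" "twice_differentiable d f Df Hf" "strongly_convex d \<mu> f"
      "lipschitz_gradient d L Df" "lipschitz_hessian d M Hf" "is_minimizer d f xs"
      "bfgs_iterates d Df (L \<cdot>\<^sub>m 1\<^sub>m d) x B \<eta>" "armijo_wolfe_unit_first \<alpha> \<beta> f Df x B \<eta>"
    assume eps: "0 < \<epsilon>" "\<epsilon> < 1"
    let ?k = "L / \<mu>" and ?C0 = "C_const M \<mu> f xs (x 0)" and ?l = "ln (1 / \<epsilon>)"
    let ?m1 = "?k * ?l" and ?m2 = "(real d + ?C0) * ?k + ?l"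
      and ?m3 = "?l / ln (1/2 + sqrt (1/4 + 1 / (real d * ?k + ?C0 * ?k) * ?l))"
    assume t: "real t \<ge> K * Min {?m1, ?m2, ?m3}"
    interpret bfgs_run d f Df Hf \<mu> L M xs \<alpha> \<beta> x B \<eta>
      by unfold_locales (use * assms in auto)
    have l: "?l > 0" using eps by simp
    have eps_l: "exp (- ?l) = \<epsilon>" using eps by (simp add: ln_div)
    have k: "?k \<ge> 1" by (rule kappa_ge_1)
    have C0: "?C0 \<ge> 0" using C_nonneg[OF x_carrier[of 0]] by (simp add: C_def)
    define X where "X = real d * ?k + ?C0 * ?k"
    have X: "X > 0" using d_pos k C0 unfolding X_def by (intro add_pos_nonneg mult_pos_pos mult_nonneg_nonneg) auto
    have "- (K * X) \<le> - (total_const \<alpha> \<beta> * X)" using K(1) X by (simp add: mult_right_mono)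
    also have "\<dots> \<le> (\<Sum>i<t. ln (1 - r i))" using sum_ln_ge[of t] by (simp add: X_def C_def)
    finally have S: "- (K * X) \<le> (\<Sum>i<t. ln (1 - r i))" .
    have rate: "gap t / gap 0 \<le> (1 - exp (- (K * X) / t)) ^ t" if "t > 0"
      using prod_le_of_sum_ln[OF that _ S] r_bounds by (simp add: prod_r)
    have "Min {?m1, ?m2, ?m3} \<in> {?m1, ?m2, ?m3}" by (rule Min_in) auto
    then consider "real t \<ge> K * ?m1" | "real t \<ge> K * ?m2" | "real t \<ge> K * ?m3" using t by auto
    then have "gap t / gap 0 \<le> exp (- ?l)"
    proof cases
      case 1
      have kp: "?k > 0" using k by linarith
      have "?l / (?c / ?k) = 1 / ?c * (?k * ?l)" using c kp by (simp add: field_simps)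
      moreover have "\<dots> \<le> K * (?k * ?l)" 
        using kp l by (intro mult_right_mono[OF K(2)] mult_nonneg_nonneg) linarith+
      ultimately have "(1 - ?c / ?k) ^ t \<le> exp (- ?l)"
        using 1 by (intro linear_threshold rate_bounds) linarith
      then show ?thesis using linear_rate[of t] by linarith
    next
      case 2
      have m2: "?m2 = X + ?l" by (simp add: X_def algebra_simps)
      have Kt: "K * X + K * ?l \<le> t" using 2 unfolding m2 by (simp add: algebra_simps)
      have KX: "K * X > 0" "K * ?l > 0" using K(5) X l by auto
      have tp: "t > 0" using Kt KX by (intro gr0I) auto
      have "exp 1 * ?l \<le> K * ?l" using K(3) l by (intro mult_right_mono) auto
      then have "exp 1 * ?l \<le> t" using Kt KX by linarith
      then have "exp (-1) * (exp 1 * ?l) \<le> exp (-1) * t" by (intro mult_left_mono) auto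
      then have "?l \<le> exp (-1) * t" by (simp add: mult.assoc[symmetric] exp_add[symmetric])
      then have "(1 - exp (- (K * X) / t)) ^ t \<le> exp (- ?l)"
        using KX Kt tp by (intro improved_linear_threshold) auto
      then show ?thesis using rate[OF tp] by linarith
    next
      case 3
      then have "K * (?l / ln (1/2 + sqrt (1/4 + ?l / X))) \<le> real t" by (simp add: X_def)
      note th = superlinear_threshold[OF X l K(4) this]
      show ?thesis using rate[OF th(1)] th(2) by linarith
    qed
    then show "(f (x t) - f xs) / (f (x 0) - f xs) \<le> \<epsilon>" unfolding eps_l .
  qed
qed

end
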